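(* Let $(\mathcal{E},R,\langle\cdot,\cdot\rangle,\partial,\circ)$ be a Courant-Dorfman algebra over $\mathfrak{k}$, let $\mathcal{H}\subseteq\mathcal{E}$ be an $R$-submodule containing $\partial R$ which is an isotropic ideal of $\mathcal{E}$, and let $(\mathcal{V},\nabla)$ be an $\mathcal{H}$-representation of $\mathcal{E}$. If the quotient $R$-module $\mathcal{E}/\mathcal{H}$ is projective, then $$H^{\bullet}(\mathcal{E},\mathcal{H},\mathcal{V})\cong H_{CE}^{\bullet}(\mathcal{E}/\mathcal{H},\mathcal{V}).$$
   Context: Throughout $\mathfrak{k}=\mathbb{R}$ or $\mathbb{C}$; unadorned tensor products are over $\mathfrak{k}$; a hat denotes omission. A Courant-Dorfman algebra $(\mathcal{E},R,\langle\cdot,\cdot\rangle,\partial,\circ)$ consists of a commutative $\mathfrak{k}$-algebra $R$, an $R$-module $\mathcal{E}$, a symmetric $R$-bilinear form $\langle\cdot,\cdot\rangle:\mathcal{E}\otimes_R\mathcal{E}\to R$ (not assumed non-degenerate), a derivation $\partial:R\to\mathcal{E}$ and a $\mathfrak{k}$-bilinear bracket $\circ:\mathcal{E}\otimes\mathcal{E}\to\mathcal{E}$ such that for all $e,e_i\in\mathcal{E}$, $f,g\in R$: (1) $e_1\circ(fe_2)=f(e_1\circ e_2)+\langle e_1,\partial f\rangle e_2$; (2) $\langle e_1,\partial\langle e_2,e_3\rangle\rangle=\langle e_1\circ e_2,e_3\rangle+\langle e_2,e_1\circ e_3\rangle$; (3) $e_1\circ e_2+e_2\circ e_1=\partial\langle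 e_1,e_2\rangle$; (4) $e_1\circ(e_2\circ e_3)=(e_1\circ e_2)\circ e_3+e_2\circ(e_1\circ e_3)$; (5) $\partial f\circ e=0$; (6) $\langle\partial f,\partial g\rangle=0$. The anchor is $\rho(e)f=\langle e,\partial f\rangle$. Isotropic ideal: $\langle\alpha,\beta\rangle=0$ for $\alpha,\beta\in\mathcal{H}$, and $e\circ\alpha,\ \alpha\circ e\in\mathcal{H}$ for $e\in\mathcal{E},\alpha\in\mathcal{H}$. An $\mathcal{H}$-representation of $\mathcal{E}$ is an $R$-module $\mathcal{V}$ with a $\mathfrak{k}$-linear map $e\mapsto\nabla_e$ from $\mathcal{E}$ to $\mathfrak{k}$-linear endomorphisms of $\mathcal{V}$ with $\nabla_{e_1\circ e_2}=\nabla_{e_1}\nabla_{e_2}-\nabla_{e_2}\nabla_{e_1}$, $\nabla_\alpha v=0$, $\nabla_{fe}v=f\nabla_ev$, $\nabla_e(fv)=(\rho(e)f)v+f\nabla_ev$ for $\alpha\in\mathcal{H}$, $e,e_1,e_2\in\mathcal{E}$, $f\in R$, $v\in\mathcal{V}$. $C^n(\mathcal{E},\mathcal{H},\mathcal{V})$ is the space of sequences $\omega=(\omega_0,\dots,\omega_{[n/2]})$ of $\mathfrak{k}$-linear maps $\omega_k:(\otimes^{n-2k}\mathcal{E})\otimes(\odot^k\mathcal{H})\to\mathcal{V}$ ($\odot^k$ the symmetric power over $\mathfrak{k}$; set $\omega_k=0$ for $k>[n/2]$ or $k<0$) such that for all $k$: 1) $\omega_k(e_1,\dots,e_a,e_{a+1},\dots,e_{n-2k};\alpha_1,\dots,\alpha_k)+\omega_k(e_1,\dots,e_{a+1},e_a,\dots,e_{n-2k};\alpha_1,\dots,\alpha_k)=-\omega_{k+1}(e_1,\dots,\widehat{e_a},\widehat{e_{a+1}},\dots,e_{n-2k};\partial\langle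 e_a,e_{a+1}\rangle,\alpha_1,\dots,\alpha_k)$; 2) $\omega_k(e_1,\dots,fe_a,\dots,e_{n-2k};\alpha_1,\dots,\alpha_k)=f\omega_k(e_1,\dots,e_a,\dots,e_{n-2k};\alpha_1,\dots,\alpha_k)+\sum_{b>a}(-1)^{b-a}\langle e_a,e_b\rangle\,\omega_{k+1}(e_1,\dots,\widehat{e_a},\dots,\widehat{e_b},\dots,e_{n-2k};\partial f,\alpha_1,\dots,\alpha_k)$; 3) $\omega_k$ is $R$-linear in each argument from $\mathcal{H}$. The $\mathcal{H}$-standard complex is $C^\bullet(\mathcal{E},\mathcal{H},\mathcal{V})=\bigoplus_nC^n(\mathcal{E},\mathcal{H},\mathcal{V})$ with differential $d=d_0+\delta+d'$, where for $\omega\in C^n(\mathcal{E},\mathcal{H},\mathcal{V})$ and $0\le k\le[(n+1)/2]$: $(d_0\omega)_k(e_1,\dots,e_{n+1-2k};\alpha_1,\dots,\alpha_k)=\sum_a(-1)^{a+1}\nabla_{e_a}\omega_k(\dots,\widehat{e_a},\dots;\alpha_1,\dots,\alpha_k)+\sum_{a<b}(-1)^a\omega_k(\dots,\widehat{e_a},\dots,e_a\circ e_b,\dots;\alpha_1,\dots,\alpha_k)$, with $e_a\circ e_b$ in the place of $e_b$; $(\delta\omega)_k(e_1,\dots,e_{n+1-2k};\alpha_1,\dots,\alpha_k)=\sum_i\omega_{k-1}(\alpha_i,e_1,\dots,e_{n+1-2k};\alpha_1,\dots,\widehat{\alpha_i},\dots,\alpha_k)$ (zero for $k=0$); $(d'\omega)_k(e_1,\dots,e_{n+1-2k};\alpha_1,\dots,\alpha_k)=\sum_{a,i}(-1)^{a+1}\omega_k(\dots,\widehat{e_a},\dots;\alpha_1,\dots,\widehat{\alpha_i},\alpha_i\circ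 e_a,\dots,\alpha_k)$, with $\alpha_i\circ e_a$ in the place of $\alpha_i$. This is a cochain complex; its cohomology is $H^\bullet(\mathcal{E},\mathcal{H},\mathcal{V})$, the $\mathcal{H}$-standard cohomology. $\mathcal{E}/\mathcal{H}$ is a Lie-Rinehart algebra over $R$ with anchor $\rho([e])f=\rho(e)f$ and bracket $[e_1]\circ[e_2]=[e_1\circ e_2]$, acting on $\mathcal{V}$ by $\nabla_{[e]}v=\nabla_ev$. $H^\bullet_{CE}(\mathcal{E}/\mathcal{H},\mathcal{V})$ is the cohomology of its Chevalley-Eilenberg complex $(C^\bullet_{CE}(\mathcal{E}/\mathcal{H},\mathcal{V}),d_{CE})$ of skew-symmetric $R$-multilinear maps from $\mathcal{E}/\mathcal{H}$ to $\mathcal{V}$ with the usual differential. *)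

theory Defs
  imports
    Complex_Main
    "HOL-Algebra.Module"
    "HOL-Library.Function_Algebras"
    "HOL-Library.Multiset"
begin

section \<open>Modules, quotients and projectivity\<close>

text \<open>
  \<open>R\<close>, \<open>E\<close> and \<open>V\<close> are types, with scalar multiplications in the style of \<^locale>\<open>Modules.module\<close>.
  Quotients and cohomology spaces have no type of their own; they are \<open>HOL-Algebra\<close> module records
  with cosets as elements, over the ring \<open>type_ring\<close> of all elements of a type.
\<close>

definition type_ring :: "'r::comm_ring_1 ring"
  where "type_ring = \<lparr>carrier = UNIV, monoid.mult = (*), one = 1, zero = 0, add = (+)\<rparr>"

definition module_homs :: "'r ring \<Rightarrow> ('r, 'a) module \<Rightarrow> ('r, 'b) module \<Rightarrow> ('a \<Rightarrow> 'b) set"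
  where "module_homs R M N = {f \<in> carrier M \<rightarrow> carrier N.
    (\<forall>x\<in>carrier M. \<forall>y\<in>carrier M. f (x \<oplus>\<^bsub>M\<^esub> y) = f x \<oplus>\<^bsub>N\<^esub> f y) \<and>
    (\<forall>r\<in>carrier R. \<forall>x\<in>carrier M. f (r \<odot>\<^bsub>M\<^esub> x) = r \<odot>\<^bsub>N\<^esub> f x)}"

definition module_isomorphic :: "'r ring \<Rightarrow> ('r, 'a) module \<Rightarrow> ('r, 'b) module \<Rightarrow> bool"
  where "module_isomorphic R M N \<longleftrightarrow>
    (\<exists>f\<in>module_homs R M N. bij_betw f (carrier M) (carrier N))"

text \<open>
  The lifting property of a projective module. A definition cannot quantify over all types, so \<open>M\<close>
  ranges over the modules carried by subsets of the type of \<open>P\<close>, and \<open>N\<close> over those carried by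
  sets of functions from that type to \<open>R\<close>, which include the free module on the carrier of \<open>P\<close>.
  Lemma \<open>projective_module_lift\<close> below derives the lifting property for modules in arbitrary types.
\<close>

definition projective_module :: "'r ring \<Rightarrow> ('r, 'p) module \<Rightarrow> bool"
  where "projective_module R P \<longleftrightarrow> module R P \<and>
    (\<forall>(N :: ('r, 'p \<Rightarrow> 'r) module) (M :: ('r, 'p) module).
      module R N \<longrightarrow> module R M \<longrightarrow>
      (\<forall>g\<in>module_homs R N M. \<forall>f\<in>module_homs R P M. g ` carrier N = carrier M \<longrightarrow>
        (\<exists>h\<in>module_homs R P N. \<forall>x\<in>carrier P. g (h x) = f x)))"

text \<open>The free module on \<open>S\<close>: finitely supported functions.\<close>

definition free_module :: "'r ring \<Rightarrow> 'p set \<Rightarrow> ('r, 'p \<Rightarrow> 'r) module"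
  where "free_module R S =
    \<lparr>carrier = {\<phi>. range \<phi> \<subseteq> carrier R \<and> finite {p. \<phi> p \<noteq> \<zero>\<^bsub>R\<^esub>} \<and> {p. \<phi> p \<noteq> \<zero>\<^bsub>R\<^esub>} \<subseteq> S},
     monoid.mult = undefined, one = undefined,
     zero = (\<lambda>p. \<zero>\<^bsub>R\<^esub>),
     add = (\<lambda>\<phi> \<psi> p. \<phi> p \<oplus>\<^bsub>R\<^esub> \<psi> p),
     smult = (\<lambda>r \<phi> p. r \<otimes>\<^bsub>R\<^esub> \<phi> p)\<rparr>"

lemma free_module_module:
  assumes "cring R"
  shows "module R (free_module R S)"
proof -
  interpret R: cring R by fact
  have sub: "finite {p. \<phi> p \<oplus>\<^bsub>R\<^esub> \<psi> p \<noteq> \<zero>\<^bsub>R\<^esub>} \<and> {p. \<phi> p \<oplus>\<^bsub>R\<^esub> \<psi> p \<noteq> \<zero>\<^bsub>R\<^esub>} \<subseteq> S"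
    if "finite {p. \<phi> p \<noteq> \<zero>\<^bsub>R\<^esub>}" "finite {p. \<psi> p \<noteq> \<zero>\<^bsub>R\<^esub>}"
      "{p. \<phi> p \<noteq> \<zero>\<^bsub>R\<^esub>} \<subseteq> S" "{p. \<psi> p \<noteq> \<zero>\<^bsub>R\<^esub>} \<subseteq> S" for \<phi> \<psi> :: "'b \<Rightarrow> 'a"
  proof -
    have "{p. \<phi> p \<oplus>\<^bsub>R\<^esub> \<psi> p \<noteq> \<zero>\<^bsub>R\<^esub>} \<subseteq> {p. \<phi> p \<noteq> \<zero>\<^bsub>R\<^esub>} \<union> {p. \<psi> p \<noteq> \<zero>\<^bsub>R\<^esub>}"
      by auto
    then show ?thesis
      using that by (meson finite_UnI finite_subset le_sup_iff subset_trans)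
  qed
  have subm: "finite {p. r \<otimes>\<^bsub>R\<^esub> \<phi> p \<noteq> \<zero>\<^bsub>R\<^esub>} \<and> {p. r \<otimes>\<^bsub>R\<^esub> \<phi> p \<noteq> \<zero>\<^bsub>R\<^esub>} \<subseteq> S"
    if "r \<in> carrier R" "finite {p. \<phi> p \<noteq> \<zero>\<^bsub>R\<^esub>}" "{p. \<phi> p \<noteq> \<zero>\<^bsub>R\<^esub>} \<subseteq> S"
    for r and \<phi> :: "'b \<Rightarrow> 'a"
  proof -
    have "{p. r \<otimes>\<^bsub>R\<^esub> \<phi> p \<noteq> \<zero>\<^bsub>R\<^esub>} \<subseteq> {p. \<phi> p \<noteq> \<zero>\<^bsub>R\<^esub>}"
      using that(1) by auto
    then show ?thesis
      using that by (meson finite_subset subset_trans)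
  qed
  have ab: "abelian_group (free_module R S)"
  proof (rule abelian_groupI)
    fix \<phi> \<psi>
    assume "\<phi> \<in> carrier (free_module R S)" "\<psi> \<in> carrier (free_module R S)"
    then show "\<phi> \<oplus>\<^bsub>free_module R S\<^esub> \<psi> \<in> carrier (free_module R S)"
      using sub[of \<phi> \<psi>] by (auto simp: free_module_def image_subset_iff)
  next
    fix \<phi>
    assume \<phi>: "\<phi> \<in> carrier (free_module R S)"
    let ?\<psi> = "\<lambda>p. \<ominus>\<^bsub>R\<^esub> \<phi> p"
    have "{p. ?\<psi> p \<noteq> \<zero>\<^bsub>R\<^esub>} \<subseteq> {p. \<phi> p \<noteq> \<zero>\<^bsub>R\<^esub>}"
      using \<phi> by (auto simp: free_module_def)
    then have "finite {p. ?\<psi> p \<noteq> \<zero>\<^bsub>R\<^esub>}" "{p. ?\<psi> p \<noteq> \<zero>\<^bsub>R\<^esub>} \<subseteq> S"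
      using \<phi> by (auto simp: free_module_def intro: finite_subset)
    then have "?\<psi> \<in> carrier (free_module R S)"
      using \<phi> by (auto simp: free_module_def image_subset_iff)
    moreover have "?\<psi> \<oplus>\<^bsub>free_module R S\<^esub> \<phi> = \<zero>\<^bsub>free_module R S\<^esub>"
      using \<phi> by (auto simp: free_module_def image_subset_iff R.l_neg)
    ultimately show "\<exists>\<psi>\<in>carrier (free_module R S). \<psi> \<oplus>\<^bsub>free_module R S\<^esub> \<phi> = \<zero>\<^bsub>free_module R S\<^esub>"
      by blast
  qed (auto simp: free_module_def image_subset_iff R.a_ac)
  show ?thesis
  proof (rule moduleI[OF assms ab])
    fix r \<phi>
    assume "r \<in> carrier R" "\<phi> \<in> carrier (free_module R S)"
    then show "r \<odot>\<^bsub>free_module R S\<^esub> \<phi> \<in> carrier (free_module R S)"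
      using subm[of r \<phi>] by (auto simp: free_module_def image_subset_iff)
  qed (auto simp: free_module_def image_subset_iff R.l_distr R.r_distr R.m_assoc)
qed

definition free_module_extend ::
    "'r ring \<Rightarrow> ('r, 'n) module \<Rightarrow> ('p \<Rightarrow> 'n) \<Rightarrow> ('p \<Rightarrow> 'r) \<Rightarrow> 'n"
  where "free_module_extend R N t \<phi> =
    finsum N (\<lambda>p. \<phi> p \<odot>\<^bsub>N\<^esub> t p) {p. \<phi> p \<noteq> \<zero>\<^bsub>R\<^esub>}"

lemma free_module_extend_eq:
  assumes "module R N" "t \<in> S \<rightarrow> carrier N" "\<phi> \<in> carrier (free_module R S)"
    "finite A" "{p. \<phi> p \<noteq> \<zero>\<^bsub>R\<^esub>} \<subseteq> A" "A \<subseteq> S"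
  shows "free_module_extend R N t \<phi> = finsum N (\<lambda>p. \<phi> p \<odot>\<^bsub>N\<^esub> t p) A"
proof -
  interpret N: module R N by fact
  show ?thesis
    unfolding free_module_extend_def
    using assms(2-) by (intro N.add.finprod_mono_neutral_cong_left)
      (auto simp: free_module_def image_subset_iff subset_iff Pi_iff)
qed

lemma free_module_extend_hom:
  assumes "module R N" "t \<in> S \<rightarrow> carrier N"
  shows "free_module_extend R N t \<in> module_homs R (free_module R S) N"
proof -
  interpret N: module R N by fact
  have F: "module R (free_module R S)"
    by (rule free_module_module) (rule N.R.is_cring)
  interpret F: module R "free_module R S" by (rule F)
  have supp: "finite {p. \<phi> p \<noteq> \<zero>\<^bsub>R\<^esub>}" "{p. \<phi> p \<noteq> \<zero>\<^bsub>R\<^esub>} \<subseteq> S" "\<And>p. \<phi> p \<in> carrier R"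
    if "\<phi> \<in> carrier (free_module R S)" for \<phi>
    using that by (auto simp: free_module_def image_subset_iff)
  show ?thesis
    unfolding module_homs_def
  proof (intro CollectI conjI ballI Pi_I)
    fix \<phi>
    assume "\<phi> \<in> carrier (free_module R S)"
    then show "free_module_extend R N t \<phi> \<in> carrier N"
      using supp[of \<phi>] assms(2) unfolding free_module_extend_def
      by (intro N.finsum_closed) auto
  next
    fix \<phi> \<psi>
    assume \<phi>: "\<phi> \<in> carrier (free_module R S)" and \<psi>: "\<psi> \<in> carrier (free_module R S)"
    let ?A = "{p. \<phi> p \<noteq> \<zero>\<^bsub>R\<^esub>} \<union> {p. \<psi> p \<noteq> \<zero>\<^bsub>R\<^esub>}"
    have A: "finite ?A" "?A \<subseteq> S"
      using supp[OF \<phi>] supp[OF \<psi>] by auto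
    have "free_module_extend R N t (\<phi> \<oplus>\<^bsub>free_module R S\<^esub> \<psi>) =
        finsum N (\<lambda>p. (\<phi> \<oplus>\<^bsub>free_module R S\<^esub> \<psi>) p \<odot>\<^bsub>N\<^esub> t p) ?A"
      using A F.add.m_closed[OF \<phi> \<psi>]
      by (intro free_module_extend_eq[OF assms]) (auto simp: free_module_def)
    also have "\<dots> = finsum N (\<lambda>p. \<phi> p \<odot>\<^bsub>N\<^esub> t p \<oplus>\<^bsub>N\<^esub> \<psi> p \<odot>\<^bsub>N\<^esub> t p) ?A"
    proof -
      have "(\<phi> \<oplus>\<^bsub>free_module R S\<^esub> \<psi>) p \<odot>\<^bsub>N\<^esub> t p = \<phi> p \<odot>\<^bsub>N\<^esub> t p \<oplus>\<^bsub>N\<^esub> \<psi> p \<odot>\<^bsub>N\<^esub> t p" if "p \<in> ?A" for p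
        using that A assms(2) supp(3)[OF \<phi>] supp(3)[OF \<psi>]
        by (subst N.smult_l_distr[symmetric]) (auto simp: free_module_def)
      moreover have "(\<lambda>p. \<phi> p \<odot>\<^bsub>N\<^esub> t p \<oplus>\<^bsub>N\<^esub> \<psi> p \<odot>\<^bsub>N\<^esub> t p) \<in> ?A \<rightarrow> carrier N"
        using A assms(2) supp(3)[OF \<phi>] supp(3)[OF \<psi>] by blast
      ultimately show ?thesis
        by (intro N.finsum_cong') auto
    qed
    also have "\<dots> = finsum N (\<lambda>p. \<phi> p \<odot>\<^bsub>N\<^esub> t p) ?A \<oplus>\<^bsub>N\<^esub> finsum N (\<lambda>p. \<psi> p \<odot>\<^bsub>N\<^esub> t p) ?A"
      using A assms(2) supp(3)[OF \<phi>] supp(3)[OF \<psi>] by (intro N.finsum_addf) blast+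
    also have "\<dots> = free_module_extend R N t \<phi> \<oplus>\<^bsub>N\<^esub> free_module_extend R N t \<psi>"
      using A \<phi> \<psi> by (subst (1 2) free_module_extend_eq[OF assms]) auto
    finally show "free_module_extend R N t (\<phi> \<oplus>\<^bsub>free_module R S\<^esub> \<psi>) =
      free_module_extend R N t \<phi> \<oplus>\<^bsub>N\<^esub> free_module_extend R N t \<psi>" .
  next
    fix r \<phi>
    assume r: "r \<in> carrier R" and \<phi>: "\<phi> \<in> carrier (free_module R S)"
    let ?A = "{p. \<phi> p \<noteq> \<zero>\<^bsub>R\<^esub>}"
    have "free_module_extend R N t (r \<odot>\<^bsub>free_module R S\<^esub> \<phi>) =
        finsum N (\<lambda>p. (r \<odot>\<^bsub>free_module R S\<^esub> \<phi>) p \<odot>\<^bsub>N\<^esub> t p) ?A"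
      using supp[OF \<phi>] r F.smult_closed[OF r \<phi>]
      by (intro free_module_extend_eq[OF assms]) (auto simp: free_module_def)
    also have "\<dots> = finsum N (\<lambda>p. r \<odot>\<^bsub>N\<^esub> (\<phi> p \<odot>\<^bsub>N\<^esub> t p)) ?A"
    proof -
      have "(r \<odot>\<^bsub>free_module R S\<^esub> \<phi>) p \<odot>\<^bsub>N\<^esub> t p = r \<odot>\<^bsub>N\<^esub> (\<phi> p \<odot>\<^bsub>N\<^esub> t p)" if "p \<in> ?A" for p
        using that r assms(2) supp[OF \<phi>]
        by (subst N.smult_assoc1[symmetric]) (auto simp: free_module_def)
      moreover have "(\<lambda>p. r \<odot>\<^bsub>N\<^esub> (\<phi> p \<odot>\<^bsub>N\<^esub> t p)) \<in> ?A \<rightarrow> carrier N"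
        using r assms(2) supp[OF \<phi>] by blast
      ultimately show ?thesis
        by (intro N.finsum_cong') auto
    qed
    also have "\<dots> = r \<odot>\<^bsub>N\<^esub> free_module_extend R N t \<phi>"
      using supp[OF \<phi>] r assms(2) unfolding free_module_extend_def
      by (subst N.finsum_smult_ldistr) auto
    finally show "free_module_extend R N t (r \<odot>\<^bsub>free_module R S\<^esub> \<phi>) =
      r \<odot>\<^bsub>N\<^esub> free_module_extend R N t \<phi>" .
  qed
qed

lemma module_homs_zero:
  assumes "module R M" "module R N" "g \<in> module_homs R M N"
  shows "g \<zero>\<^bsub>M\<^esub> = \<zero>\<^bsub>N\<^esub>"
proof -
  interpret M: module R M by fact
  interpret N: module R N by fact
  have "\<forall>x\<in>carrier M. \<forall>y\<in>carrier M. g (x \<oplus>\<^bsub>M\<^esub> y) = g x \<oplus>\<^bsub>N\<^esub> g y"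
    using assms(3) by (simp add: module_homs_def)
  from this[rule_format, OF M.zero_closed M.zero_closed]
  have "g \<zero>\<^bsub>M\<^esub> \<oplus>\<^bsub>N\<^esub> g \<zero>\<^bsub>M\<^esub> = g \<zero>\<^bsub>M\<^esub>"
    by simp
  moreover have "g \<zero>\<^bsub>M\<^esub> \<in> carrier N"
    using assms(3) unfolding module_homs_def by auto
  ultimately show ?thesis
    by (metis N.add.l_cancel_one)
qed

lemma module_homs_finsum:
  assumes "module R M" "module R N" "g \<in> module_homs R M N" "finite A" "u \<in> A \<rightarrow> carrier M"
  shows "g (finsum M u A) = finsum N (\<lambda>p. g (u p)) A"
  using assms(4,5)
proof (induction A)
  interpret M: module R M by fact
  interpret N: module R N by fact
  case empty
  then show ?case
    using module_homs_zero[OF assms(1-3)] by simp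
next
  interpret M: module R M by fact
  interpret N: module R N by fact
  case (insert a A)
  have g: "g x \<in> carrier N" if "x \<in> carrier M" for x
    using assms(3) that unfolding module_homs_def by auto
  have g_add: "g (x \<oplus>\<^bsub>M\<^esub> y) = g x \<oplus>\<^bsub>N\<^esub> g y" if "x \<in> carrier M" "y \<in> carrier M" for x y
    using assms(3) that unfolding module_homs_def by auto
  have "u a \<in> carrier M" "u \<in> A \<rightarrow> carrier M" "(\<lambda>p. g (u p)) \<in> A \<rightarrow> carrier N"
    using insert.prems g by auto
  then show ?case
    using insert g g_add by (simp add: M.finsum_closed)
qed

lemma module_homs_free_module_extend:
  assumes "module R M" "module R N" "g \<in> module_homs R M N" "t \<in> S \<rightarrow> carrier M"
    "\<phi> \<in> carrier (free_module R S)"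
  shows "g (free_module_extend R M t \<phi>) = free_module_extend R N (\<lambda>p. g (t p)) \<phi>"
proof -
  interpret M: module R M by fact
  interpret N: module R N by fact
  let ?A = "{p. \<phi> p \<noteq> \<zero>\<^bsub>R\<^esub>}"
  have A: "finite ?A" "?A \<subseteq> S" "\<And>p. \<phi> p \<in> carrier R"
    using assms(5) by (auto simp: free_module_def image_subset_iff)
  have "g (free_module_extend R M t \<phi>) = finsum N (\<lambda>p. g (\<phi> p \<odot>\<^bsub>M\<^esub> t p)) ?A"
    unfolding free_module_extend_def using A assms(4)
    by (intro module_homs_finsum[OF assms(1-3)]) blast+
  also have "\<dots> = finsum N (\<lambda>p. \<phi> p \<odot>\<^bsub>N\<^esub> g (t p)) ?A"
  proof (rule N.finsum_cong')
    show "(\<lambda>p. \<phi> p \<odot>\<^bsub>N\<^esub> g (t p)) \<in> ?A \<rightarrow> carrier N"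
      using A assms(3,4) unfolding module_homs_def by blast
    show "g (\<phi> p \<odot>\<^bsub>M\<^esub> t p) = \<phi> p \<odot>\<^bsub>N\<^esub> g (t p)" if "p \<in> ?A" for p
    proof -
      have "t p \<in> carrier M"
        using that A(2) assms(4) by blast
      then show ?thesis
        using A(3) assms(3) unfolding module_homs_def by blast
    qed
  qed simp
  finally show ?thesis
    unfolding free_module_extend_def .
qed

lemma projective_module_lift:
  fixes P :: "('r, 'p) module" and N :: "('r, 'n) module" and M :: "('r, 'm) module"
  assumes proj: "projective_module R P" and N: "module R N" and M: "module R M"
    and g: "g \<in> module_homs R N M" and surj: "g ` carrier N = carrier M"
    and f: "f \<in> module_homs R P M"
  shows "\<exists>h\<in>module_homs R P N. \<forall>x\<in>carrier P. g (h x) = f x"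
proof -
  let ?S = "carrier P"
  let ?F = "free_module R ?S"
  let ?e = "free_module_extend R P (\<lambda>p. p)"
  have P: "module R P"
    using proj unfolding projective_module_def by blast
  interpret P: module R P by (rule P)
  interpret N: module R N by (rule N)
  interpret M: module R M by (rule M)
  have F: "module R ?F"
    by (rule free_module_module) (rule P.R.is_cring)
  have e: "?e \<in> module_homs R ?F P"
    by (rule free_module_extend_hom[OF P]) auto
  have esurj: "?e ` carrier ?F = carrier P"
  proof (intro subset_antisym subsetI)
    fix x
    assume "x \<in> ?e ` carrier ?F"
    then show "x \<in> carrier P"
      using e unfolding module_homs_def by auto
  next
    fix x
    assume x: "x \<in> carrier P"
    let ?\<phi> = "\<lambda>p. if p = x then \<one>\<^bsub>R\<^esub> else \<zero>\<^bsub>R\<^esub>"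
    have \<phi>: "?\<phi> \<in> carrier ?F"
      using x by (auto simp: free_module_def intro: finite_subset[of _ "{x}"])
    have "?e ?\<phi> = finsum P (\<lambda>p. ?\<phi> p \<odot>\<^bsub>P\<^esub> p) {x}"
      using x \<phi> by (intro free_module_extend_eq[OF P]) auto
    also have "\<dots> = x"
      using x by simp
    finally show "x \<in> ?e ` carrier ?F"
      using \<phi> by (metis imageI)
  qed
  have "(\<lambda>x. x) \<in> module_homs R P P"
    unfolding module_homs_def by auto
  then obtain s where s: "s \<in> module_homs R P ?F" "\<And>x. x \<in> carrier P \<Longrightarrow> ?e (s x) = x"
    using proj F P e esurj unfolding projective_module_def by meson
  have fP: "f x \<in> carrier M" if "x \<in> carrier P" for x
    using f that unfolding module_homs_def by auto
  define t where "t p = (SOME y. y \<in> carrier N \<and> g y = f p)" for p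
  have t: "t p \<in> carrier N \<and> g (t p) = f p" if "p \<in> carrier P" for p
  proof -
    have "\<exists>y. y \<in> carrier N \<and> g y = f p"
      using fP[OF that] surj by (metis imageE)
    then show ?thesis
      unfolding t_def by (rule someI_ex)
  qed
  let ?l = "free_module_extend R N t"
  have l: "?l \<in> module_homs R ?F N"
    using t by (intro free_module_extend_hom[OF N]) auto
  have sF: "s x \<in> carrier ?F" if "x \<in> carrier P" for x
    using s(1) that unfolding module_homs_def by auto
  have "(\<lambda>x. ?l (s x)) \<in> module_homs R P N"
    using s(1) l sF unfolding module_homs_def by (auto simp: Pi_iff)
  moreover have "g (?l (s x)) = f x" if x: "x \<in> carrier P" for x
  proof -
    have supp: "{p. s x p \<noteq> \<zero>\<^bsub>R\<^esub>} \<subseteq> carrier P" "\<And>p. s x p \<in> carrier R"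
      using sF[OF x] by (auto simp: free_module_def image_subset_iff)
    have "g (?l (s x)) = free_module_extend R M (\<lambda>p. g (t p)) (s x)"
      using t sF[OF x] by (intro module_homs_free_module_extend[OF N M g]) auto
    also have "\<dots> = free_module_extend R M f (s x)"
      unfolding free_module_extend_def
    proof (rule M.finsum_cong')
      show "(\<lambda>p. s x p \<odot>\<^bsub>M\<^esub> f p) \<in> {p. s x p \<noteq> \<zero>\<^bsub>R\<^esub>} \<rightarrow> carrier M"
        using supp fP by blast
      show "s x p \<odot>\<^bsub>M\<^esub> g (t p) = s x p \<odot>\<^bsub>M\<^esub> f p" if "p \<in> {p. s x p \<noteq> \<zero>\<^bsub>R\<^esub>}" for p
        using that supp t[of p] by auto
    qed simp
    also have "\<dots> = f (?e (s x))"
      using sF[OF x] by (intro module_homs_free_module_extend[OF P M f, symmetric]) auto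
    finally show ?thesis
      using s(2)[OF x] by simp
  qed
  ultimately show ?thesis
    by (intro bexI[where x = "\<lambda>x. ?l (s x)"] ballI)
qed

text \<open>
  The quotient \<open>A / B\<close> of submodules \<open>B \<subseteq> A\<close> of a type carrying the scalar multiplication \<open>s\<close>; its
  elements are the cosets \<open>x + B\<close>. The fields \<open>mult\<close> and \<open>one\<close> belong to the record type only
  because \<open>HOL-Algebra\<close> derives modules from rings.
\<close>

definition quotient_module ::
    "('r \<Rightarrow> 'a \<Rightarrow> 'a) \<Rightarrow> 'a set \<Rightarrow> 'a set \<Rightarrow> ('r, 'a::ab_group_add set) module"
  where "quotient_module s A B =
    \<lparr>carrier = (\<lambda>x. (+) x ` B) ` A,
     monoid.mult = undefined, one = undefined,
     zero = B,
     add = (\<lambda>X Y. \<Union>x\<in>X. \<Union>y\<in>Y. (+) (x + y) ` B),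
     smult = (\<lambda>r X. \<Union>x\<in>X. (+) (s r x) ` B)\<rparr>"

lemma cring_type_ring: "cring (type_ring :: 'r::comm_ring_1 ring)"
proof -
  have "abelian_group (type_ring :: 'r ring)"
  proof (rule abelian_groupI)
    fix x :: 'r
    have "- x \<in> carrier type_ring" "- x \<oplus>\<^bsub>type_ring\<^esub> x = \<zero>\<^bsub>type_ring\<^esub>"
      by (simp_all add: type_ring_def)
    then show "\<exists>y\<in>carrier type_ring. y \<oplus>\<^bsub>type_ring\<^esub> x = \<zero>\<^bsub>type_ring\<^esub>"
      by blast
  qed (simp_all add: type_ring_def algebra_simps)
  moreover have "comm_monoid (type_ring :: 'r ring)"
    by (rule comm_monoidI) (simp_all add: type_ring_def algebra_simps)
  ultimately show ?thesis
    by (rule cringI) (simp_all add: type_ring_def algebra_simps)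
qed

lemma coset_eq_iff:
  fixes B :: "'a::ab_group_add set"
  assumes "0 \<in> B" "\<And>x y. x \<in> B \<Longrightarrow> y \<in> B \<Longrightarrow> x + y \<in> B" "\<And>x. x \<in> B \<Longrightarrow> - x \<in> B"
  shows "(+) x ` B = (+) y ` B \<longleftrightarrow> x - y \<in> B"
proof
  assume "(+) x ` B = (+) y ` B"
  then have "x + 0 \<in> (+) y ` B"
    using assms(1) by blast
  then show "x - y \<in> B"
    by auto
next
  have sub: "(+) x ` B \<subseteq> (+) y ` B" if "x - y \<in> B" for x y
  proof
    fix z
    assume "z \<in> (+) x ` B"
    then obtain b where "b \<in> B" "z = x + b"
      by auto
    then have "z = y + ((x - y) + b)" "(x - y) + b \<in> B"
      using assms(2)[OF that] by simp_all
    then show "z \<in> (+) y ` B"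
      by blast
  qed
  assume "x - y \<in> B"
  moreover from this have "y - x \<in> B"
    using assms(3)[of "x - y"] by simp
  ultimately show "(+) x ` B = (+) y ` B"
    using sub by blast
qed

lemma
  fixes s :: "'r::comm_ring_1 \<Rightarrow> 'a::ab_group_add \<Rightarrow> 'a"
  assumes s: "Modules.module s" and B: "module.subspace s B"
  shows quotient_module_zero: "\<zero>\<^bsub>quotient_module s A B\<^esub> = (+) 0 ` B"
    and quotient_module_add:
      "(+) x ` B \<oplus>\<^bsub>quotient_module s A B\<^esub> (+) y ` B = (+) (x + y) ` B"
    and quotient_module_smult: "r \<odot>\<^bsub>quotient_module s A B\<^esub> (+) x ` B = (+) (s r x) ` B"
proof -
  interpret s: Modules.module s by fact
  have cl: "0 \<in> B" "\<And>x y. x \<in> B \<Longrightarrow> y \<in> B \<Longrightarrow> x + y \<in> B" "\<And>x. x \<in> B \<Longrightarrow> - x \<in> B"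
    using B s.subspace_0 s.subspace_add s.subspace_neg by blast+
  note eq = coset_eq_iff[OF cl]
  show "\<zero>\<^bsub>quotient_module s A B\<^esub> = (+) 0 ` B"
    by (simp add: quotient_module_def)
  have "(+) (x + b + (y + b')) ` B = (+) (x + y) ` B" if "b \<in> B" "b' \<in> B" for b b'
  proof (rule eq[THEN iffD2])
    have "x + b + (y + b') - (x + y) = b + b'"
      by (simp add: algebra_simps)
    then show "x + b + (y + b') - (x + y) \<in> B"
      using cl(2)[OF that] by simp
  qed
  then show "(+) x ` B \<oplus>\<^bsub>quotient_module s A B\<^esub> (+) y ` B = (+) (x + y) ` B"
    using cl(1) by (auto simp: quotient_module_def)
  have "(+) (s r (x + b)) ` B = (+) (s r x) ` B" if "b \<in> B" for b
  proof (rule eq[THEN iffD2])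
    have "s r (x + b) - s r x = s r b"
      by (simp add: s.scale_right_distrib)
    then show "s r (x + b) - s r x \<in> B"
      using s.subspace_scale[OF B that] by simp
  qed
  then show "r \<odot>\<^bsub>quotient_module s A B\<^esub> (+) x ` B = (+) (s r x) ` B"
    using cl(1) by (auto simp: quotient_module_def)
qed

lemma quotient_module_module:
  fixes s :: "'r::comm_ring_1 \<Rightarrow> 'a::ab_group_add \<Rightarrow> 'a"
  assumes s: "Modules.module s" and A: "module.subspace s A" and B: "module.subspace s B"
  shows "module type_ring (quotient_module s A B)"
proof -
  interpret s: Modules.module s by fact
  define c where "c x = (+) x ` B" for x
  let ?Q = "quotient_module s A B"
  have ops: "\<zero>\<^bsub>?Q\<^esub> = c 0" "c x \<oplus>\<^bsub>?Q\<^esub> c y = c (x + y)" "r \<odot>\<^bsub>?Q\<^esub> c x = c (s r x)" for x y r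
    unfolding c_def
    by (rule quotient_module_zero[OF s B] quotient_module_add[OF s B] quotient_module_smult[OF s B])+
  have car: "carrier ?Q = c ` A"
    by (simp add: quotient_module_def c_def)
  have cl: "0 \<in> A" "\<And>x y. x \<in> A \<Longrightarrow> y \<in> A \<Longrightarrow> x + y \<in> A" "\<And>r x. x \<in> A \<Longrightarrow> s r x \<in> A"
    "\<And>x. x \<in> A \<Longrightarrow> - x \<in> A"
    using A s.subspace_0 s.subspace_add s.subspace_scale s.subspace_neg by blast+
  have "abelian_group ?Q"
  proof (rule abelian_groupI)
    fix X
    assume "X \<in> carrier ?Q"
    then obtain x where "x \<in> A" "X = c x"
      unfolding car by auto
    then have "c (- x) \<in> carrier ?Q" "c (- x) \<oplus>\<^bsub>?Q\<^esub> X = \<zero>\<^bsub>?Q\<^esub>"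
      using cl by (simp_all add: car ops)
    then show "\<exists>Y\<in>carrier ?Q. Y \<oplus>\<^bsub>?Q\<^esub> X = \<zero>\<^bsub>?Q\<^esub>"
      by blast
  qed (auto simp: car ops add_ac intro: cl)
  then show ?thesis
    by (rule moduleI[OF cring_type_ring])
      (auto simp: car ops type_ring_def s.scale_right_distrib s.scale_left_distrib intro: cl)
qed

text \<open>The degree \<open>n\<close> cohomology of \<open>C 0 \<rightarrow> C 1 \<rightarrow> C 2 \<rightarrow> \<dots>\<close>.\<close>

definition cohomology ::
    "('k \<Rightarrow> 'c \<Rightarrow> 'c) \<Rightarrow> (nat \<Rightarrow> 'c set) \<Rightarrow> ('c \<Rightarrow> 'c) \<Rightarrow> nat \<Rightarrow> ('k, 'c::ab_group_add set) module"
  where "cohomology s C d n =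
    quotient_module s {x \<in> C n. d x = 0} (case n of 0 \<Rightarrow> {0} | Suc m \<Rightarrow> d ` C m)"


section \<open>Courant-Dorfman algebras and their representations\<close>

definition real_or_complex :: "'k::field itself \<Rightarrow> bool"
  where "real_or_complex _ \<longleftrightarrow>
    (\<exists>\<phi> :: 'k \<Rightarrow> real. bij \<phi> \<and> (\<forall>x y. \<phi> (x + y) = \<phi> x + \<phi> y \<and> \<phi> (x * y) = \<phi> x * \<phi> y)) \<or>
    (\<exists>\<phi> :: 'k \<Rightarrow> complex. bij \<phi> \<and> (\<forall>x y. \<phi> (x + y) = \<phi> x + \<phi> y \<and> \<phi> (x * y) = \<phi> x * \<phi> y))"

text \<open>Every module over a \<open>k\<close>-algebra is a \<open>k\<close>-vector space by restriction of scalars.\<close>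

definition restrict_scalars ::
    "('k \<Rightarrow> 'r::comm_ring_1 \<Rightarrow> 'r) \<Rightarrow> ('r \<Rightarrow> 'm \<Rightarrow> 'm) \<Rightarrow> 'k \<Rightarrow> 'm \<Rightarrow> 'm"
  where "restrict_scalars scaleK s c x = s (scaleK c 1) x"

locale k_algebra = vector_space scaleK
  for scaleK :: "'k::field \<Rightarrow> 'r::comm_ring_1 \<Rightarrow> 'r" (infixr \<open>*\<^sub>K\<close> 75) +
  assumes ground_field: "real_or_complex TYPE('k)"
    and scaleK_mult: "c *\<^sub>K (f * g) = (c *\<^sub>K f) * g"

locale courant_dorfman_algebra = k_algebra scaleK + E: Modules.module scaleE
  for scaleK :: "'k::field \<Rightarrow> 'r::comm_ring_1 \<Rightarrow> 'r" (infixr \<open>*\<^sub>K\<close> 75)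
    and scaleE :: "'r \<Rightarrow> 'e::ab_group_add \<Rightarrow> 'e" (infixr \<open>*\<^sub>E\<close> 75) +
  fixes pairing :: "'e \<Rightarrow> 'e \<Rightarrow> 'r" (\<open>\<langle>_, _\<rangle>\<close>)
    and der :: "'r \<Rightarrow> 'e" (\<open>\<partial>\<close>)
    and bracket :: "'e \<Rightarrow> 'e \<Rightarrow> 'e" (infixl \<open>\<circ>\<^sub>E\<close> 70)
  assumes pairing_sym: "\<langle>e1, e2\<rangle> = \<langle>e2, e1\<rangle>"
    and pairing_linear: "Modules.module_hom scaleE (*) (\<lambda>e2. \<langle>e1, e2\<rangle>)"
    and der_linear: "Vector_Spaces.linear scaleK (restrict_scalars scaleK scaleE) \<partial>"
    and der_mult: "\<partial> (f * g) = f *\<^sub>E \<partial> g + g *\<^sub>E \<partial> f"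
    and bracket_linear_right: "Vector_Spaces.linear
      (restrict_scalars scaleK scaleE) (restrict_scalars scaleK scaleE) (\<lambda>e2. e1 \<circ>\<^sub>E e2)"
    and bracket_linear_left: "Vector_Spaces.linear
      (restrict_scalars scaleK scaleE) (restrict_scalars scaleK scaleE) (\<lambda>e1. e1 \<circ>\<^sub>E e2)"
    and bracket_scale: "e1 \<circ>\<^sub>E (f *\<^sub>E e2) = f *\<^sub>E (e1 \<circ>\<^sub>E e2) + \<langle>e1, \<partial> f\<rangle> *\<^sub>E e2"
    and pairing_invariant: "\<langle>e1, \<partial> \<langle>e2, e3\<rangle>\<rangle> = \<langle>e1 \<circ>\<^sub>E e2, e3\<rangle> + \<langle>e2, e1 \<circ>\<^sub>E e3\<rangle>"
    and bracket_sym: "e1 \<circ>\<^sub>E e2 + e2 \<circ>\<^sub>E e1 = \<partial> \<langle>e1, e2\<rangle>"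
    and bracket_leibniz:
      "e1 \<circ>\<^sub>E (e2 \<circ>\<^sub>E e3) = (e1 \<circ>\<^sub>E e2) \<circ>\<^sub>E e3 + e2 \<circ>\<^sub>E (e1 \<circ>\<^sub>E e3)"
    and bracket_der: "\<partial> f \<circ>\<^sub>E e = 0"
    and pairing_der: "\<langle>\<partial> f, \<partial> g\<rangle> = 0"

definition isotropic_ideal ::
    "('e \<Rightarrow> 'e \<Rightarrow> 'r::zero) \<Rightarrow> ('e \<Rightarrow> 'e \<Rightarrow> 'e) \<Rightarrow> 'e set \<Rightarrow> bool"
  where "isotropic_ideal pairing bracket H \<longleftrightarrow>
    (\<forall>\<alpha>\<in>H. \<forall>\<beta>\<in>H. pairing \<alpha> \<beta> = 0) \<and>
    (\<forall>e. \<forall>\<alpha>\<in>H. bracket e \<alpha> \<in> H \<and> bracket \<alpha> e \<in> H)"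

locale h_representation = V: Modules.module scaleV
  for scaleK :: "'k::field \<Rightarrow> 'r::comm_ring_1 \<Rightarrow> 'r"
    and scaleE :: "'r \<Rightarrow> 'e::ab_group_add \<Rightarrow> 'e" (infixr \<open>*\<^sub>E\<close> 75)
    and pairing :: "'e \<Rightarrow> 'e \<Rightarrow> 'r" (\<open>\<langle>_, _\<rangle>\<close>)
    and der :: "'r \<Rightarrow> 'e" (\<open>\<partial>\<close>)
    and bracket :: "'e \<Rightarrow> 'e \<Rightarrow> 'e" (infixl \<open>\<circ>\<^sub>E\<close> 70)
    and H :: "'e set"
    and scaleV :: "'r \<Rightarrow> 'v::ab_group_add \<Rightarrow> 'v" (infixr \<open>*\<^sub>V\<close> 75)
    and nabla :: "'e \<Rightarrow> 'v \<Rightarrow> 'v" (\<open>\<nabla>\<close>) +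
  assumes nabla_linear_left: "Vector_Spaces.linear
      (restrict_scalars scaleK scaleE) (restrict_scalars scaleK scaleV) (\<lambda>e. \<nabla> e v)"
    and nabla_linear_right: "Vector_Spaces.linear
      (restrict_scalars scaleK scaleV) (restrict_scalars scaleK scaleV) (\<nabla> e)"
    and nabla_bracket: "\<nabla> (e1 \<circ>\<^sub>E e2) v = \<nabla> e1 (\<nabla> e2 v) - \<nabla> e2 (\<nabla> e1 v)"
    and nabla_H: "\<alpha> \<in> H \<Longrightarrow> \<nabla> \<alpha> v = 0"
    and nabla_scale_left: "\<nabla> (f *\<^sub>E e) v = f *\<^sub>V \<nabla> e v"
    and nabla_scale_right: "\<nabla> e (f *\<^sub>V v) = \<langle>e, \<partial> f\<rangle> *\<^sub>V v + f *\<^sub>V \<nabla> e v"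


section \<open>The H-standard complex\<close>

definition omit :: "nat \<Rightarrow> 'a list \<Rightarrow> 'a list"
  where "omit a xs = take a xs @ drop (Suc a) xs"

text \<open>
  A sequence \<open>\<omega>\<close> of maps out of \<open>(\<Otimes>\<^sup>n\<^sup>-\<^sup>2\<^sup>k E) \<otimes> (\<Odot>\<^sup>k H)\<close> is a function \<open>\<omega> k es as\<close> of the list \<open>es\<close> of
  arguments from \<open>E\<close> and of the multiset \<open>as\<close> of arguments from \<open>H\<close> (a monomial of the symmetric
  power), multilinear in each argument. To have unique representatives, \<open>\<omega> k\<close> is zero on arguments
  of the wrong number or outside \<open>H\<close>, in particular for \<open>2 * k > n\<close>. List positions are counted from
  \<open>0\<close>, so a sign \<open>(- 1) ^ (a + 1)\<close> for counting from \<open>1\<close> becomes \<open>(- 1) ^ a\<close>.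
\<close>

type_synonym ('e, 'v) cochain = "nat \<Rightarrow> 'e list \<Rightarrow> 'e multiset \<Rightarrow> 'v"

context
  fixes scaleK :: "'k::field \<Rightarrow> 'r::comm_ring_1 \<Rightarrow> 'r"
    and scaleE :: "'r \<Rightarrow> 'e::ab_group_add \<Rightarrow> 'e" (infixr \<open>*\<^sub>E\<close> 75)
    and pairing :: "'e \<Rightarrow> 'e \<Rightarrow> 'r" (\<open>\<langle>_, _\<rangle>\<close>)
    and der :: "'r \<Rightarrow> 'e" (\<open>\<partial>\<close>)
    and bracket :: "'e \<Rightarrow> 'e \<Rightarrow> 'e" (infixl \<open>\<circ>\<^sub>E\<close> 70)
    and H :: "'e set"
    and scaleV :: "'r \<Rightarrow> 'v::ab_group_add \<Rightarrow> 'v" (infixr \<open>*\<^sub>V\<close> 75)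
    and nabla :: "'e \<Rightarrow> 'v \<Rightarrow> 'v" (\<open>\<nabla>\<close>)
begin

text \<open>
  Linearity over \<open>k\<close> in the arguments from \<open>H\<close> is contained in the linearity over \<open>R\<close> required in
  the last two clauses.
\<close>

definition std_cochains :: "nat \<Rightarrow> ('e, 'v) cochain set"
  where "std_cochains n = {\<omega>.
    (\<forall>k es as. \<not> (length es + 2 * k = n \<and> size as = k \<and> set_mset as \<subseteq> H) \<longrightarrow> \<omega> k es as = 0) \<and>
    (\<forall>k xs ys as. Vector_Spaces.linear
      (restrict_scalars scaleK scaleE) (restrict_scalars scaleK scaleV)
      (\<lambda>e. \<omega> k (xs @ e # ys) as)) \<and>
    (\<forall>k xs e e' ys as. \<omega> k (xs @ e # e' # ys) as + \<omega> k (xs @ e' # e # ys) as =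
      - \<omega> (k + 1) (xs @ ys) (add_mset (\<partial> \<langle>e, e'\<rangle>) as)) \<and>
    (\<forall>k xs f e ys as. \<omega> k (xs @ (f *\<^sub>E e) # ys) as = f *\<^sub>V \<omega> k (xs @ e # ys) as +
      (\<Sum>j<length ys. ((- 1) ^ (j + 1) * \<langle>e, ys ! j\<rangle>) *\<^sub>V
        \<omega> (k + 1) (xs @ omit j ys) (add_mset (\<partial> f) as))) \<and>
    (\<forall>k es as. \<forall>\<alpha>\<in>H. \<forall>\<beta>\<in>H.
      \<omega> k es (add_mset (\<alpha> + \<beta>) as) = \<omega> k es (add_mset \<alpha> as) + \<omega> k es (add_mset \<beta> as)) \<and>
    (\<forall>k es as f. \<forall>\<alpha>\<in>H. \<omega> k es (add_mset (f *\<^sub>E \<alpha>) as) = f *\<^sub>V \<omega> k es (add_mset \<alpha> as))}"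

definition std_d0 :: "('e, 'v) cochain \<Rightarrow> ('e, 'v) cochain"
  where "std_d0 \<omega> k es as =
    (\<Sum>a<length es. (- 1) ^ a *\<^sub>V \<nabla> (es ! a) (\<omega> k (omit a es) as)) +
    (\<Sum>b<length es. \<Sum>a<b. (- 1) ^ (a + 1) *\<^sub>V \<omega> k (omit a (es[b := es ! a \<circ>\<^sub>E es ! b])) as)"

definition std_delta :: "('e, 'v) cochain \<Rightarrow> ('e, 'v) cochain"
  where "std_delta \<omega> k es as =
    (if k = 0 then 0 else \<Sum>\<alpha>\<in>#as. \<omega> (k - 1) (\<alpha> # es) (as - {#\<alpha>#}))"

definition std_d' :: "('e, 'v) cochain \<Rightarrow> ('e, 'v) cochain"
  where "std_d' \<omega> k es as =
    (\<Sum>a<length es. \<Sum>\<alpha>\<in>#as.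
      (- 1) ^ a *\<^sub>V \<omega> k (omit a es) (add_mset (\<alpha> \<circ>\<^sub>E es ! a) (as - {#\<alpha>#})))"

definition std_d :: "('e, 'v) cochain \<Rightarrow> ('e, 'v) cochain"
  where "std_d \<omega> k es as = (if set_mset as \<subseteq> H
    then std_d0 \<omega> k es as + std_delta \<omega> k es as + std_d' \<omega> k es as else 0)"

definition std_cohomology :: "nat \<Rightarrow> ('k, ('e, 'v) cochain set) module"
  where "std_cohomology =
    cohomology (\<lambda>c \<omega> k es as. restrict_scalars scaleK scaleV c (\<omega> k es as)) std_cochains std_d"

end


section \<open>The Chevalley-Eilenberg complex\<close>

text \<open>
  For a Lie-Rinehart algebra given by the \<open>R\<close>-module \<open>L\<close> and the bracket \<open>br\<close>, acting by \<open>act\<close>. The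
  anchor enters the complex only through this action. Cochains are zero on lists of the wrong
  length or outside the carrier.
\<close>

context
  fixes scaleK :: "'k::field \<Rightarrow> 'r::comm_ring_1 \<Rightarrow> 'r"
    and L :: "('r, 'l) module" (structure)
    and br :: "'l \<Rightarrow> 'l \<Rightarrow> 'l"
    and scaleV :: "'r \<Rightarrow> 'v::ab_group_add \<Rightarrow> 'v" (infixr \<open>*\<^sub>V\<close> 75)
    and act :: "'l \<Rightarrow> 'v \<Rightarrow> 'v"
begin

definition ce_cochains :: "nat \<Rightarrow> ('l list \<Rightarrow> 'v) set"
  where "ce_cochains n = {\<eta>.
    (\<forall>xs. \<not> (length xs = n \<and> set xs \<subseteq> carrier L) \<longrightarrow> \<eta> xs = 0) \<and>
    (\<forall>xs ys. \<forall>x\<in>carrier L. \<forall>y\<in>carrier L.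
      \<eta> (xs @ (x \<oplus> y) # ys) = \<eta> (xs @ x # ys) + \<eta> (xs @ y # ys)) \<and>
    (\<forall>f xs ys. \<forall>x\<in>carrier L. \<eta> (xs @ (f \<odot> x) # ys) = f *\<^sub>V \<eta> (xs @ x # ys)) \<and>
    (\<forall>xs i j. i < j \<longrightarrow> j < length xs \<longrightarrow> \<eta> (xs[i := xs ! j, j := xs ! i]) = - \<eta> xs)}"

definition ce_d :: "('l list \<Rightarrow> 'v) \<Rightarrow> 'l list \<Rightarrow> 'v"
  where "ce_d \<eta> xs = (if set xs \<subseteq> carrier L
    then (\<Sum>a<length xs. (- 1) ^ a *\<^sub>V act (xs ! a) (\<eta> (omit a xs))) +
      (\<Sum>b<length xs. \<Sum>a<b.
        (- 1) ^ (a + b) *\<^sub>V \<eta> (br (xs ! a) (xs ! b) # omit a (omit b xs)))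
    else 0)"

definition ce_cohomology :: "nat \<Rightarrow> ('k, ('l list \<Rightarrow> 'v) set) module"
  where "ce_cohomology =
    cohomology (\<lambda>c \<eta> xs. restrict_scalars scaleK scaleV c (\<eta> xs)) ce_cochains ce_d"

end

text \<open>The bracket of \<open>E / H\<close> and its action on \<open>V\<close>, for cosets \<open>X\<close> and \<open>Y\<close> of \<open>H\<close>.\<close>

definition quotient_bracket ::
    "('e \<Rightarrow> 'e \<Rightarrow> 'e::ab_group_add) \<Rightarrow> 'e set \<Rightarrow> 'e set \<Rightarrow> 'e set \<Rightarrow> 'e set"
  where "quotient_bracket bracket H X Y = (\<Union>x\<in>X. \<Union>y\<in>Y. (+) (bracket x y) ` H)"

definition quotient_action :: "('e \<Rightarrow> 'v \<Rightarrow> 'v) \<Rightarrow> 'e set \<Rightarrow> 'v \<Rightarrow> 'v"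
  where "quotient_action nabla X v = the_elem ((\<lambda>e. nabla e v) ` X)"

end

theory Submission
  imports Defs
begin

text \<open>
  Evaluating a cochain on one argument gives operators \<open>\<iota>\<^sub>e\<close> and \<open>\<iota>\<^sub>\<alpha>\<close>, and Cartan's formula
  \<open>\<iota>\<^sub>e d + d \<iota>\<^sub>e = L\<^sub>e\<close> determines \<open>d\<close> by recursion on the arguments from \<open>E\<close>; all identities between
  operators, in particular \<open>d d = 0\<close>, follow by this recursion. A projective quotient splits, so
  there is an \<open>R\<close>-linear projection \<open>p : E \<rightarrow> H\<close>. It gives the homotopy
  \<open>(h \<omega>)\<^sub>k(e\<^sub>1, \<dots>; \<alpha>\<^sub>1, \<dots>) = \<Sum>\<^sub>a \<plusminus> \<omega>\<^sub>k\<^sub>+\<^sub>1(\<dots>, e\<^sub>a omitted, \<dots>; p e\<^sub>a, \<alpha>\<^sub>1, \<dots>)\<close>. Up to terms of higher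
  filtration, \<open>d h + h d\<close> multiplies by the number of arguments from \<open>H\<close>. Dividing by these
  numbers, one makes a cocycle vanish, step by step and within its class, as soon as one argument is
  in \<open>H\<close>. Such cochains are the pullbacks of the Chevalley-Eilenberg cochains of \<open>E / H\<close>.
\<close>

text \<open>Cochains are neither skew nor R-linear in the arguments from E: both conditions fail by
  a value of the next component at some \<partial>f. With explicit sums every identity would drag
  these terms along; in the recursion they appear only as commutators of two contractions. The
  homotopy meets the same obstacle: p does not commute with the bracket, and the error in d h + h d
  moves an argument from E to the H-side. Hence lists are split additively into entries in H and
  entries in the kernel of p, and ordered by the number q of the latter, increasing, and then by the
  number k of arguments on the H-side, decreasing. In degree n the eigenvalue on such a stratum is k
  plus the number of entries in H, that is n - q - k; it is positive on every nonempty stratum with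
  q < n, and invertible because the ground field has characteristic zero. Bijectivity on cohomology
  rests on a single lemma: the correction only uses h d \<omega> = 0, which holds for cocycles and
  also for every \<omega> whose differential is a pullback. The first case gives surjectivity, the
  second injectivity.\<close>

text \<open>The index \<open>k\<close> of a cochain is the size of the multiset, so forms do not carry it.\<close>

type_synonym ('e, 'v) form = "'e list \<Rightarrow> 'e multiset \<Rightarrow> 'v"

section \<open>Sums over a multiset with one element removed\<close>

text \<open>The rest of the multiset is handed to \<open>F\<close>, so nested sums run over ordered
  pairs of distinct positions. These are the sums over i in \<delta> and d'.\<close>

definition removal_sum :: "('a \<Rightarrow> 'a multiset \<Rightarrow> 'v) \<Rightarrow> 'a multiset \<Rightarrow> 'v::comm_monoid_add"
  where "removal_sum F as = (\<Sum>\<alpha>\<in>#as. F \<alpha> (as - {#\<alpha>#}))"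

lemma removal_sum_empty [simp]: "removal_sum F {#} = 0"
  by (simp add: removal_sum_def)

text \<open>Either the displayed copy of \<alpha> is removed, or it stays with the rest: the Leibniz
  rule on the symmetric power.\<close>

lemma removal_sum_add_mset:
  "removal_sum F (add_mset \<alpha> as) = F \<alpha> as + removal_sum (\<lambda>\<beta> bs. F \<beta> (add_mset \<alpha> bs)) as"
proof -
  have "image_mset (\<lambda>\<beta>. F \<beta> (add_mset \<alpha> as - {#\<beta>#})) as =
      image_mset (\<lambda>\<beta>. F \<beta> (add_mset \<alpha> (as - {#\<beta>#}))) as"
    by (rule image_mset_cong) (auto dest!: multi_member_split simp: add_mset_commute[of \<alpha>])
  then show ?thesis
    by (simp add: removal_sum_def)
qed

lemma removal_sum_cong:
  assumes "\<And>\<alpha> bs. as = add_mset \<alpha> bs \<Longrightarrow> F \<alpha> bs = G \<alpha> bs"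
  shows "removal_sum F as = removal_sum G as"
  unfolding removal_sum_def
  by (rule arg_cong[where f = sum_mset], rule image_mset_cong) (simp add: assms)

lemma removal_sum_zero [simp]: "removal_sum (\<lambda>_ _. 0) as = 0"
  by (simp add: removal_sum_def)

lemma removal_sum_add:
  "removal_sum (\<lambda>\<alpha> bs. F \<alpha> bs + G \<alpha> bs) as = removal_sum F as + removal_sum G as"
  by (simp add: removal_sum_def sum_mset.distrib)

lemma removal_sum_additive:
  assumes "f 0 = 0" "\<And>v w. f (v + w) = f v + f w"
  shows "f (removal_sum F as) = removal_sum (\<lambda>\<alpha> bs. f (F \<alpha> bs)) as"
proof -
  have "f (sum_mset M) = sum_mset (image_mset f M)" for M
    by (induction M) (simp_all add: assms)
  then show ?thesis
    by (simp add: removal_sum_def multiset.map_comp comp_def)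
qed

lemma removal_sum_minus:
  fixes F :: "'a \<Rightarrow> 'a multiset \<Rightarrow> 'v::ab_group_add"
  shows "removal_sum (\<lambda>\<alpha> bs. - F \<alpha> bs) as = - removal_sum F as"
  by (rule removal_sum_additive[where f = uminus, symmetric]) simp_all

lemma removal_sum_diff:
  fixes F :: "'a \<Rightarrow> 'a multiset \<Rightarrow> 'v::ab_group_add"
  shows "removal_sum (\<lambda>\<alpha> bs. F \<alpha> bs - G \<alpha> bs) as = removal_sum F as - removal_sum G as"
  using removal_sum_add[of F "\<lambda>\<alpha> bs. - G \<alpha> bs" as] by (simp add: removal_sum_minus)

text \<open>Ordered pairs of distinct positions cancel in twos; the diagonal does not occur, since
  \<alpha> is gone when \<beta> is chosen. \<open>G\<close> varies in the induction because the new
  element joins its last argument.\<close>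

lemma removal_sum_antisymmetric:
  fixes G :: "'a \<Rightarrow> 'a \<Rightarrow> 'a multiset \<Rightarrow> 'v::ab_group_add"
  assumes "\<And>\<alpha> \<beta> cs. as = add_mset \<alpha> (add_mset \<beta> cs) \<Longrightarrow> G \<alpha> \<beta> cs + G \<beta> \<alpha> cs = 0"
  shows "removal_sum (\<lambda>\<alpha>. removal_sum (G \<alpha>)) as = 0"
  using assms
proof (induction as arbitrary: G)
  case (add \<alpha> as)
  have "removal_sum (\<lambda>\<alpha>. removal_sum (G \<alpha>)) (add_mset \<alpha> as) =
      removal_sum (G \<alpha>) as + removal_sum (\<lambda>\<beta> cs. G \<beta> \<alpha> cs) as +
      removal_sum (\<lambda>\<beta>. removal_sum (\<lambda>\<gamma> cs. G \<beta> \<gamma> (add_mset \<alpha> cs))) as"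
    by (simp add: removal_sum_add_mset removal_sum_add)
  also have "removal_sum (\<lambda>\<beta>. removal_sum (\<lambda>\<gamma> cs. G \<beta> \<gamma> (add_mset \<alpha> cs))) as = 0"
  proof (rule add.IH)
    fix \<beta> \<gamma> cs
    assume "as = add_mset \<beta> (add_mset \<gamma> cs)"
    then show "G \<beta> \<gamma> (add_mset \<alpha> cs) + G \<gamma> \<beta> (add_mset \<alpha> cs) = 0"
      by (intro add.prems) (simp add: add_mset_commute)
  qed
  also have "removal_sum (G \<alpha>) as + removal_sum (\<lambda>\<beta> cs. G \<beta> \<alpha> cs) as =
      removal_sum (\<lambda>_ _. 0) as"
    unfolding removal_sum_add[symmetric] by (rule removal_sum_cong) (simp add: add.prems)
  finally show ?case
    by simp
qed simp

text \<open>The difference of \<open>G\<close> and its transpose is antisymmetric.\<close>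

lemma removal_sum_swap:
  fixes G :: "'a \<Rightarrow> 'a \<Rightarrow> 'a multiset \<Rightarrow> 'v::ab_group_add"
  shows "removal_sum (\<lambda>\<alpha>. removal_sum (G \<alpha>)) as = removal_sum (\<lambda>\<alpha>. removal_sum (\<lambda>\<beta>. G \<beta> \<alpha>)) as"
proof -
  have "(\<lambda>\<alpha>. removal_sum (\<lambda>\<beta> cs. G \<alpha> \<beta> cs - G \<beta> \<alpha> cs)) =
      (\<lambda>\<alpha> bs. removal_sum (G \<alpha>) bs - removal_sum (\<lambda>\<beta>. G \<beta> \<alpha>) bs)"
    by (simp add: fun_eq_iff removal_sum_diff)
  then show ?thesis
    using removal_sum_antisymmetric[of as "\<lambda>\<alpha> \<beta> cs. G \<alpha> \<beta> cs - G \<beta> \<alpha> cs"]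
    by (simp add: removal_sum_diff)
qed


section \<open>Operations on forms\<close>

definition contract :: "'e \<Rightarrow> ('e, 'v) form \<Rightarrow> ('e, 'v) form"
  where "contract x W = (\<lambda>es. W (x # es))"

definition contractH :: "'e \<Rightarrow> ('e, 'v) form \<Rightarrow> ('e, 'v) form"
  where "contractH \<alpha> W = (\<lambda>es as. W es (add_mset \<alpha> as))"

lemma contract_apply: "contract x W es as = W (x # es) as"
  by (simp add: contract_def)

lemma contractH_apply: "contractH \<alpha> W es as = W es (add_mset \<alpha> as)"
  by (simp add: contractH_def)

lemma contractH_contract: "contractH \<alpha> (contract x W) = contract x (contractH \<alpha> W)"
  by (simp add: contract_def contractH_def)

lemma contractH_commute: "contractH \<alpha> (contractH \<beta> W) = contractH \<beta> (contractH \<alpha> W)"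
  by (simp add: contractH_def add_mset_commute)

lemma contract_linear [simp]:
  fixes W :: "('e, 'v::ab_group_add) form"
  shows "contract x (W + W') = contract x W + contract x W'"
    and "contract x (W - W') = contract x W - contract x W'"
    and "contract x (- W) = - contract x W"
    and "contract x (0 :: ('e, 'v) form) = 0"
  by (simp_all add: contract_def fun_eq_iff)

lemma contractH_linear [simp]:
  fixes W :: "('e, 'v::ab_group_add) form"
  shows "contractH \<alpha> (W + W') = contractH \<alpha> W + contractH \<alpha> W'"
    and "contractH \<alpha> (W - W') = contractH \<alpha> W - contractH \<alpha> W'"
    and "contractH \<alpha> (- W) = - contractH \<alpha> W"
    and "contractH \<alpha> (0 :: ('e, 'v) form) = 0"
  by (simp_all add: contractH_def fun_eq_iff)

text \<open>
  All operators below are determined by their values on the empty list and by their commutation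
  with \<open>contract\<close>, so identities between them follow by the next two rules.
\<close>

lemma form_operator_eqI:
  fixes F G :: "('e, 'v::ab_group_add) form \<Rightarrow> ('e, 'v) form"
  assumes "P W"
    and base: "\<And>W as. P W \<Longrightarrow> F W [] as = G W [] as"
    and step: "\<And>W x. P W \<Longrightarrow> P (contract x W) \<and>
      contract x (F W) - F (contract x W) = contract x (G W) - G (contract x W)"
  shows "F W = G W"
proof (intro ext)
  fix es as
  show "F W es as = G W es as"
    using \<open>P W\<close>
  proof (induction es arbitrary: W)
    case (Cons x es)
    have "(contract x (F W) - F (contract x W)) es as = (contract x (G W) - G (contract x W)) es as"
      using step[OF Cons.prems] by simp
    moreover have "F (contract x W) es as = G (contract x W) es as"
      using step[OF Cons.prems] by (intro Cons.IH) simp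
    ultimately show ?case
      by (simp add: contract_apply)
  qed (simp add: base)
qed

text \<open>Meant for operators of odd degree, whose graded commutator with \<open>contract\<close>
  is an anticommutator; the rule with differences serves the even ones.\<close>

lemma form_operator_eqI':
  fixes F G :: "('e, 'v::ab_group_add) form \<Rightarrow> ('e, 'v) form"
  assumes "P W"
    and base: "\<And>W as. P W \<Longrightarrow> F W [] as = G W [] as"
    and step: "\<And>W x. P W \<Longrightarrow> P (contract x W) \<and>
      contract x (F W) + F (contract x W) = contract x (G W) + G (contract x W)"
  shows "F W = G W"
proof (intro ext)
  fix es as
  show "F W es as = G W es as"
    using \<open>P W\<close>
  proof (induction es arbitrary: W)
    case (Cons x es)
    have "(contract x (F W) + F (contract x W)) es as = (contract x (G W) + G (contract x W)) es as"
      using step[OF Cons.prems] by simp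
    moreover have "F (contract x W) es as = G (contract x W) es as"
      using step[OF Cons.prems] by (intro Cons.IH) simp
    ultimately show ?case
      by (simp add: contract_apply)
  qed (simp add: base)
qed

locale h_complex =
  courant_dorfman_algebra scaleK scaleE pairing der bracket +
  h_representation scaleK scaleE pairing der bracket H scaleV nabla
  for scaleK :: "'k::field \<Rightarrow> 'r::comm_ring_1 \<Rightarrow> 'r" (infixr \<open>*\<^sub>K\<close> 75)
    and scaleE :: "'r \<Rightarrow> 'e::ab_group_add \<Rightarrow> 'e" (infixr \<open>*\<^sub>E\<close> 75)
    and pairing :: "'e \<Rightarrow> 'e \<Rightarrow> 'r" (\<open>\<langle>_, _\<rangle>\<close>)
    and der :: "'r \<Rightarrow> 'e" (\<open>\<partial>\<close>)
    and bracket :: "'e \<Rightarrow> 'e \<Rightarrow> 'e" (infixl \<open>\<circ>\<^sub>E\<close> 70)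
    and H :: "'e set"
    and scaleV :: "'r \<Rightarrow> 'v::ab_group_add \<Rightarrow> 'v" (infixr \<open>*\<^sub>V\<close> 75)
    and nabla :: "'e \<Rightarrow> 'v \<Rightarrow> 'v" (\<open>\<nabla>\<close>) +
  assumes subspace_H: "E.subspace H"
    and range_der: "range \<partial> \<subseteq> H"
    and ideal_H: "isotropic_ideal pairing bracket H"
begin

section \<open>Elementary identities of the pairing, the bracket and the connection\<close>

lemma H_closed [simp, intro]:
  "0 \<in> H" "\<alpha> \<in> H \<Longrightarrow> \<beta> \<in> H \<Longrightarrow> \<alpha> + \<beta> \<in> H" "\<alpha> \<in> H \<Longrightarrow> f *\<^sub>E \<alpha> \<in> H" "\<alpha> \<in> H \<Longrightarrow> - \<alpha> \<in> H"
  "\<alpha> \<in> H \<Longrightarrow> \<beta> \<in> H \<Longrightarrow> \<alpha> - \<beta> \<in> H" "\<partial> f \<in> H" "\<alpha> \<in> H \<Longrightarrow> e \<circ>\<^sub>E \<alpha> \<in> H" "\<alpha> \<in> H \<Longrightarrow> \<alpha> \<circ>\<^sub>E e \<in> H"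
  using ideal_H range_der unfolding isotropic_ideal_def
  by (simp_all add: E.subspace_0[OF subspace_H] E.subspace_add[OF subspace_H]
    E.subspace_scale[OF subspace_H] E.subspace_neg[OF subspace_H] E.subspace_diff[OF subspace_H]
    image_subset_iff)

lemma pairing_H: "\<alpha> \<in> H \<Longrightarrow> \<beta> \<in> H \<Longrightarrow> \<langle>\<alpha>, \<beta>\<rangle> = 0"
  using ideal_H unfolding isotropic_ideal_def by blast

lemma pairing_simps [simp]:
  "\<langle>e, x + y\<rangle> = \<langle>e, x\<rangle> + \<langle>e, y\<rangle>" "\<langle>e, f *\<^sub>E x\<rangle> = f * \<langle>e, x\<rangle>"
  "\<langle>x + y, e\<rangle> = \<langle>x, e\<rangle> + \<langle>y, e\<rangle>" "\<langle>f *\<^sub>E x, e\<rangle> = f * \<langle>x, e\<rangle>"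
  using module_hom.add[OF pairing_linear] module_hom.scale[OF pairing_linear]
  by (simp_all add: pairing_sym[of _ e])

lemma der_add: "\<partial> (f + g) = \<partial> f + \<partial> g"
  using Vector_Spaces.linear.axioms(3)[OF der_linear] by (rule module_hom.add)

lemma der_zero [simp]: "\<partial> 0 = 0"
  using der_add[of 0 0] by simp

lemma der_one [simp]: "\<partial> 1 = 0"
  using der_mult[of 1 1] by simp

lemma der_scaleK [simp]: "\<partial> (c *\<^sub>K 1) = 0"
  using module_hom.scale[OF Vector_Spaces.linear.axioms(3)[OF der_linear], of c 1]
  by (simp add: restrict_scalars_def)

lemma bracket_add [simp]:
  "e \<circ>\<^sub>E (x + y) = e \<circ>\<^sub>E x + e \<circ>\<^sub>E y" "(x + y) \<circ>\<^sub>E e = x \<circ>\<^sub>E e + y \<circ>\<^sub>E e"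
  using module_hom.add[OF Vector_Spaces.linear.axioms(3)[OF bracket_linear_right]]
    module_hom.add[OF Vector_Spaces.linear.axioms(3)[OF bracket_linear_left]] by blast+

lemma bracket_zero [simp]: "e \<circ>\<^sub>E 0 = 0" "0 \<circ>\<^sub>E e = 0"
  using bracket_add(1)[of e 0 0] bracket_add(2)[of 0 0 e] by simp_all

lemma bracket_der_right: "e \<circ>\<^sub>E \<partial> f = \<partial> \<langle>e, \<partial> f\<rangle>"
  using bracket_sym[of e "\<partial> f"] by (simp add: bracket_der)

text \<open>Axiom (3) carries the scalar over to the right argument. The last term has no
  counterpart in a Lie-Rinehart algebra; it causes the corrections in
  \<open>lie_scale_left\<close>.\<close>

lemma bracket_scale_left:
  "(f *\<^sub>E e) \<circ>\<^sub>E y = f *\<^sub>E (e \<circ>\<^sub>E y) - \<langle>y, \<partial> f\<rangle> *\<^sub>E e + \<langle>e, y\<rangle> *\<^sub>E \<partial> f"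
proof -
  have "(f *\<^sub>E e) \<circ>\<^sub>E y = \<partial> \<langle>f *\<^sub>E e, y\<rangle> - y \<circ>\<^sub>E (f *\<^sub>E e)"
    using bracket_sym[of "f *\<^sub>E e" y] by (simp add: algebra_simps)
  also have "\<dots> = f *\<^sub>E (\<partial> \<langle>e, y\<rangle> - y \<circ>\<^sub>E e) - \<langle>y, \<partial> f\<rangle> *\<^sub>E e + \<langle>e, y\<rangle> *\<^sub>E \<partial> f"
    by (simp add: bracket_scale der_mult E.scale_right_diff_distrib algebra_simps)
  also have "\<partial> \<langle>e, y\<rangle> - y \<circ>\<^sub>E e = e \<circ>\<^sub>E y"
    using bracket_sym[of e y] by (simp add: algebra_simps)
  finally show ?thesis .
qed

lemma nabla_add [simp]:
  "\<nabla> e (v + w) = \<nabla> e v + \<nabla> e w" "\<nabla> (x + y) v = \<nabla> x v + \<nabla> y v"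
  using module_hom.add[OF Vector_Spaces.linear.axioms(3)[OF nabla_linear_right]]
    module_hom.add[OF Vector_Spaces.linear.axioms(3)[OF nabla_linear_left]] by blast+

lemma nabla_zero [simp]: "\<nabla> e 0 = 0"
  using nabla_add(1)[of e 0 0] by simp

lemma nabla_minus [simp]: "\<nabla> e (- v) = - \<nabla> e v"
  using nabla_add(1)[of e v "- v"] by (simp add: eq_neg_iff_add_eq_0 add.commute)

lemma nabla_diff [simp]: "\<nabla> e (v - w) = \<nabla> e v - \<nabla> e w"
  using nabla_add(1)[of e v "- w"] by simp

definition scale_form :: "'r \<Rightarrow> ('e, 'v) form \<Rightarrow> ('e, 'v) form"
  where "scale_form f W = (\<lambda>es as. f *\<^sub>V W es as)"

lemma scale_form_apply: "scale_form f W es as = f *\<^sub>V W es as"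
  by (simp add: scale_form_def)

lemma scale_form_linear [simp]:
  "scale_form f (W + W') = scale_form f W + scale_form f W'"
  "scale_form f (W - W') = scale_form f W - scale_form f W'"
  "scale_form f (- W) = - scale_form f W"
  "scale_form f 0 = 0"
  "scale_form 0 W = 0"
  by (simp_all add: scale_form_def fun_eq_iff V.scale_right_distrib V.scale_right_diff_distrib)

lemma scale_form_add_left: "scale_form (f + g) W = scale_form f W + scale_form g W"
  by (simp add: scale_form_def fun_eq_iff V.scale_left_distrib)

lemma scale_form_scale_form: "scale_form f (scale_form g W) = scale_form (f * g) W"
  by (simp add: scale_form_def)

lemma contract_scale_form: "contract x (scale_form f W) = scale_form f (contract x W)"
  by (simp add: scale_form_def contract_def)

lemma contractH_scale_form: "contractH \<alpha> (scale_form f W) = scale_form f (contractH \<alpha> W)"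
  by (simp add: scale_form_def contractH_def)

text \<open>The form \<open>\<langle>e, \<cdot>\<rangle> \<and> W\<close>.\<close>

primrec wedge_aux :: "'e \<Rightarrow> 'e list \<Rightarrow> ('e, 'v) form \<Rightarrow> 'e multiset \<Rightarrow> 'v"
  where "wedge_aux e [] W as = 0"
  | "wedge_aux e (x # es) W as = \<langle>e, x\<rangle> *\<^sub>V W es as - wedge_aux e es (contract x W) as"

definition wedge :: "'e \<Rightarrow> ('e, 'v) form \<Rightarrow> ('e, 'v) form"
  where "wedge e W = (\<lambda>es. wedge_aux e es W)"

lemma wedge_Nil [simp]: "wedge e W [] as = 0"
  by (simp add: wedge_def)

lemma contract_wedge: "contract x (wedge e W) = scale_form \<langle>e, x\<rangle> W - wedge e (contract x W)"
  by (simp add: contract_def wedge_def scale_form_def fun_eq_iff)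

lemma wedge_eq_sum:
  "wedge e W es as = (\<Sum>j<length es. ((- 1) ^ j * \<langle>e, es ! j\<rangle>) *\<^sub>V W (omit j es) as)"
proof (induction es arbitrary: W)
  case (Cons x es)
  have "wedge e W (x # es) as = \<langle>e, x\<rangle> *\<^sub>V W es as - wedge e (contract x W) es as"
    using contract_wedge[of x e W] by (simp add: contract_def fun_eq_iff scale_form_def)
  also have "\<dots> = (\<Sum>j<length (x # es).
      ((- 1) ^ j * \<langle>e, (x # es) ! j\<rangle>) *\<^sub>V W (omit j (x # es)) as)"
    unfolding Cons.IH by (simp add: sum.lessThan_Suc_shift omit_def contract_def sum_negf
      del: sum.lessThan_Suc)
  finally show ?case .
qed simp

lemma wedge_linear [simp]:
  "wedge e (W + W') = wedge e W + wedge e W'"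
  "wedge e (- W) = - wedge e W"
  "wedge e (W - W') = wedge e W - wedge e W'"
  "wedge e 0 = 0"
  "wedge (e + e') W = wedge e W + wedge e' W"
  by (simp_all add: wedge_eq_sum fun_eq_iff V.scale_right_distrib V.scale_left_distrib
      V.scale_right_diff_distrib sum.distrib sum_negf sum_subtractf distrib_left)

lemma wedge_zero [simp]: "wedge 0 W = 0"
  using wedge_linear(5)[of 0 0] by simp

lemma contractH_wedge: "contractH \<alpha> (wedge e W) = wedge e (contractH \<alpha> W)"
  by (simp add: wedge_eq_sum contractH_def fun_eq_iff)

lemma wedge_scale_form: "wedge e (scale_form f W) = scale_form f (wedge e W)"
  by (simp add: wedge_eq_sum scale_form_def fun_eq_iff V.scale_sum_right mult.commute)

text \<open>The Lie derivative: \<nabla> on the value, minus a bracket in each argument. Arguments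
  from H receive \<open>e \<circ>\<^sub>E \<alpha>\<close>, whereas d' uses
  \<open>\<alpha> \<circ>\<^sub>E e\<close>; \<open>differential_eq_sum\<close> reconciles the two.
  The test on \<open>as\<close> keeps the value zero outside H.\<close>

primrec lie_aux :: "'e \<Rightarrow> 'e list \<Rightarrow> ('e, 'v) form \<Rightarrow> 'e multiset \<Rightarrow> 'v"
  where "lie_aux e [] W as = (if set_mset as \<subseteq> H
      then \<nabla> e (W [] as) - removal_sum (\<lambda>\<alpha> bs. W [] (add_mset (e \<circ>\<^sub>E \<alpha>) bs)) as else 0)"
  | "lie_aux e (x # es) W as = lie_aux e es (contract x W) as - W (e \<circ>\<^sub>E x # es) as"

definition lie :: "'e \<Rightarrow> ('e, 'v) form \<Rightarrow> ('e, 'v) form"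
  where "lie e W = (\<lambda>es. lie_aux e es W)"

lemma lie_Nil: "lie e W [] as = (if set_mset as \<subseteq> H
    then \<nabla> e (W [] as) - removal_sum (\<lambda>\<alpha> bs. W [] (add_mset (e \<circ>\<^sub>E \<alpha>) bs)) as else 0)"
  by (simp add: lie_def)

lemma contract_lie: "contract x (lie e W) = lie e (contract x W) - contract (e \<circ>\<^sub>E x) W"
  by (simp add: contract_def lie_def fun_eq_iff)

text \<open>Cartan's formula, in the recursive equation, defines the differential.\<close>

primrec differential_aux :: "'e list \<Rightarrow> ('e, 'v) form \<Rightarrow> 'e multiset \<Rightarrow> 'v"
  where "differential_aux [] W as = (if set_mset as \<subseteq> H
      then removal_sum (\<lambda>\<alpha> bs. W [\<alpha>] bs) as else 0)"
  | "differential_aux (x # es) W as = lie x W es as - differential_aux es (contract x W) as"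

definition differential :: "('e, 'v) form \<Rightarrow> ('e, 'v) form"
  where "differential W = (\<lambda>es. differential_aux es W)"

lemma differential_Nil: "differential W [] as = (if set_mset as \<subseteq> H
    then removal_sum (\<lambda>\<alpha> bs. W [\<alpha>] bs) as else 0)"
  by (simp add: differential_def)

lemma contract_differential: "contract x (differential W) = lie x W - differential (contract x W)"
  by (simp add: contract_def differential_def fun_eq_iff)


lemma lie_linear [simp]:
  "lie e (W + W') = lie e W + lie e W'"
  "lie e (- W) = - lie e W"
  "lie e (W - W') = lie e W - lie e W'"
  "lie e 0 = 0"
proof -
  have add: "lie_aux e es (W + W') as = lie_aux e es W as + lie_aux e es W' as" for es W W' as
    by (induction es arbitrary: W W') (simp_all add: removal_sum_add)
  then show add': "lie e (W + W') = lie e W + lie e W'" for W W'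
    by (simp add: lie_def fun_eq_iff)
  show zero: "lie e 0 = 0"
    using add'[of 0 0] by simp
  show minus: "lie e (- W) = - lie e W" for W
    using add'[of W "- W"] zero by (simp add: eq_neg_iff_add_eq_0 add.commute)
  show "lie e (W - W') = lie e W - lie e W'"
    using add'[of W "- W'"] minus[of W'] by simp
qed

lemma differential_linear [simp]:
  "differential (W + W') = differential W + differential W'"
  "differential (- W) = - differential W"
  "differential (W - W') = differential W - differential W'"
  "differential 0 = 0"
proof -
  have add: "differential_aux es (W + W') as = differential_aux es W as + differential_aux es W' as"
    for es W W' as
    by (induction es arbitrary: W W') (simp_all add: removal_sum_add)
  then show add': "differential (W + W') = differential W + differential W'" for W W'
    by (simp add: differential_def fun_eq_iff)
  show zero: "differential 0 = 0"
    using add'[of 0 0] by simp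
  show minus: "differential (- W) = - differential W" for W
    using add'[of W "- W"] zero by (simp add: eq_neg_iff_add_eq_0 add.commute)
  show "differential (W - W') = differential W - differential W'"
    using add'[of W "- W'"] minus[of W'] by simp
qed

section \<open>Commutation with scaling, contraction and wedge\<close>

definition supported :: "('e, 'v) form \<Rightarrow> bool"
  where "supported W \<longleftrightarrow> (\<forall>es as. \<not> set_mset as \<subseteq> H \<longrightarrow> W es as = 0)"

lemma supportedD: "supported W \<Longrightarrow> \<not> set_mset as \<subseteq> H \<Longrightarrow> W es as = 0"
  by (simp add: supported_def)

lemma supported_contract: "supported W \<Longrightarrow> supported (contract x W)"
  by (simp add: supported_def contract_def)

lemma lie_scale_form:
  assumes "supported W"
  shows "lie e (scale_form f W) = scale_form f (lie e W) + scale_form \<langle>e, \<partial> f\<rangle> W"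
proof (rule form_operator_eqI[where P = supported and W = W and
    F = "\<lambda>W. lie e (scale_form f W)" and G = "\<lambda>W. scale_form f (lie e W) + scale_form \<langle>e, \<partial> f\<rangle> W", OF assms])
  fix W as
  assume "supported W"
  then show "lie e (scale_form f W) [] as =
      (scale_form f (lie e W) + scale_form \<langle>e, \<partial> f\<rangle> W) [] as"
    by (simp add: lie_Nil scale_form_apply nabla_scale_right V.scale_right_diff_distrib
      removal_sum_additive[where f = "\<lambda>v. f *\<^sub>V v"] V.scale_right_distrib supportedD)
qed (simp add: contract_lie contract_scale_form supported_contract)

lemma lie_contractH:
  assumes "supported W" "\<alpha> \<in> H"
  shows "lie e (contractH \<alpha> W) = contractH \<alpha> (lie e W) + contractH (e \<circ>\<^sub>E \<alpha>) W"
proof (rule form_operator_eqI[where P = supported and W = W and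
    F = "\<lambda>W. lie e (contractH \<alpha> W)" and G = "\<lambda>W. contractH \<alpha> (lie e W) + contractH (e \<circ>\<^sub>E \<alpha>) W", OF assms(1)])
  fix W as
  assume "supported W"
  then show "lie e (contractH \<alpha> W) [] as = (contractH \<alpha> (lie e W) + contractH (e \<circ>\<^sub>E \<alpha>) W) [] as"
    using assms(2)
    by (simp add: lie_Nil contractH_apply removal_sum_add_mset supportedD add_mset_commute)
qed (simp add: contract_lie contractH_contract[symmetric] supported_contract)

lemma differential_scale_form:
  assumes "supported W"
  shows "differential (scale_form f W) = scale_form f (differential W) + wedge (\<partial> f) W"
proof (rule form_operator_eqI'[where P = supported and W = W and
    F = "\<lambda>W. differential (scale_form f W)" and G = "\<lambda>W. scale_form f (differential W) + wedge (\<partial> f) W", OF assms])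
  fix W x
  assume "supported W"
  then show "supported (contract x W) \<and>
      contract x (differential (scale_form f W)) + differential (scale_form f (contract x W)) =
      contract x (scale_form f (differential W) + wedge (\<partial> f) W) +
      (scale_form f (differential (contract x W)) + wedge (\<partial> f) (contract x W))"
    by (simp add: supported_contract contract_differential contract_scale_form contract_wedge
      lie_scale_form pairing_sym[of x])
qed (simp add: differential_Nil scale_form_apply removal_sum_additive[where f = "\<lambda>v. f *\<^sub>V v"]
  V.scale_right_distrib)

text \<open>The recursive step is axiom (2), the invariance of the pairing, applied to e and the
  stripped argument.\<close>

lemma lie_wedge:
  assumes "supported W"
  shows "lie x (wedge e W) = wedge e (lie x W) + wedge (x \<circ>\<^sub>E e) W"
  by (rule form_operator_eqI'[where P = supported and W = W and
    F = "\<lambda>W. lie x (wedge e W)" and G = "\<lambda>W. wedge e (lie x W) + wedge (x \<circ>\<^sub>E e) W", OF assms])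
    (simp_all add: lie_Nil supported_contract contract_lie contract_wedge lie_scale_form
      pairing_invariant scale_form_add_left)


section \<open>Cochains\<close>

text \<open>The fourth clause is condition 2) with its sum over later arguments written as a wedge.
  It contains linearity over the ground field, because \<partial> kills the constants. The clauses
  on H speak of the empty list only; the other lists are reached through contractions.\<close>

definition cochain_head :: "('e, 'v) form \<Rightarrow> bool"
  where "cochain_head W \<longleftrightarrow>
    (\<forall>as. \<not> set_mset as \<subseteq> H \<longrightarrow> W [] as = 0) \<and>
    (\<forall>x y. contract (x + y) W = contract x W + contract y W) \<and>
    (\<forall>x y. contract x (contract y W) + contract y (contract x W) = - contractH (\<partial> \<langle>x, y\<rangle>) W) \<and>
    (\<forall>f x. contract (f *\<^sub>E x) W = scale_form f (contract x W) - wedge x (contractH (\<partial> f) W)) \<and>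
    (\<forall>\<alpha>\<in>H. \<forall>\<beta>\<in>H. \<forall>as. W [] (add_mset (\<alpha> + \<beta>) as) = W [] (add_mset \<alpha> as) + W [] (add_mset \<beta> as)) \<and>
    (\<forall>f. \<forall>\<alpha>\<in>H. \<forall>as. W [] (add_mset (f *\<^sub>E \<alpha>) as) = f *\<^sub>V W [] (add_mset \<alpha> as))"

text \<open>
  The defining conditions of a cochain, required in the first argument only, for all contractions.
\<close>

coinductive cochain :: "('e, 'v) form \<Rightarrow> bool"
  where "cochain_head W \<Longrightarrow> (\<And>x. cochain (contract x W)) \<Longrightarrow> cochain W"

lemma cochain_head: "cochain W \<Longrightarrow> cochain_head W"
  and cochain_contract: "cochain W \<Longrightarrow> cochain (contract x W)"
  by (auto elim: cochain.cases)

section \<open>Closure of the cochains under the operators\<close>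

lemma cochain_head_add:
  assumes "cochain_head V" "cochain_head W"
  shows "cochain_head (V + W)"
  unfolding cochain_head_def
proof (intro conjI allI)
  fix x y
  have "contract x (contract y (V + W)) + contract y (contract x (V + W)) =
      (contract x (contract y V) + contract y (contract x V)) +
      (contract x (contract y W) + contract y (contract x W))"
    by simp
  also have "\<dots> = - contractH (\<partial> \<langle>x, y\<rangle>) (V + W)"
    using assms by (simp add: cochain_head_def)
  finally show "contract x (contract y (V + W)) + contract y (contract x (V + W)) =
      - contractH (\<partial> \<langle>x, y\<rangle>) (V + W)" .
qed (use assms in \<open>auto simp: cochain_head_def V.scale_right_distrib\<close>)

lemma cochain_head_scale:
  assumes "cochain_head W"
  shows "cochain_head (scale_form r W)"
  unfolding cochain_head_def
proof (intro conjI allI)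
  fix x y
  have "contract x (contract y (scale_form r W)) + contract y (contract x (scale_form r W)) =
      scale_form r (contract x (contract y W) + contract y (contract x W))"
    by (simp add: contract_scale_form)
  also have "\<dots> = - contractH (\<partial> \<langle>x, y\<rangle>) (scale_form r W)"
    using assms by (simp add: cochain_head_def contractH_scale_form)
  finally show "contract x (contract y (scale_form r W)) + contract y (contract x (scale_form r W)) =
      - contractH (\<partial> \<langle>x, y\<rangle>) (scale_form r W)" .
qed (use assms in \<open>auto simp: cochain_head_def scale_form_apply V.scale_right_distrib
    contract_scale_form contractH_scale_form wedge_scale_form scale_form_scale_form mult.commute\<close>)

lemma cochain_coinduct:
  assumes "P W" "\<And>W. P W \<Longrightarrow> cochain_head W" "\<And>W x. P W \<Longrightarrow> P (contract x W)"
  shows "cochain W"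
  using assms by (intro cochain.coinduct[where X = P]) blast+

lemma cochain_zero [simp]: "cochain 0"
  by (rule cochain_coinduct[where P = "\<lambda>W. W = 0"]) (simp_all only: contract_linear, simp add: cochain_head_def)

lemma cochain_add:
  assumes "cochain V" "cochain W"
  shows "cochain (V + W)"
  by (rule cochain_coinduct[where P = "\<lambda>W. \<exists>A B. W = A + B \<and> cochain A \<and> cochain B"])
    (use assms in \<open>blast intro: cochain_head_add cochain_head cochain_contract contract_linear(1)\<close>)+

lemma cochain_scale:
  assumes "cochain W"
  shows "cochain (scale_form r W)"
  by (rule cochain_coinduct[where P = "\<lambda>W. \<exists>V. W = scale_form r V \<and> cochain V"])
    (use assms in \<open>blast intro: cochain_head_scale cochain_head cochain_contract contract_scale_form\<close>)+

lemma cochain_minus: "cochain W \<Longrightarrow> cochain (- W)"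
  using cochain_scale[of W "- 1"] by (simp add: scale_form_def fun_Compl_def)

lemma cochain_diff: "cochain V \<Longrightarrow> cochain W \<Longrightarrow> cochain (V - W)"
  using cochain_add[of V "- W"] by (simp add: cochain_minus)

text \<open>Coinduction up to adding a cochain: for \<open>lie\<close>, \<open>differential\<close>
  and \<open>homotopy\<close> a contraction of \<open>F W\<close> is not again a value of
  \<open>F\<close>, but a value of \<open>F\<close> plus a commutator term already known to be a
  cochain.\<close>

lemma cochain_operatorI:
  assumes "cochain W"
    and head: "\<And>W. cochain W \<Longrightarrow> cochain_head (F W)"
    and step: "\<And>W x. cochain W \<Longrightarrow>
      \<exists>A V. cochain A \<and> cochain V \<and> contract x (F W) = A + F V"
  shows "cochain (F W)"
proof -
  show ?thesis
  proof (rule cochain_coinduct[where P = "\<lambda>W. \<exists>A V. W = A + F V \<and> cochain A \<and> cochain V"])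
    show "\<exists>A V. F W = A + F V \<and> cochain A \<and> cochain V"
      using assms(1) by (intro exI[of _ 0] exI[of _ W]) simp
  next
    fix W
    assume "\<exists>A V. W = A + F V \<and> cochain A \<and> cochain V"
    then show "cochain_head W"
      using cochain_head_add[OF cochain_head head] by blast
  next
    fix W x
    assume "\<exists>A V. W = A + F V \<and> cochain A \<and> cochain V"
    then obtain A V where W: "W = A + F V" "cochain A" "cochain V"
      by blast
    obtain A' V' where "cochain A'" "cochain V'" "contract x (F V) = A' + F V'"
      using step[OF W(3), of x] by blast
    then show "\<exists>A V. contract x W = A + F V \<and> cochain A \<and> cochain V"
      using W cochain_add[OF cochain_contract[OF W(2), of x], of A']
      by (intro exI[of _ "contract x A + A'"] exI[of _ V']) (simp only: contract_linear add.assoc)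
  qed
qed

lemma cochain_supported:
  assumes "cochain W"
  shows "supported W"
proof -
  have "W es as = 0" if "\<not> set_mset as \<subseteq> H" for es as
    using assms
  proof (induction es arbitrary: W)
    case Nil
    then show ?case
      using cochain_head[of W] that by (simp add: cochain_head_def)
  next
    case (Cons x es)
    then show ?case
      using Cons.IH[OF cochain_contract[OF Cons.prems], of x] by (simp add: contract_apply)
  qed
  then show ?thesis
    by (simp add: supported_def)
qed

lemma contract_add_left: "cochain W \<Longrightarrow> contract (x + y) W = contract x W + contract y W"
  using cochain_head[of W] by (simp add: cochain_head_def)

lemma contract_diff_left: "cochain W \<Longrightarrow> contract (x - y) W = contract x W - contract y W"
  using contract_add_left[of W "x - y" y] by simp

lemma contract_zero_left: "cochain W \<Longrightarrow> contract 0 W = 0"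
  using contract_add_left[of W 0 0] by simp

lemma contract_contract:
  "cochain W \<Longrightarrow>
    contract x (contract y W) = - contract y (contract x W) - contractH (\<partial> \<langle>x, y\<rangle>) W"
  using cochain_head[of W] by (simp add: cochain_head_def eq_diff_eq add.commute
      minus_add_distrib[symmetric] eq_neg_iff_add_eq_0) (metis add.commute add.assoc add.right_inverse)

lemma contract_scale_left: "cochain W \<Longrightarrow>
    contract (f *\<^sub>E x) W = scale_form f (contract x W) - wedge x (contractH (\<partial> f) W)"
  using cochain_head[of W] by (simp add: cochain_head_def)

text \<open>\<open>contractH\<close> commutes with \<open>contract\<close>, so the clause of
  \<open>cochain_head\<close> for the empty list spreads to all lists.\<close>

lemma contractH_add_left:
  assumes "cochain W" "\<alpha> \<in> H" "\<beta> \<in> H"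
  shows "contractH (\<alpha> + \<beta>) W = contractH \<alpha> W + contractH \<beta> W"
  by (rule form_operator_eqI[where P = cochain and W = W and F = "\<lambda>W. contractH (\<alpha> + \<beta>) W"
        and G = "\<lambda>W. contractH \<alpha> W + contractH \<beta> W", OF assms(1)])
    (use assms in \<open>simp_all add: cochain_head_def contractH_apply contractH_contract
      cochain_contract cochain_head[unfolded cochain_head_def]\<close>)

lemma contractH_scale_left:
  assumes "cochain W" "\<alpha> \<in> H"
  shows "contractH (f *\<^sub>E \<alpha>) W = scale_form f (contractH \<alpha> W)"
  by (rule form_operator_eqI[where P = cochain and W = W and F = "\<lambda>W. contractH (f *\<^sub>E \<alpha>) W"
        and G = "\<lambda>W. scale_form f (contractH \<alpha> W)", OF assms(1)])
    (use assms in \<open>simp_all add: cochain_head_def contractH_apply contractH_contract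
      scale_form_apply contract_scale_form cochain_contract cochain_head[unfolded cochain_head_def]\<close>)

lemma contractH_zero_left: "cochain W \<Longrightarrow> contractH 0 W = 0"
  using contractH_scale_left[of W 0 0] by simp

lemma contractH_minus_left: "cochain W \<Longrightarrow> \<alpha> \<in> H \<Longrightarrow> contractH (- \<alpha>) W = - contractH \<alpha> W"
  using contractH_add_left[of W \<alpha> "- \<alpha>"]
  by (simp add: contractH_zero_left eq_neg_iff_add_eq_0 add.commute)

lemma contractH_diff_left:
  "cochain W \<Longrightarrow> \<alpha> \<in> H \<Longrightarrow> \<beta> \<in> H \<Longrightarrow> contractH (\<alpha> - \<beta>) W = contractH \<alpha> W - contractH \<beta> W"
  using contractH_add_left[of W \<alpha> "- \<beta>"] by (simp add: contractH_minus_left)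

lemma cochain_contractH:
  assumes "cochain W" "\<alpha> \<in> H"
  shows "cochain (contractH \<alpha> W)"
  using assms(1)
proof (rule cochain_operatorI)
  fix W
  assume W: "cochain W"
  show "cochain_head (contractH \<alpha> W)"
    unfolding cochain_head_def
  proof (intro conjI allI ballI impI)
    fix x y
    show "contract x (contract y (contractH \<alpha> W)) + contract y (contract x (contractH \<alpha> W)) =
        - contractH (\<partial> \<langle>x, y\<rangle>) (contractH \<alpha> W)"
      using contract_contract[OF W, of x y]
      by (simp add: contractH_contract[symmetric] contractH_commute[of \<alpha> "\<partial> \<langle>x, y\<rangle>"])
  next
    fix as
    assume "\<not> set_mset as \<subseteq> H"
    then show "contractH \<alpha> W [] as = 0"
      using cochain_supported[OF W] by (simp add: contractH_apply supportedD)
  next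
    fix f x
    show "contract (f *\<^sub>E x) (contractH \<alpha> W) =
        scale_form f (contract x (contractH \<alpha> W)) - wedge x (contractH (\<partial> f) (contractH \<alpha> W))"
      unfolding contractH_contract[symmetric] contract_scale_left[OF W]
      by (simp add: contractH_scale_form contractH_wedge contractH_commute[of \<alpha> "\<partial> f"])
  next
    fix \<beta> \<gamma> as
    assume "\<beta> \<in> H" "\<gamma> \<in> H"
    then have "contractH (\<beta> + \<gamma>) W [] (add_mset \<alpha> as) =
        (contractH \<beta> W + contractH \<gamma> W) [] (add_mset \<alpha> as)"
      by (simp only: contractH_add_left[OF W])
    then show "contractH \<alpha> W [] (add_mset (\<beta> + \<gamma>) as) =
        contractH \<alpha> W [] (add_mset \<beta> as) + contractH \<alpha> W [] (add_mset \<gamma> as)"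
      by (simp add: contractH_apply add_mset_commute)
  next
    fix f \<beta> as
    assume "\<beta> \<in> H"
    then have "contractH (f *\<^sub>E \<beta>) W [] (add_mset \<alpha> as) =
        scale_form f (contractH \<beta> W) [] (add_mset \<alpha> as)"
      by (simp only: contractH_scale_left[OF W])
    then show "contractH \<alpha> W [] (add_mset (f *\<^sub>E \<beta>) as) = f *\<^sub>V contractH \<alpha> W [] (add_mset \<beta> as)"
      by (simp add: contractH_apply scale_form_apply add_mset_commute)
  qed (simp add: contractH_contract[symmetric] contract_add_left[OF W])
next
  fix W x
  assume "cochain W"
  then show "\<exists>A V. cochain A \<and> cochain V \<and> contract x (contractH \<alpha> W) = A + contractH \<alpha> V"
    by (intro exI[of _ 0] exI[of _ "contract x W"]) (simp add: contractH_contract cochain_contract)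
qed

text \<open>Moving \<open>lie e\<close> past the contractions turns each clause for \<open>W\<close>
  into the same clause for \<open>lie e W\<close> plus bracket terms. These match because \<open>e
  \<circ>\<^sub>E \<partial> f = \<partial> \<langle>e, \<partial> f\<rangle>\<close> and the
  pairing is invariant.\<close>

lemma cochain_lie:
  assumes "cochain W"
  shows "cochain (lie e W)"
  using assms
proof (rule cochain_operatorI)
  fix W
  assume W: "cochain W"
  note [simp] = cochain_supported cochain_contract cochain_contractH
  have lie_contractH_W: "contractH \<alpha> (lie e W) = lie e (contractH \<alpha> W) - contractH (e \<circ>\<^sub>E \<alpha>) W"
    if "\<alpha> \<in> H" for \<alpha>
    using lie_contractH[of W \<alpha> e] that W by simp
  show "cochain_head (lie e W)"
    unfolding cochain_head_def
  proof (intro conjI allI ballI impI)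
    fix x y
    have "contract x (contract y (lie e W)) + contract y (contract x (lie e W)) =
        lie e (contract x (contract y W) + contract y (contract x W)) -
        (contract (e \<circ>\<^sub>E x) (contract y W) + contract y (contract (e \<circ>\<^sub>E x) W)) -
        (contract x (contract (e \<circ>\<^sub>E y) W) + contract (e \<circ>\<^sub>E y) (contract x W))"
      by (simp add: contract_lie)
    also have "\<dots> = - lie e (contractH (\<partial> \<langle>x, y\<rangle>) W) +
        (contractH (\<partial> \<langle>e \<circ>\<^sub>E x, y\<rangle>) W + contractH (\<partial> \<langle>x, e \<circ>\<^sub>E y\<rangle>) W)"
      by (simp add: contract_contract[OF W, of x y] contract_contract[OF W, of "e \<circ>\<^sub>E x" y]
        contract_contract[OF W, of x "e \<circ>\<^sub>E y"])
    also have "\<dots> = - contractH (\<partial> \<langle>x, y\<rangle>) (lie e W)"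
      by (simp add: lie_contractH_W bracket_der_right pairing_invariant der_add
        contractH_add_left[OF W])
    finally show "contract x (contract y (lie e W)) + contract y (contract x (lie e W)) =
        - contractH (\<partial> \<langle>x, y\<rangle>) (lie e W)" .
  next
    fix f x
    show "contract (f *\<^sub>E x) (lie e W) =
        scale_form f (contract x (lie e W)) - wedge x (contractH (\<partial> f) (lie e W))"
      using W by (simp add: contract_lie contract_scale_left lie_scale_form lie_wedge lie_contractH_W
        bracket_scale contract_add_left bracket_der_right)
  next
    fix \<beta> \<gamma> as
    assume "\<beta> \<in> H" "\<gamma> \<in> H"
    then have "contractH (\<beta> + \<gamma>) (lie e W) = contractH \<beta> (lie e W) + contractH \<gamma> (lie e W)"
      using W by (simp add: lie_contractH_W contractH_add_left)
    then show "lie e W [] (add_mset (\<beta> + \<gamma>) as) =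
        lie e W [] (add_mset \<beta> as) + lie e W [] (add_mset \<gamma> as)"
      by (simp add: fun_eq_iff contractH_apply)
  next
    fix f \<beta> as
    assume "\<beta> \<in> H"
    then have "contractH (f *\<^sub>E \<beta>) (lie e W) = scale_form f (contractH \<beta> (lie e W))"
      using W by (simp add: lie_contractH_W contractH_scale_left lie_scale_form bracket_scale
        contractH_add_left)
    then show "lie e W [] (add_mset (f *\<^sub>E \<beta>) as) = f *\<^sub>V lie e W [] (add_mset \<beta> as)"
      by (simp add: fun_eq_iff contractH_apply scale_form_apply)
  qed (use W in \<open>simp_all add: lie_Nil contract_lie contract_add_left\<close>)
next
  fix W x
  assume W: "cochain W"
  then show "\<exists>A V. cochain A \<and> cochain V \<and> contract x (lie e W) = A + lie e V"
    using cochain_minus[OF cochain_contract[OF W, of "e \<circ>\<^sub>E x"]]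
    by (intro exI[of _ "- contract (e \<circ>\<^sub>E x) W"] exI[of _ "contract x W"])
      (simp add: contract_lie cochain_contract)
qed

lemma lie_add_left:
  assumes "cochain W"
  shows "lie (x + y) W = lie x W + lie y W"
proof (rule form_operator_eqI[where P = cochain and W = W and F = "\<lambda>W. lie (x + y) W"
      and G = "\<lambda>W. lie x W + lie y W", OF assms])
  fix W as
  assume W: "cochain W"
  have "W [] (add_mset (x \<circ>\<^sub>E \<alpha> + y \<circ>\<^sub>E \<alpha>) bs) =
      W [] (add_mset (x \<circ>\<^sub>E \<alpha>) bs) + W [] (add_mset (y \<circ>\<^sub>E \<alpha>) bs)" if "\<alpha> \<in> H" for \<alpha> bs
    using contractH_add_left[OF W, of "x \<circ>\<^sub>E \<alpha>" "y \<circ>\<^sub>E \<alpha>"] that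
    by (auto simp: fun_eq_iff contractH_apply)
  then have "removal_sum (\<lambda>\<alpha> bs. W [] (add_mset ((x + y) \<circ>\<^sub>E \<alpha>) bs)) as =
      removal_sum (\<lambda>\<alpha> bs. W [] (add_mset (x \<circ>\<^sub>E \<alpha>) bs) + W [] (add_mset (y \<circ>\<^sub>E \<alpha>) bs)) as"
    if "set_mset as \<subseteq> H"
    using that by (intro removal_sum_cong) auto
  then show "lie (x + y) W [] as = (lie x W + lie y W) [] as"
    by (simp add: lie_Nil removal_sum_add)
qed (simp add: contract_lie cochain_contract contract_add_left)


section \<open>Cartan calculus\<close>

lemma lie_lie:
  assumes "cochain W"
  shows "lie e (lie e' W) - lie e' (lie e W) = lie (e \<circ>\<^sub>E e') W"
proof (rule form_operator_eqI[where P = cochain and W = W and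
      F = "\<lambda>W. lie e (lie e' W) - lie e' (lie e W)" and G = "\<lambda>W. lie (e \<circ>\<^sub>E e') W", OF assms])
  fix W as
  assume "cochain W"
  then show "(lie e (lie e' W) - lie e' (lie e W)) [] as = lie (e \<circ>\<^sub>E e') W [] as"
  \<comment> \<open>Recursion over \<open>contract\<close> strips only the arguments from E. With
    none left, those from H are stripped by \<open>contractH\<close>, and the Leibniz axiom (4)
    appears once more.\<close>
  proof (induction as arbitrary: W)
    case empty
    then show ?case
      by (simp add: lie_Nil nabla_bracket)
  next
    case (add \<alpha> as)
    note W = add.prems and [simp] = cochain_supported cochain_lie cochain_contractH
    have lie_contractH': "contractH \<beta> (lie x V) = lie x (contractH \<beta> V) - contractH (x \<circ>\<^sub>E \<beta>) V"
      if "\<beta> \<in> H" "cochain V" for \<beta> x V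
      using lie_contractH[of V \<beta> x] that by simp
    show ?case
    proof (cases "\<alpha> \<in> H")
      case True
      have "contractH \<alpha> (lie e (lie e' W) - lie e' (lie e W)) [] as =
          (lie e (lie e' (contractH \<alpha> W)) - lie e' (lie e (contractH \<alpha> W)) -
          contractH (e \<circ>\<^sub>E (e' \<circ>\<^sub>E \<alpha>) - e' \<circ>\<^sub>E (e \<circ>\<^sub>E \<alpha>)) W) [] as"
        using True W by (simp add: lie_contractH' contractH_diff_left)
      also have "\<dots> = (lie (e \<circ>\<^sub>E e') (contractH \<alpha> W) - contractH ((e \<circ>\<^sub>E e') \<circ>\<^sub>E \<alpha>) W) [] as"
        using add.IH[OF cochain_contractH[OF W True]] by (simp add: bracket_leibniz[of e e'])
      also have "\<dots> = contractH \<alpha> (lie (e \<circ>\<^sub>E e') W) [] as"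
        using True W by (simp add: lie_contractH')
      finally show ?thesis
        by (simp add: contractH_apply)
    next
      case False
      then show ?thesis
        by (simp add: lie_Nil)
    qed
  qed
next
  fix W x
  assume "cochain W"
  then show "cochain (contract x W) \<and>
      contract x (lie e (lie e' W) - lie e' (lie e W)) -
        (lie e (lie e' (contract x W)) - lie e' (lie e (contract x W))) =
      contract x (lie (e \<circ>\<^sub>E e') W) - lie (e \<circ>\<^sub>E e') (contract x W)"
    by (simp add: contract_lie cochain_contract bracket_leibniz[of e e'] contract_add_left)
qed

text \<open>The recursive step is \<open>lie_lie\<close>. On the empty list both sides contain a sum
  over ordered pairs of arguments from H, with the roles of the two exchanged;
  \<open>removal_sum_swap\<close> identifies them.\<close>

lemma lie_differential:
  assumes "cochain W"
  shows "lie e (differential W) = differential (lie e W)"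
proof (rule form_operator_eqI'[where P = cochain and W = W and
      F = "\<lambda>W. lie e (differential W)" and G = "\<lambda>W. differential (lie e W)", OF assms])
  fix W :: "('e, 'v) form" and as
  assume "cochain W"
  show "lie e (differential W) [] as = differential (lie e W) [] as"
  proof (cases "set_mset as \<subseteq> H")
    case True
    have "removal_sum (\<lambda>\<alpha> bs. lie e W [\<alpha>] bs) as =
        removal_sum (\<lambda>\<alpha> bs. \<nabla> e (W [\<alpha>] bs) -
          removal_sum (\<lambda>\<beta> cs. W [\<alpha>] (add_mset (e \<circ>\<^sub>E \<beta>) cs)) bs - W [e \<circ>\<^sub>E \<alpha>] bs) as"
      using True by (intro removal_sum_cong) (auto simp: lie_def contract_apply)
    moreover have "removal_sum (\<lambda>\<alpha> bs. differential W [] (add_mset (e \<circ>\<^sub>E \<alpha>) bs)) as =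
        removal_sum (\<lambda>\<alpha> bs. W [e \<circ>\<^sub>E \<alpha>] bs +
          removal_sum (\<lambda>\<beta> cs. W [\<beta>] (add_mset (e \<circ>\<^sub>E \<alpha>) cs)) bs) as"
      using True by (intro removal_sum_cong) (auto simp: differential_Nil removal_sum_add_mset)
    moreover have "removal_sum (\<lambda>\<alpha>. removal_sum (\<lambda>\<beta> cs. W [\<alpha>] (add_mset (e \<circ>\<^sub>E \<beta>) cs))) as =
        removal_sum (\<lambda>\<alpha>. removal_sum (\<lambda>\<beta> cs. W [\<beta>] (add_mset (e \<circ>\<^sub>E \<alpha>) cs))) as"
      by (rule removal_sum_swap)
    ultimately show ?thesis
      using True by (simp add: lie_Nil differential_Nil removal_sum_additive[where f = "\<nabla> e"]
        removal_sum_add removal_sum_diff)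
  qed (simp add: lie_Nil differential_Nil)
next
  fix W x
  assume W: "cochain W"
  have "lie e (lie x W) = lie (e \<circ>\<^sub>E x) W + lie x (lie e W)"
    using lie_lie[OF W, of e x] by (simp add: algebra_simps)
  then show "cochain (contract x W) \<and>
      contract x (lie e (differential W)) + lie e (differential (contract x W)) =
      contract x (differential (lie e W)) + differential (lie e (contract x W))"
    using W by (simp add: contract_lie contract_differential cochain_contract)
qed

text \<open>Cartan's formula reduces the recursive step to \<open>lie_differential\<close>. What
  remains is a sum over ordered pairs from H, and there isotropy decides: it makes both
  \<open>W [\<alpha>, \<beta>]\<close> and \<open>\<alpha> \<circ>\<^sub>E \<beta>\<close>
  antisymmetric, while the connection vanishes on H.\<close>

lemma differential_differential:
  assumes "cochain W"
  shows "differential (differential W) = 0"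
proof (rule form_operator_eqI[where P = cochain and W = W and
      F = "\<lambda>W. differential (differential W)" and G = "\<lambda>W. 0", OF assms])
  fix W as
  assume W: "cochain W"
  have anti: "(W [] (add_mset (\<alpha> \<circ>\<^sub>E \<beta>) cs) + W [\<alpha>, \<beta>] cs) +
      (W [] (add_mset (\<beta> \<circ>\<^sub>E \<alpha>) cs) + W [\<beta>, \<alpha>] cs) = 0" if "\<alpha> \<in> H" "\<beta> \<in> H" for \<alpha> \<beta> cs
  proof -
    have "contract \<alpha> (contract \<beta> W) + contract \<beta> (contract \<alpha> W) = 0"
      using W that by (simp add: contract_contract[OF W, of \<alpha> \<beta>] pairing_H contractH_zero_left)
    moreover have "contractH (\<alpha> \<circ>\<^sub>E \<beta>) W + contractH (\<beta> \<circ>\<^sub>E \<alpha>) W = 0"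
      using W that by (simp add: contractH_add_left[symmetric] bracket_sym pairing_H contractH_zero_left)
    ultimately have "(contractH (\<alpha> \<circ>\<^sub>E \<beta>) W + contractH (\<beta> \<circ>\<^sub>E \<alpha>) W) [] cs +
        (contract \<alpha> (contract \<beta> W) + contract \<beta> (contract \<alpha> W)) [] cs = 0"
      by (simp only: zero_fun_apply add_0)
    then show ?thesis
      by (simp add: contract_apply contractH_apply add_ac)
  qed
  show "differential (differential W) [] as = (0 :: ('e, 'v) form) [] as"
  proof (cases "set_mset as \<subseteq> H")
    case True
    have "removal_sum (\<lambda>\<alpha> bs. differential W [\<alpha>] bs) as =
        removal_sum (\<lambda>\<alpha> bs. - removal_sum (\<lambda>\<beta> cs. W [] (add_mset (\<alpha> \<circ>\<^sub>E \<beta>) cs) + W [\<alpha>, \<beta>] cs) bs) as"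
      using True by (intro removal_sum_cong)
        (auto simp: differential_def lie_def contract_def nabla_H removal_sum_add)
    also have "\<dots> = - removal_sum (\<lambda>\<alpha>. removal_sum
        (\<lambda>\<beta> cs. W [] (add_mset (\<alpha> \<circ>\<^sub>E \<beta>) cs) + W [\<alpha>, \<beta>] cs)) as"
      by (rule removal_sum_minus)
    also have "\<dots> = 0"
      using True by (subst removal_sum_antisymmetric) (auto intro: anti)
    finally show ?thesis
      using True by (simp add: differential_Nil)
  qed (simp add: differential_Nil)
qed (simp_all add: contract_differential cochain_contract lie_differential)

text \<open>Unwound by \<open>contract_differential_defect\<close>, this is the alternating sum over
  a of the values of \<open>W\<close> with the entry e_a omitted and
  \<open>\<alpha> \<circ>\<^sub>E e_a\<close> added to the arguments from H: the share of \<alpha>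
  in d'.\<close>

definition differential_defect :: "'e \<Rightarrow> ('e, 'v) form \<Rightarrow> ('e, 'v) form"
  where "differential_defect \<alpha> W =
    contractH \<alpha> (differential W) - differential (contractH \<alpha> W) - contract \<alpha> W"

lemma differential_defect_Nil:
  assumes "cochain W" "\<alpha> \<in> H"
  shows "differential_defect \<alpha> W [] as = 0"
  using assms(2) supportedD[OF cochain_supported[OF assms(1)], of as "[\<alpha>]"]
  by (simp add: differential_defect_def contractH_def contract_apply differential_Nil
      removal_sum_add_mset)

lemma contract_differential_defect:
  assumes "cochain W" "\<alpha> \<in> H"
  shows "contract x (differential_defect \<alpha> W) =
    contractH (\<alpha> \<circ>\<^sub>E x) W - differential_defect \<alpha> (contract x W)"
proof -
  have "\<alpha> \<circ>\<^sub>E x = \<partial> \<langle>x, \<alpha>\<rangle> - x \<circ>\<^sub>E \<alpha>"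
    using bracket_sym[of \<alpha> x] by (simp add: pairing_sym[of \<alpha>] algebra_simps)
  then have "contractH (\<alpha> \<circ>\<^sub>E x) W = contractH (\<partial> \<langle>x, \<alpha>\<rangle>) W - contractH (x \<circ>\<^sub>E \<alpha>) W"
    using assms by (simp add: contractH_diff_left)
  then show ?thesis
    using assms contract_contract[of W x \<alpha>]
    by (simp add: differential_defect_def contractH_contract[symmetric] contract_differential
        lie_contractH cochain_supported algebra_simps)
qed

text \<open>Each term of the defect contains a bracket
  \<open>\<partial> f \<circ>\<^sub>E x\<close>, which is zero by axiom (5).\<close>

lemma differential_defect_der:
  assumes "cochain W"
  shows "differential_defect (\<partial> f) W = 0"
  by (rule form_operator_eqI'[where P = cochain and W = W and
    F = "\<lambda>W. differential_defect (\<partial> f) W" and G = "\<lambda>W. 0", OF assms])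
    (simp_all add: differential_defect_Nil contract_differential_defect cochain_contract
      bracket_der contractH_zero_left)

lemma contractH_der_differential:
  assumes "cochain W"
  shows "contractH (\<partial> f) (differential W) = differential (contractH (\<partial> f) W) + contract (\<partial> f) W"
  using differential_defect_der[OF assms, of f] by (simp add: differential_defect_def algebra_simps)

text \<open>The right-hand side is what Cartan's formula yields when
  \<open>contract (f *\<^sub>E e)\<close> is expanded by condition 2) on both \<open>W\<close> and
  \<open>differential W\<close>. For \<open>differential W\<close> that condition is still open and
  will be deduced from this lemma, so the identity is proved by recursion instead.\<close>

lemma lie_scale_left:
  assumes "cochain W"
  shows "lie (f *\<^sub>E e) W = scale_form f (lie e W) + wedge (\<partial> f) (contract e W) -
    (differential (wedge e (contractH (\<partial> f) W)) + wedge e (differential (contractH (\<partial> f) W))) -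
    wedge e (contract (\<partial> f) W)"
proof (rule form_operator_eqI[where P = cochain and W = W and F = "\<lambda>W. lie (f *\<^sub>E e) W" and
      G = "\<lambda>W. scale_form f (lie e W) + wedge (\<partial> f) (contract e W) -
        (differential (wedge e (contractH (\<partial> f) W)) + wedge e (differential (contractH (\<partial> f) W))) -
        wedge e (contract (\<partial> f) W)", OF assms])
  fix W as
  assume W: "cochain W"
  show "lie (f *\<^sub>E e) W [] as = (scale_form f (lie e W) + wedge (\<partial> f) (contract e W) -
        (differential (wedge e (contractH (\<partial> f) W)) + wedge e (differential (contractH (\<partial> f) W))) -
        wedge e (contract (\<partial> f) W)) [] as"
  proof (cases "set_mset as \<subseteq> H")
    case True
    have "W [] (add_mset ((f *\<^sub>E e) \<circ>\<^sub>E \<alpha>) bs) =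
        f *\<^sub>V W [] (add_mset (e \<circ>\<^sub>E \<alpha>) bs) + \<langle>e, \<alpha>\<rangle> *\<^sub>V W [] (add_mset (\<partial> f) bs)"
      if "\<alpha> \<in> H" for \<alpha> bs
    proof -
      \<comment> \<open>Isotropy removes the term with
        \<open>\<langle>\<alpha>, \<partial> f\<rangle>\<close> from
        \<open>bracket_scale_left\<close>.\<close>
      have "contractH ((f *\<^sub>E e) \<circ>\<^sub>E \<alpha>) W =
          scale_form f (contractH (e \<circ>\<^sub>E \<alpha>) W) + scale_form \<langle>e, \<alpha>\<rangle> (contractH (\<partial> f) W)"
        using W that by (simp add: bracket_scale_left pairing_H contractH_add_left contractH_scale_left)
      then show ?thesis
        by (simp add: fun_eq_iff contractH_apply scale_form_apply)
    qed
    then have "removal_sum (\<lambda>\<alpha> bs. W [] (add_mset ((f *\<^sub>E e) \<circ>\<^sub>E \<alpha>) bs)) as =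
        removal_sum (\<lambda>\<alpha> bs. f *\<^sub>V W [] (add_mset (e \<circ>\<^sub>E \<alpha>) bs) + \<langle>e, \<alpha>\<rangle> *\<^sub>V W [] (add_mset (\<partial> f) bs)) as"
      using True by (intro removal_sum_cong) auto
    moreover have "removal_sum (\<lambda>\<alpha> bs. wedge e (contractH (\<partial> f) W) [\<alpha>] bs) as =
        removal_sum (\<lambda>\<alpha> bs. \<langle>e, \<alpha>\<rangle> *\<^sub>V W [] (add_mset (\<partial> f) bs)) as"
      by (rule removal_sum_cong) (simp add: wedge_def contractH_apply)
    ultimately show ?thesis
      using True by (simp add: lie_Nil scale_form_apply nabla_scale_left V.scale_right_diff_distrib
        removal_sum_additive[where f = "\<lambda>v. f *\<^sub>V v"] V.scale_right_distrib removal_sum_add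
        differential_Nil)
  qed (simp add: lie_Nil scale_form_apply differential_Nil)
next
  fix W x
  assume W: "cochain W"
  have bracket: "(f *\<^sub>E e) \<circ>\<^sub>E x = f *\<^sub>E (e \<circ>\<^sub>E x) - \<langle>\<partial> f, x\<rangle> *\<^sub>E e + \<langle>e, x\<rangle> *\<^sub>E \<partial> f"
    using bracket_scale_left[of f e x] by (simp add: pairing_sym)
  have wedge_der: "wedge (\<partial> \<langle>e, x\<rangle>) V = wedge (e \<circ>\<^sub>E x) V + wedge (x \<circ>\<^sub>E e) V" for V
    by (simp flip: bracket_sym)
  show "cochain (contract x W) \<and>
      contract x (lie (f *\<^sub>E e) W) - lie (f *\<^sub>E e) (contract x W) =
      contract x (scale_form f (lie e W) + wedge (\<partial> f) (contract e W) -
        (differential (wedge e (contractH (\<partial> f) W)) + wedge e (differential (contractH (\<partial> f) W))) -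
        wedge e (contract (\<partial> f) W)) -
      (scale_form f (lie e (contract x W)) + wedge (\<partial> f) (contract e (contract x W)) -
        (differential (wedge e (contractH (\<partial> f) (contract x W))) +
          wedge e (differential (contractH (\<partial> f) (contract x W)))) -
        wedge e (contract (\<partial> f) (contract x W)))"
    using W
    by (simp add: contract_differential lie_wedge differential_scale_form cochain_supported
        cochain_contract cochain_contractH contract_scale_form contract_lie contract_wedge bracket
        contract_add_left contract_diff_left contract_scale_left contractH_contract wedge_der
        contract_contract[OF W, of x] pairing_sym[of x])
qed

text \<open>In the symmetry condition the Lie derivatives cancel and the brackets add up to
  \<open>\<partial> \<langle>x, y\<rangle>\<close>, in a slot for E. This is exactly the extra term
  of \<open>contractH_der_differential\<close>. Condition 2) is
  \<open>lie_scale_left\<close>.\<close>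

lemma cochain_differential:
  assumes "cochain W"
  shows "cochain (differential W)"
  using assms
proof (rule cochain_operatorI)
  fix W
  assume W: "cochain W"
  note [simp] = cochain_supported cochain_contract cochain_contractH
  show "cochain_head (differential W)"
    unfolding cochain_head_def
  proof (intro conjI allI ballI impI)
    fix x y
    have "contract x (contract y (differential W)) + contract y (contract x (differential W)) =
        differential (contract x (contract y W) + contract y (contract x W)) -
        contract (x \<circ>\<^sub>E y + y \<circ>\<^sub>E x) W"
      using W by (simp add: contract_differential contract_lie contract_add_left)
    also have "\<dots> = - contractH (\<partial> \<langle>x, y\<rangle>) (differential W)"
      using W by (simp add: contract_contract[OF W, of x y] bracket_sym contractH_der_differential)
    finally show "contract x (contract y (differential W)) + contract y (contract x (differential W)) =
        - contractH (\<partial> \<langle>x, y\<rangle>) (differential W)" .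
  next
    fix f x
    show "contract (f *\<^sub>E x) (differential W) =
        scale_form f (contract x (differential W)) - wedge x (contractH (\<partial> f) (differential W))"
      using W by (simp add: contract_differential lie_scale_left contract_scale_left
        differential_scale_form contractH_der_differential)
  next
    fix \<beta> \<gamma> as
    assume H: "\<beta> \<in> H" "\<gamma> \<in> H"
    have "W [\<delta>] (add_mset (\<beta> + \<gamma>) bs) = W [\<delta>] (add_mset \<beta> bs) + W [\<delta>] (add_mset \<gamma> bs)" for \<delta> bs
      using contractH_add_left[OF W H] by (simp add: fun_eq_iff contractH_apply)
    moreover have "W [\<beta> + \<gamma>] as = W [\<beta>] as + W [\<gamma>] as"
      using contract_add_left[OF W, of \<beta> \<gamma>] by (simp add: fun_eq_iff contract_apply)
    ultimately show "differential W [] (add_mset (\<beta> + \<gamma>) as) =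
        differential W [] (add_mset \<beta> as) + differential W [] (add_mset \<gamma> as)"
      using H by (simp add: differential_Nil removal_sum_add_mset removal_sum_add)
  next
    fix f \<beta> as
    assume H: "\<beta> \<in> H"
    have "W [\<delta>] (add_mset (f *\<^sub>E \<beta>) bs) = f *\<^sub>V W [\<delta>] (add_mset \<beta> bs)" for \<delta> bs
      using contractH_scale_left[OF W H] by (simp add: fun_eq_iff contractH_apply scale_form_apply)
    moreover have "W [f *\<^sub>E \<beta>] as = f *\<^sub>V W [\<beta>] as"
      using arg_cong[OF contract_scale_left[OF W, of f \<beta>], of "\<lambda>U. U [] as"]
      by (simp add: contract_apply scale_form_apply)
    ultimately show "differential W [] (add_mset (f *\<^sub>E \<beta>) as) = f *\<^sub>V differential W [] (add_mset \<beta> as)"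
      using H by (simp add: differential_Nil removal_sum_add_mset V.scale_right_distrib
        removal_sum_additive[where f = "\<lambda>v. f *\<^sub>V v"])
  qed (use W in \<open>simp_all add: differential_Nil contract_differential lie_add_left contract_add_left\<close>)
next
  fix W x
  assume W: "cochain W"
  then show "\<exists>A V. cochain A \<and> cochain V \<and> contract x (differential W) = A + differential V"
    by (intro exI[of _ "lie x W"] exI[of _ "- contract x W"])
      (simp add: contract_differential cochain_lie cochain_minus cochain_contract)
qed

text \<open>Degrees are integers so that primitives in degree n - 1 make sense for n = 0; a form of
  degree - 1 is zero.\<close>

definition homogeneous :: "int \<Rightarrow> ('e, 'v) form \<Rightarrow> bool"
  where "homogeneous n W \<longleftrightarrow> (\<forall>es as. int (length es + 2 * size as) \<noteq> n \<longrightarrow> W es as = 0)"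

lemma homogeneousD: "homogeneous n W \<Longrightarrow> int (length es + 2 * size as) \<noteq> n \<Longrightarrow> W es as = 0"
  by (simp add: homogeneous_def)

lemma homogeneous_contract: "homogeneous n W \<Longrightarrow> homogeneous (n - 1) (contract x W)"
  by (simp add: homogeneous_def contract_def)

lemma homogeneous_zero [simp]: "homogeneous n 0"
  by (simp add: homogeneous_def)

lemma homogeneous_add: "homogeneous n V \<Longrightarrow> homogeneous n W \<Longrightarrow> homogeneous n (V + W)"
  by (simp add: homogeneous_def)

lemma homogeneous_diff: "homogeneous n V \<Longrightarrow> homogeneous n W \<Longrightarrow> homogeneous n (V - W)"
  by (simp add: homogeneous_def)

lemma homogeneous_scale: "homogeneous n W \<Longrightarrow> homogeneous n (scale_form f W)"
  by (simp add: homogeneous_def scale_form_def)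

lemma homogeneous_lie:
  assumes "homogeneous n W"
  shows "homogeneous n (lie e W)"
proof -
  have "lie e W es as = 0" if "int (length es + 2 * size as) \<noteq> n" for es as
    using assms that
  proof (induction es arbitrary: n W)
    case Nil
    have "removal_sum (\<lambda>\<alpha> bs. W [] (add_mset (e \<circ>\<^sub>E \<alpha>) bs)) as = removal_sum (\<lambda>_ _. 0) as"
      using Nil by (intro removal_sum_cong) (auto intro: homogeneousD)
    then show ?case
      using Nil by (simp add: lie_Nil homogeneousD)
  next
    case (Cons x es)
    then have "lie e (contract x W) es as = 0" "contract (e \<circ>\<^sub>E x) W es as = 0"
      by (auto intro!: Cons.IH[of "n - 1"] homogeneous_contract simp: homogeneousD contract_apply)
    then show ?case
      using arg_cong[OF contract_lie[of x e W], of "\<lambda>U. U es as"] by (simp add: contract_apply)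
  qed
  then show ?thesis
    by (simp add: homogeneous_def)
qed

lemma homogeneous_differential:
  assumes "homogeneous n W"
  shows "homogeneous (n + 1) (differential W)"
proof -
  have "differential W es as = 0" if "int (length es + 2 * size as) \<noteq> n + 1" for es as
    using assms that
  proof (induction es arbitrary: n W)
    case Nil
    have "removal_sum (\<lambda>\<alpha> bs. W [\<alpha>] bs) as = removal_sum (\<lambda>_ _. 0) as"
      using Nil by (intro removal_sum_cong) (auto intro: homogeneousD)
    then show ?case
      by (simp add: differential_Nil)
  next
    case (Cons x es)
    then have "differential (contract x W) es as = 0" "lie x W es as = 0"
      by (auto intro!: Cons.IH[of "n - 1"] homogeneous_contract homogeneousD[OF homogeneous_lie])
    then show ?case
      using arg_cong[OF contract_differential[of x W], of "\<lambda>U. U es as"] by (simp add: contract_apply)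
  qed
  then show ?thesis
    by (simp add: homogeneous_def)
qed

lemma differential_scale_const:
  "supported W \<Longrightarrow> \<partial> f = 0 \<Longrightarrow> differential (scale_form f W) = scale_form f (differential W)"
  by (simp add: differential_scale_form)

definition horizontal :: "('e, 'v) form \<Rightarrow> bool"
  where "horizontal W \<longleftrightarrow> (\<forall>es as. as \<noteq> {#} \<or> set es \<inter> H \<noteq> {} \<longrightarrow> W es as = 0)"

text \<open>The field is known only up to a bijection with the reals or the complex numbers that
  respects sums and products; this determines the images of 0 and 1 and transfers characteristic
  zero. The inverse is sought among the multiples \<open>c *\<^sub>K 1\<close>, since \<partial>
  kills these and scaling by them commutes with the differential.\<close>

lemma of_nat_invertible:
  assumes "m > 0"
  obtains c :: 'k where "(c *\<^sub>K 1) * of_nat m = 1"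
proof -
  have nz: "(of_nat m :: 'k) \<noteq> 0"
  proof -
    have "(of_nat m :: 'k) \<noteq> 0"
      if "bij \<phi>" "\<forall>x y. \<phi> (x + y) = \<phi> x + \<phi> y \<and> \<phi> (x * y) = \<phi> x * \<phi> y"
      for \<phi> :: "'k \<Rightarrow> 'a::field_char_0"
    proof -
      have zero: "\<phi> 0 = 0"
        using that(2)[rule_format, of 0 0] by simp
      moreover have "\<phi> 1 \<noteq> \<phi> 0"
        using that(1) by (metis bij_betw_def inj_eq zero_neq_one)
      ultimately have one: "\<phi> 1 = 1"
        using that(2)[rule_format, of 1 1] by simp
      have "\<phi> (of_nat k) = of_nat k" for k
        by (induction k) (simp_all add: zero one that(2))
      then show ?thesis
        using zero assms by (metis of_nat_eq_0_iff not_gr_zero)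
    qed
    then show ?thesis
      using ground_field unfolding real_or_complex_def by metis
  qed
  have of_nat_scale: "of_nat k *\<^sub>K (1 :: 'r) = of_nat k" for k
    by (induction k) (simp_all add: scale_left_distrib)
  have "(inverse (of_nat m :: 'k) *\<^sub>K 1) * of_nat m = inverse (of_nat m) *\<^sub>K (of_nat m *\<^sub>K 1)"
    by (simp add: of_nat_scale flip: scaleK_mult)
  also have "\<dots> = 1"
    using nz by simp
  finally show ?thesis
    by (rule that)
qed

end


section \<open>The contracting homotopy\<close>

locale h_splitting =
  h_complex scaleK scaleE pairing der bracket H scaleV nabla
  for scaleK :: "'k::field \<Rightarrow> 'r::comm_ring_1 \<Rightarrow> 'r" (infixr \<open>*\<^sub>K\<close> 75)
    and scaleE :: "'r \<Rightarrow> 'e::ab_group_add \<Rightarrow> 'e" (infixr \<open>*\<^sub>E\<close> 75)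
    and pairing :: "'e \<Rightarrow> 'e \<Rightarrow> 'r" (\<open>\<langle>_, _\<rangle>\<close>)
    and der :: "'r \<Rightarrow> 'e" (\<open>\<partial>\<close>)
    and bracket :: "'e \<Rightarrow> 'e \<Rightarrow> 'e" (infixl \<open>\<circ>\<^sub>E\<close> 70)
    and H :: "'e set"
    and scaleV :: "'r \<Rightarrow> 'v::ab_group_add \<Rightarrow> 'v" (infixr \<open>*\<^sub>V\<close> 75)
    and nabla :: "'e \<Rightarrow> 'v \<Rightarrow> 'v" (\<open>\<nabla>\<close>) +
  fixes p :: "'e \<Rightarrow> 'e"
  assumes p_add [simp]: "p (x + y) = p x + p y"
    and p_scale [simp]: "p (f *\<^sub>E x) = f *\<^sub>E p x"
    and p_in_H [simp]: "p x \<in> H"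
    and p_H [simp]: "\<alpha> \<in> H \<Longrightarrow> p \<alpha> = \<alpha>"
begin

lemma p_diff [simp]: "p (x - y) = p x - p y"
  using p_add[of "x - y" y] by simp

text \<open>
  The Koszul homotopy for the component \<open>\<delta>\<close> of the differential: it inserts the arguments from
  \<open>E\<close>, projected to \<open>H\<close>, as arguments from \<open>H\<close>.
\<close>

primrec homotopy_aux :: "'e list \<Rightarrow> ('e, 'v) form \<Rightarrow> 'e multiset \<Rightarrow> 'v"
  where "homotopy_aux [] W as = 0"
  | "homotopy_aux (x # es) W as = W es (add_mset (p x) as) - homotopy_aux es (contract x W) as"

definition homotopy :: "('e, 'v) form \<Rightarrow> ('e, 'v) form"
  where "homotopy W = (\<lambda>es. homotopy_aux es W)"

lemma homotopy_Nil [simp]: "homotopy W [] as = 0"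
  by (simp add: homotopy_def)

lemma contract_homotopy: "contract x (homotopy W) = contractH (p x) W - homotopy (contract x W)"
  by (simp add: contract_def contractH_def homotopy_def fun_eq_iff)

lemma homotopy_linear [simp]:
  "homotopy (W + W') = homotopy W + homotopy W'"
  "homotopy (- W) = - homotopy W"
  "homotopy (W - W') = homotopy W - homotopy W'"
  "homotopy 0 = 0"
proof -
  have add: "homotopy_aux es (W + W') as = homotopy_aux es W as + homotopy_aux es W' as" for es W W' as
    by (induction es arbitrary: W W') simp_all
  then show add': "homotopy (W + W') = homotopy W + homotopy W'" for W W'
    by (simp add: homotopy_def fun_eq_iff)
  show zero: "homotopy 0 = 0"
    using add'[of 0 0] by simp
  show minus: "homotopy (- W) = - homotopy W" for W
    using add'[of W "- W"] zero by (simp add: eq_neg_iff_add_eq_0 add.commute)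
  show "homotopy (W - W') = homotopy W - homotopy W'"
    using add'[of W "- W'"] minus[of W'] by simp
qed

lemma homotopy_scale_form: "homotopy (scale_form f W) = scale_form f (homotopy W)"
  by (rule form_operator_eqI'[where P = "\<lambda>_. True" and W = W and
    F = "\<lambda>W. homotopy (scale_form f W)" and G = "\<lambda>W. scale_form f (homotopy W)", OF TrueI])
    (simp_all add: scale_form_apply contract_scale_form contract_homotopy contractH_scale_form)

lemma contractH_homotopy: "contractH \<alpha> (homotopy W) = homotopy (contractH \<alpha> W)"
  by (rule form_operator_eqI'[where P = "\<lambda>_. True" and W = W and
    F = "\<lambda>W. contractH \<alpha> (homotopy W)" and G = "\<lambda>W. homotopy (contractH \<alpha> W)", OF TrueI])
    (simp_all add: contractH_apply contractH_contract[symmetric] contract_homotopy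
      contractH_commute[of \<alpha> "p _"])

lemma homotopy_wedge: "homotopy (wedge e W) = - wedge e (homotopy W)"
  by (rule form_operator_eqI[where P = "\<lambda>_. True" and W = W and
    F = "\<lambda>W. homotopy (wedge e W)" and G = "\<lambda>W. - wedge e (homotopy W)", OF TrueI])
    (simp_all add: contract_homotopy contract_wedge contractH_wedge homotopy_scale_form)

text \<open>Every term of the homotopy inserts an argument from H, so the component with k = 0 never
  enters.\<close>

lemma homotopy_eq_0:
  assumes "\<And>es as. as \<noteq> {#} \<Longrightarrow> W es as = 0"
  shows "homotopy W = 0"
proof -
  have "homotopy_aux es W as = 0" for es as
    using assms by (induction es arbitrary: W) (simp_all add: contract_def)
  then show ?thesis
    by (simp add: homotopy_def fun_eq_iff)
qed

lemma homogeneous_homotopy: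
  assumes "homogeneous n W"
  shows "homogeneous (n - 1) (homotopy W)"
proof -
  have "homotopy W es as = 0" if "int (length es + 2 * size as) \<noteq> n - 1" for es as
    using assms that
  proof (induction es arbitrary: n W)
    case (Cons x es)
    then have "homotopy (contract x W) es as = 0"
      by (auto intro!: Cons.IH[of "n - 1"] homogeneous_contract)
    moreover have "W es (add_mset (p x) as) = 0"
      using Cons.prems by (auto intro: homogeneousD)
    ultimately show ?case
      by (simp add: homotopy_def)
  qed simp
  then show ?thesis
    by (simp add: homogeneous_def)
qed

text \<open>Here p has to be R-linear, which is where projectivity enters: condition 2) for the
  homotopy needs \<open>p (f *\<^sub>E x)\<close> to contract as f times \<open>p x\<close>. In the
  symmetry condition the terms with p cancel in pairs.\<close>

lemma cochain_homotopy:
  assumes "cochain W"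
  shows "cochain (homotopy W)"
  using assms
proof (rule cochain_operatorI)
  fix W
  assume W: "cochain W"
  show "cochain_head (homotopy W)"
    unfolding cochain_head_def
  proof (intro conjI allI ballI impI)
    fix x y
    show "contract x (contract y (homotopy W)) + contract y (contract x (homotopy W)) =
        - contractH (\<partial> \<langle>x, y\<rangle>) (homotopy W)"
      by (simp add: contract_homotopy contractH_contract contractH_homotopy
        contract_contract[OF W, of x y])
  next
    fix f x
    show "contract (f *\<^sub>E x) (homotopy W) =
        scale_form f (contract x (homotopy W)) - wedge x (contractH (\<partial> f) (homotopy W))"
      using W by (simp add: contract_homotopy contract_scale_left contractH_scale_left
        homotopy_scale_form homotopy_wedge contractH_homotopy)
  qed (use W in \<open>simp_all add: contract_homotopy contract_add_left contractH_add_left\<close>)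
next
  fix W x
  assume W: "cochain W"
  then show "\<exists>A V. cochain A \<and> cochain V \<and> contract x (homotopy W) = A + homotopy V"
    by (intro exI[of _ "contractH (p x) W"] exI[of _ "- contract x W"])
      (simp add: contract_homotopy cochain_contractH cochain_minus cochain_contract)
qed

section \<open>The Laplacian and its eigenvalues on the filtration\<close>

definition laplacian :: "('e, 'v) form \<Rightarrow> ('e, 'v) form"
  where "laplacian W = differential (homotopy W) + homotopy (differential W)"

text \<open>The part of the commutator of the Laplacian with \<open>contract x\<close> beyond
  \<open>contract (p x)\<close>. Unwound, it omits an entry y and adds \<open>x \<circ>\<^sub>E p y
  - p (x \<circ>\<^sub>E y) + p x \<circ>\<^sub>E y\<close> to the arguments from H: the failure of
  p to respect the bracket.\<close>

definition laplacian_defect :: "'e \<Rightarrow> ('e, 'v) form \<Rightarrow> ('e, 'v) form"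
  where "laplacian_defect x W =
    lie x (homotopy W) - homotopy (lie x W) + differential_defect (p x) W"

text \<open>Euler's identity: \<delta> moves an argument \<alpha> to the side of E and the homotopy
  returns \<open>p \<alpha> = \<alpha>\<close>, once for each argument.\<close>

lemma laplacian_Nil:
  assumes "set_mset as \<subseteq> H"
  shows "laplacian W [] as = of_nat (size as) *\<^sub>V W [] as"
proof -
  have "removal_sum (\<lambda>\<alpha> bs. homotopy W [\<alpha>] bs) as = removal_sum (\<lambda>_ _. W [] as) as"
    using assms by (intro removal_sum_cong) (auto simp: homotopy_def)
  also have "\<dots> = of_nat (size as) *\<^sub>V W [] as"
  proof -
    have "removal_sum (\<lambda>_ _. v) as = of_nat (size as) *\<^sub>V v" for v
      by (induction as) (simp_all add: removal_sum_add_mset V.scale_left_distrib)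
    then show ?thesis .
  qed
  finally show ?thesis
    using assms by (simp add: laplacian_def differential_Nil)
qed

lemma contract_laplacian:
  "contract x (laplacian W) = laplacian (contract x W) + contract (p x) W + laplacian_defect x W"
  by (simp add: laplacian_def laplacian_defect_def contract_differential contract_homotopy
      differential_defect_def)

lemma laplacian_defect_Nil:
  assumes "cochain W"
  shows "laplacian_defect x W [] as = 0"
  using assms by (simp add: laplacian_defect_def lie_Nil differential_defect_Nil)

lemma contract_laplacian_defect:
  assumes "cochain W"
  shows "contract y (laplacian_defect x W) =
    contractH (x \<circ>\<^sub>E p y - p (x \<circ>\<^sub>E y) + p x \<circ>\<^sub>E y) W - laplacian_defect x (contract y W)"
  using assms by (simp add: laplacian_defect_def contract_lie contract_homotopy
      contract_differential_defect lie_contractH cochain_supported contractH_add_left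
      contractH_diff_left)

lemma laplacian_defect_eq_0:
  assumes "cochain W"
    and "\<And>a. a < length es \<Longrightarrow>
      W (omit a es) (add_mset (x \<circ>\<^sub>E p (es ! a) - p (x \<circ>\<^sub>E es ! a) + p x \<circ>\<^sub>E es ! a) as) = 0"
  shows "laplacian_defect x W es as = 0"
  using assms
proof (induction es arbitrary: W)
  case Nil
  then show ?case
    by (simp add: laplacian_defect_Nil)
next
  case (Cons y es)
  have "laplacian_defect x (contract y W) es as = 0"
  proof (rule Cons.IH[OF cochain_contract[OF Cons.prems(1)]])
    fix a
    assume "a < length es"
    then show "contract y W (omit a es)
        (add_mset (x \<circ>\<^sub>E p (es ! a) - p (x \<circ>\<^sub>E es ! a) + p x \<circ>\<^sub>E es ! a) as) = 0"
      using Cons.prems(2)[of "Suc a"] by (simp add: contract_apply omit_def)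
  qed
  moreover have "contractH (x \<circ>\<^sub>E p y - p (x \<circ>\<^sub>E y) + p x \<circ>\<^sub>E y) W es as = 0"
    using Cons.prems(2)[of 0] by (simp add: contractH_apply omit_def)
  ultimately show ?case
    using arg_cong[OF contract_laplacian_defect[OF Cons.prems(1), of y x], of "\<lambda>U. U es as"]
    by (simp add: contract_apply)
qed

text \<open>
  A list is pure if each entry is in \<open>H\<close> or in the complement \<open>p -` {0}\<close>; \<open>transversal\<close> counts the
  entries of the second kind.
\<close>

definition pure :: "'e list \<Rightarrow> bool"
  where "pure es \<longleftrightarrow> (\<forall>e\<in>set es. e \<in> H \<or> p e = 0)"

definition transversal :: "'e list \<Rightarrow> nat"
  where "transversal es = length (filter (\<lambda>e. e \<notin> H) es)"

lemma transversal_simps [simp]: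
  "transversal [] = 0"
  "transversal (e # es) = (if e \<in> H then transversal es else Suc (transversal es))"
  by (simp_all add: transversal_def)

lemma transversal_le: "transversal es \<le> length es"
  by (simp add: transversal_def)

lemma transversal_less: "e \<in> set es \<Longrightarrow> e \<in> H \<Longrightarrow> transversal es < length es"
  unfolding transversal_def by (auto intro: length_filter_less)

lemma transversal_omit:
  assumes "a < length es"
  shows "transversal es = transversal (omit a es) + (if es ! a \<in> H then 0 else 1)"
  using assms by (subst id_take_nth_drop[OF assms]) (simp add: transversal_def omit_def)

lemma set_omit: "set (omit a es) \<subseteq> set es"
  using set_take_subset[of a es] set_drop_subset[of "Suc a" es] by (auto simp: omit_def)

lemma pure_omit: "pure es \<Longrightarrow> pure (omit a es)"
  using set_omit[of a es] by (auto simp: pure_def)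

text \<open>An error term of the Laplacian has one more argument from H and no more transversal
  entries. It must be known to vanish beforehand, so q is cleared from below and, for fixed q, k
  from above.\<close>

definition vanishing :: "nat \<Rightarrow> nat \<Rightarrow> ('e, 'v) form \<Rightarrow> bool"
  where "vanishing q k W \<longleftrightarrow> (\<forall>es as. pure es \<longrightarrow> set_mset as \<subseteq> H \<longrightarrow>
    transversal es < q \<or> transversal es = q \<and> k \<le> size as \<longrightarrow> W es as = 0)"

lemma vanishingD:
  "vanishing q k W \<Longrightarrow> pure es \<Longrightarrow> set_mset as \<subseteq> H \<Longrightarrow>
    transversal es < q \<or> transversal es = q \<and> k \<le> size as \<Longrightarrow> W es as = 0"
  unfolding vanishing_def by blast

text \<open>
  On the graded pieces of the filtration by \<open>vanishing\<close>, the Laplacian is multiplication by the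
  number of arguments from \<open>H\<close>.
\<close>

lemma laplacian_eigenvalue:
  assumes "cochain W" "vanishing q (Suc k) W" "pure es" "set_mset as \<subseteq> H"
    "transversal es < q \<or> transversal es = q \<and> k \<le> size as"
  shows "laplacian W es as = of_nat (size as + (length es - transversal es)) *\<^sub>V W es as"
  using assms
proof (induction es arbitrary: q W)
  case Nil
  then show ?case
    by (simp add: laplacian_Nil)
next
  case (Cons x es)
  note W = Cons.prems(1) and van = Cons.prems(2) and as = Cons.prems(4)
  have pure: "x \<in> H \<or> p x = 0" "pure es"
    using Cons.prems(3) by (auto simp: pure_def)
  have rec: "laplacian W (x # es) as =
      laplacian (contract x W) es as + W (p x # es) as + laplacian_defect x W es as"
    using arg_cong[OF contract_laplacian[of x W], of "\<lambda>U. U es as"] by (simp add: contract_apply)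
  have zero: "W es' (add_mset 0 as) = 0" for es'
    using contractH_zero_left[OF W] by (simp add: fun_eq_iff contractH_apply)
  show ?case
  proof (cases "x \<in> H")
    case True
    have "vanishing q (Suc k) (contract x W)"
      using van True by (simp add: vanishing_def contract_apply pure_def)
    then have "laplacian (contract x W) es as =
        of_nat (size as + (length es - transversal es)) *\<^sub>V contract x W es as"
      using Cons.prems(5) True pure(2) as cochain_contract[OF W] by (intro Cons.IH[of _ q]) simp_all
    moreover have "laplacian_defect x W es as = 0"
    proof (rule laplacian_defect_eq_0[OF W])
      fix a
      assume a: "a < length es"
      show "W (omit a es) (add_mset (x \<circ>\<^sub>E p (es ! a) - p (x \<circ>\<^sub>E es ! a) + p x \<circ>\<^sub>E es ! a) as) = 0"
      proof (cases "es ! a \<in> H")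
        case aH: True
        \<comment> \<open>An entry in H is traded for an argument from H: the transversal count
          stays, and the additional argument is covered by the bound \<open>Suc k\<close>.\<close>
        have "transversal (omit a es) = transversal es"
          using transversal_omit[OF a] aH by simp
        then show ?thesis
          using True aH Cons.prems(5) as
          by (intro vanishingD[OF van pure_omit[OF pure(2)]]) auto
      next
        case False
        \<comment> \<open>The inserted element is zero: p fixes x and
          \<open>x \<circ>\<^sub>E es ! a\<close>, so its last two terms cancel.\<close>
        then have "p (es ! a) = 0"
          using pure(2) a by (auto simp: pure_def)
        then show ?thesis
          using True zero by simp
      qed
    qed
    \<comment> \<open>As \<open>p x = x\<close>, the middle term of \<open>rec\<close> is
      \<open>W (x # es) as\<close> once more and raises the eigenvalue by one.\<close>
    ultimately show ?thesis
      unfolding rec using True transversal_le[of es]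
      by (simp add: contract_apply V.scale_left_distrib Suc_diff_le)
  next
    case False
    then have px: "p x = 0"
      using pure(1) by simp
    from Cons.prems(5) False obtain q' where q: "q = Suc q'"
      by (cases q) auto
    have "vanishing q' (Suc k) (contract x W)"
      using van False px by (auto simp: vanishing_def contract_apply pure_def q)
    then have "laplacian (contract x W) es as =
        of_nat (size as + (length es - transversal es)) *\<^sub>V contract x W es as"
      using Cons.prems(5) False pure(2) as cochain_contract[OF W]
      by (intro Cons.IH[of _ q']) (simp_all add: q)
    moreover have "W (p x # es) as = 0"
      using contract_zero_left[OF W] px by (simp add: fun_eq_iff contract_apply)
    moreover have "laplacian_defect x W es as = 0"
    proof (rule laplacian_defect_eq_0[OF W])
      fix a
      assume a: "a < length es"
      show "W (omit a es) (add_mset (x \<circ>\<^sub>E p (es ! a) - p (x \<circ>\<^sub>E es ! a) + p x \<circ>\<^sub>E es ! a) as) = 0"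
      proof (cases "es ! a \<in> H")
        \<comment> \<open>Now \<open>x \<circ>\<^sub>E es ! a\<close> lies in H and is fixed by p,
          and \<open>p x = 0\<close>, so the inserted element is zero.\<close>
        case True
        then show ?thesis
          using zero px by simp
      next
        case aH: False
        \<comment> \<open>Two transversal entries are lost here, x and
          \<open>es ! a\<close>.\<close>
        then have "transversal (omit a es) < q"
          using transversal_omit[OF a] Cons.prems(5) False by auto
        then show ?thesis
          using as px p_in_H[of "es ! a"] by (intro vanishingD[OF van pure_omit[OF pure(2)]]) auto
      qed
    qed
    ultimately show ?thesis
      unfolding rec using False by (simp add: contract_apply)
  qed
qed

text \<open>As h d W = 0, the Laplacian of \<open>W\<close> is d h W. On the new stratum, with q
  transversal entries and k arguments from H, it is multiplication by n - q - k, so \<open>U\<close>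
  is the homotopy of \<open>W\<close> divided by this number. Where \<open>W\<close> already
  vanishes, so does its Laplacian, and nothing gained before is lost.\<close>

lemma vanishing_step:
  assumes W: "cochain W" "homogeneous (int n) W" "vanishing q (Suc k) W" "q < n"
    and closed: "homotopy (differential W) = 0"
  obtains U where "cochain U" "homogeneous (int n - 1) U" "vanishing q k (W - differential U)"
proof (cases "n - q - k = 0")
  case True
  have "vanishing q k W"
    unfolding vanishing_def
  proof (intro allI impI)
    fix es as
    assume *: "pure es" "set_mset as \<subseteq> H" "transversal es < q \<or> transversal es = q \<and> k \<le> size as"
    show "W es as = 0"
    proof (cases "transversal es = q \<and> size as = k")
      case eq: True
      \<comment> \<open>Degree n would force q + 2 * k \<le> n, but here n \<le> q + k and q < n:
        the stratum is empty, and U = 0 serves.\<close>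
      then have "length es + 2 * size as \<noteq> n"
        using True transversal_le[of es] W(4) by auto
      then show ?thesis
        using W(2) homogeneousD by (metis of_nat_eq_iff)
    next
      case False
      then show ?thesis
        using * by (intro vanishingD[OF W(3)]) auto
    qed
  qed
  then show ?thesis
    by (intro that[of 0]) simp_all
next
  case False
  then obtain c :: 'k where c: "(c *\<^sub>K 1) * of_nat (n - q - k) = 1"
    using of_nat_invertible[of "n - q - k"] by auto
  define U where "U = scale_form (c *\<^sub>K 1) (homotopy W)"
  have dU: "differential U = scale_form (c *\<^sub>K 1) (laplacian W)"
    using W(1) closed
    by (simp add: U_def differential_scale_const cochain_supported cochain_homotopy laplacian_def)
  have "vanishing q k (W - differential U)"
    unfolding vanishing_def
  proof (intro allI impI)
    fix es as
    assume *: "pure es" "set_mset as \<subseteq> H" "transversal es < q \<or> transversal es = q \<and> k \<le> size as"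
    have dU_eq: "differential U es as =
        (c *\<^sub>K 1) *\<^sub>V (of_nat (size as + (length es - transversal es)) *\<^sub>V W es as)"
      unfolding dU scale_form_apply by (subst laplacian_eigenvalue[OF W(1,3) *]) simp
    show "(W - differential U) es as = 0"
    proof (cases "W es as = 0")
      case W0: True
      then show ?thesis
        using dU_eq by simp
    next
      case W0: False
      then have "\<not> (transversal es < q \<or> transversal es = q \<and> Suc k \<le> size as)"
        using vanishingD[OF W(3) *(1,2)] by blast
      moreover have "length es + 2 * size as = n"
        using W0 W(2) homogeneousD by (metis of_nat_eq_iff)
      ultimately have "size as + (length es - transversal es) = n - q - k"
        using * transversal_le[of es] by auto
      then show ?thesis
        using dU_eq c by (simp add: V.scale_scale)
    qed
  qed
  moreover have "cochain U" "homogeneous (int n - 1) U"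
    using W by (simp_all add: U_def cochain_scale cochain_homotopy homogeneous_scale homogeneous_homotopy)
  ultimately show ?thesis
    by (rule that[rotated 2])
qed

text \<open>Two nested inductions along the filtration. Subtracting exact terms preserves h d W = 0
  by d d = 0, so the step can be repeated.\<close>

lemma vanishing_representative:
  assumes W: "cochain W" "homogeneous (int n) W" "homotopy (differential W) = 0"
  shows "q \<le> n \<Longrightarrow> \<exists>U. cochain U \<and> homogeneous (int n - 1) U \<and> vanishing q (Suc n) (W - differential U)"
proof (induction q)
  case 0
  have "vanishing 0 (Suc n) W"
    using homogeneousD[OF W(2)] by (auto simp: vanishing_def)
  then have "cochain 0 \<and> homogeneous (int n - 1) 0 \<and> vanishing 0 (Suc n) (W - differential 0)"
    by simp
  then show ?case
    by blast
next
  case (Suc q)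
  \<comment> \<open>Descent from \<open>Suc n\<close> to 0 with q fixed. \<open>Suc n\<close>
    exceeds every possible number of arguments from H in degree n.\<close>
  have "\<exists>U. cochain U \<and> homogeneous (int n - 1) U \<and> vanishing q (Suc n - k) (W - differential U)" for k
  proof (induction k)
    case 0
    then show ?case
      using Suc by simp
  next
    case (Suc k)
    then obtain U where U: "cochain U" "homogeneous (int n - 1) U"
      "vanishing q (Suc n - k) (W - differential U)"
      by blast
    show ?case
    proof (cases "k \<le> n")
      case True
      let ?W = "W - differential U"
      have "cochain ?W" "homogeneous (int n) ?W" "homotopy (differential ?W) = 0"
        using W U homogeneous_differential[OF U(2)]
        by (simp_all add: cochain_diff cochain_differential homogeneous_diff differential_differential)
      moreover have "vanishing q (Suc (n - k)) ?W"
        using U(3) True by (simp add: Suc_diff_le)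
      ultimately obtain U' where U': "cochain U'" "homogeneous (int n - 1) U'"
        "vanishing q (n - k) (?W - differential U')"
        using vanishing_step[of ?W n q "n - k"] \<open>Suc q \<le> n\<close> by auto
      have "W - differential (U + U') = ?W - differential U'"
        by simp
      then have "cochain (U + U') \<and> homogeneous (int n - 1) (U + U') \<and>
          vanishing q (Suc n - Suc k) (W - differential (U + U'))"
        using U U' by (simp only: cochain_add homogeneous_add diff_Suc_Suc)
      then show ?thesis
        by blast
    next
      case False
      then have "Suc n - Suc k = Suc n - k"
        by simp
      then show ?thesis
        using U by metis
    qed
  qed
  from this[of "Suc n"] obtain U where U: "cochain U" "homogeneous (int n - 1) U"
    "vanishing q 0 (W - differential U)"
    by auto
  have "homogeneous (int n) (W - differential U)"
    using W(2) homogeneous_differential[OF U(2)] by (simp add: homogeneous_diff)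
  then have "(W - differential U) es as = 0" if "size as \<ge> Suc n" for es as
    using that homogeneousD[of "int n" "W - differential U" es as] by simp
  \<comment> \<open>With bound 0 all lists with q transversal entries are done; on those with
    \<open>Suc q\<close> entries the condition is vacuous by degree.\<close>
  then have "vanishing (Suc q) (Suc n) (W - differential U)"
    using U(3) by (auto simp: vanishing_def less_Suc_eq)
  then show ?case
    using U by blast
qed

text \<open>Cochains are additive in each argument from E, so writing every entry as p e + (e - p e)
  expands a value into values on pure lists.\<close>

lemma cochain_eq_0_if_pure:
  assumes "cochain W"
    and "\<And>es'. list_all2 (\<lambda>e e'. e' = p e \<or> e' = e - p e) es es' \<Longrightarrow> W es' as = 0"
  shows "W es as = 0"
  using assms
proof (induction es arbitrary: W)
  case (Cons x es)
  have "contract y W es as = 0" if y: "y = p x \<or> y = x - p x" for y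
  proof (rule Cons.IH[OF cochain_contract[OF Cons.prems(1)]])
    fix es'
    assume "list_all2 (\<lambda>e e'. e' = p e \<or> e' = e - p e) es es'"
    then have "W (y # es') as = 0"
      using y by (intro Cons.prems(2)) simp
    then show "contract y W es' as = 0"
      by (simp add: contract_apply)
  qed
  moreover have "contract x W = contract (p x) W + contract (x - p x) W"
    using contract_add_left[OF Cons.prems(1), of "p x" "x - p x"] by simp
  then have "W (x # es) as = contract (p x) W es as + contract (x - p x) W es as"
    by (metis contract_apply plus_fun_apply)
  ultimately show ?case
    by simp
qed simp

text \<open>In degree n, any argument from H on either side leaves fewer than n transversal entries,
  so vanishing up to q = n is horizontality. The hypothesis admits differentials concentrated in k =
  0; this is what injectivity on cohomology requires.\<close>

lemma horizontal_representative:
  assumes W: "cochain W" "homogeneous (int n) W"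
    and closed: "\<And>es as. as \<noteq> {#} \<Longrightarrow> differential W es as = 0"
  obtains U where "cochain U" "homogeneous (int n - 1) U" "horizontal (W - differential U)"
proof -
  obtain U where U: "cochain U" "homogeneous (int n - 1) U" "vanishing n (Suc n) (W - differential U)"
    using vanishing_representative[OF W homotopy_eq_0[OF closed], of n] by auto
  let ?W = "W - differential U"
  have hom: "homogeneous (int n) ?W" and coc: "cochain ?W"
    using W U homogeneous_differential[OF U(2)]
    by (simp_all add: homogeneous_diff cochain_diff cochain_differential)
  have "?W es as = 0" if 1: "as \<noteq> {#} \<or> set es \<inter> H \<noteq> {}" for es as
  proof (cases "set_mset as \<subseteq> H")
    case as: True
    show ?thesis
    proof (rule cochain_eq_0_if_pure[OF coc])
      fix es'
      assume es': "list_all2 (\<lambda>e e'. e' = p e \<or> e' = e - p e) es es'"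
      have len: "length es' = length es"
        using es' by (simp add: list_all2_lengthD)
      have pure: "pure es'"
        unfolding pure_def
      proof
        fix e'
        assume "e' \<in> set es'"
        then show "e' \<in> H \<or> p e' = 0"
          using es' by (auto simp: list_all2_conv_all_nth in_set_conv_nth)
      qed
      show "?W es' as = 0"
      proof (cases "length es' + 2 * size as = n")
        case True
        have "transversal es' < n"
        proof (cases "as = {#}")
          case as0: True
          with 1 obtain i where i: "i < length es" "es ! i \<in> H"
            by (auto simp: in_set_conv_nth)
          \<comment> \<open>Splitting an entry of H gives the entry itself or zero, so the pure list
            still meets H.\<close>
          then have "es' ! i \<in> H"
            using es' by (auto simp: list_all2_conv_all_nth)
          then show ?thesis
            using transversal_less[of "es' ! i" es'] i len True as0 by simp
        next
          case False
          then show ?thesis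
            using True transversal_le[of es'] by (auto simp: nonempty_has_size)
        qed
        then show ?thesis
          using vanishingD[OF U(3) pure as] by blast
      next
        case False
        then show ?thesis
          by (intro homogeneousD[OF hom]) linarith
      qed
    qed
  next
    case False
    then show ?thesis
      using supportedD[OF cochain_supported[OF coc]] by blast
  qed
  then have "horizontal ?W"
    by (simp add: horizontal_def)
  with U show ?thesis
    by (intro that)
qed

end


section \<open>Comparison with the standard complex\<close>

context h_complex
begin

definition to_seq :: "('e, 'v) form \<Rightarrow> ('e, 'v) cochain"
  where "to_seq W = (\<lambda>k es as. if size as = k then W es as else 0)"

lemma to_seq_eq_iff [simp]: "to_seq V = to_seq W \<longleftrightarrow> V = W"
  by (auto simp: to_seq_def fun_eq_iff)

lemma to_seq_linear:
  "to_seq (V + W) = to_seq V + to_seq W" "to_seq (V - W) = to_seq V - to_seq W" "to_seq 0 = 0"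
  by (simp_all add: to_seq_def fun_eq_iff)

lemma cochain_prefix: "cochain W \<Longrightarrow> cochain (\<lambda>es. W (xs @ es))"
proof (induction xs arbitrary: W)
  case (Cons x xs)
  then show ?case
    using Cons.IH[OF cochain_contract[OF Cons.prems, of x]] by (simp add: contract_def)
qed simp

lemma restricted_linear_iff:
  fixes g :: "'e \<Rightarrow> 'v"
  shows "Vector_Spaces.linear (restrict_scalars scaleK scaleE) (restrict_scalars scaleK scaleV) g \<longleftrightarrow>
    (\<forall>x y. g (x + y) = g x + g y) \<and> (\<forall>c x. g ((c *\<^sub>K 1) *\<^sub>E x) = (c *\<^sub>K 1) *\<^sub>V g x)"
proof -
  have "vector_space (restrict_scalars scaleK scaleE)" "vector_space (restrict_scalars scaleK scaleV)"
    using bracket_linear_right nabla_linear_right by (blast dest: Vector_Spaces.linear.axioms)+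
  then show ?thesis
    by (auto simp: Vector_Spaces.linear_def module_hom_iff module_iff_vector_space restrict_scalars_def)
qed

text \<open>A condition at an arbitrary position is the condition on the first argument after
  contracting the preceding ones; hence the invariant ranges over prefixes
  \<open>xs\<close>.\<close>

lemma std_cochains_cochain:
  assumes \<omega>: "\<omega> \<in> std_cochains scaleK scaleE pairing der H scaleV n"
  shows "cochain (\<lambda>es as. \<omega> (size as) es as)"
proof (rule cochain_coinduct[where P = "\<lambda>W. \<exists>xs. W = (\<lambda>es as. \<omega> (size as) (xs @ es) as)"])
  show "\<exists>xs. (\<lambda>es as. \<omega> (size as) es as) = (\<lambda>es as. \<omega> (size as) (xs @ es) as)"
    by (rule exI[of _ "[]"]) simp
next
  fix W :: "('e, 'v) form" and x
  assume "\<exists>xs. W = (\<lambda>es as. \<omega> (size as) (xs @ es) as)"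
  then obtain xs where "W = (\<lambda>es as. \<omega> (size as) (xs @ es) as)"
    by blast
  then show "\<exists>xs. contract x W = (\<lambda>es as. \<omega> (size as) (xs @ es) as)"
    by (intro exI[of _ "xs @ [x]"]) (simp add: contract_def)
next
  fix W :: "('e, 'v) form"
  assume "\<exists>xs. W = (\<lambda>es as. \<omega> (size as) (xs @ es) as)"
  then obtain xs where W: "W = (\<lambda>es as. \<omega> (size as) (xs @ es) as)"
    by blast
  have supp: "\<omega> k es as = 0" if "\<not> set_mset as \<subseteq> H" for k es as
    using \<omega> that by (simp add: std_cochains_def)
  have add: "\<omega> k (xs @ (x + y) # ys) as = \<omega> k (xs @ x # ys) as + \<omega> k (xs @ y # ys) as" for k x y ys as
    using \<omega> by (simp add: std_cochains_def restricted_linear_iff)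
  have sym: "\<omega> k (xs @ x # y # ys) as + \<omega> k (xs @ y # x # ys) as =
      - \<omega> (Suc k) (xs @ ys) (add_mset (\<partial> \<langle>x, y\<rangle>) as)" for k x y ys as
    using \<omega> by (simp add: std_cochains_def)
  have scale: "\<omega> k (xs @ (f *\<^sub>E x) # ys) as = f *\<^sub>V \<omega> k (xs @ x # ys) as +
      (\<Sum>j<length ys. ((- 1) ^ (j + 1) * \<langle>x, ys ! j\<rangle>) *\<^sub>V
        \<omega> (k + 1) (xs @ omit j ys) (add_mset (\<partial> f) as))" for k f x ys as
    using \<omega> unfolding std_cochains_def by blast
  have H: "\<omega> k es (add_mset (\<alpha> + \<beta>) as) = \<omega> k es (add_mset \<alpha> as) + \<omega> k es (add_mset \<beta> as)"
    "\<omega> k es (add_mset (f *\<^sub>E \<alpha>) as) = f *\<^sub>V \<omega> k es (add_mset \<alpha> as)"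
    if "\<alpha> \<in> H" "\<beta> \<in> H" for k es \<alpha> \<beta> f as
    using \<omega> that by (simp_all add: std_cochains_def)
  show "cochain_head W"
    unfolding cochain_head_def
  proof (intro conjI allI ballI impI)
    fix x y
    show "contract x (contract y W) + contract y (contract x W) = - contractH (\<partial> \<langle>x, y\<rangle>) W"
      using sym[of _ y x] by (simp add: fun_eq_iff W contract_def contractH_def pairing_sym)
  next
    fix f x
    show "contract (f *\<^sub>E x) W = scale_form f (contract x W) - wedge x (contractH (\<partial> f) W)"
    proof (intro ext)
      fix ys as
      show "contract (f *\<^sub>E x) W ys as = (scale_form f (contract x W) - wedge x (contractH (\<partial> f) W)) ys as"
        using scale[of "size as" f x ys as]
        by (simp add: W contract_def contractH_def wedge_eq_sum scale_form_def sum_negf)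
    qed
  qed (use supp add H in \<open>simp_all add: W fun_eq_iff contract_def\<close>)
qed

lemma to_seq_in_std_cochains:
  assumes "cochain W" "homogeneous (int n) W"
  shows "to_seq W \<in> std_cochains scaleK scaleE pairing der H scaleV n"
proof -
  have lin: "W (xs @ (x + y) # ys) as = W (xs @ x # ys) as + W (xs @ y # ys) as"
    and sym: "W (xs @ x # y # ys) as + W (xs @ y # x # ys) as = - W (xs @ ys) (add_mset (\<partial> \<langle>x, y\<rangle>) as)"
    and scale: "W (xs @ (f *\<^sub>E x) # ys) as = f *\<^sub>V W (xs @ x # ys) as +
      (\<Sum>j<length ys. ((- 1) ^ (j + 1) * \<langle>x, ys ! j\<rangle>) *\<^sub>V W (xs @ omit j ys) (add_mset (\<partial> f) as))"
    and scaleK: "W (xs @ ((c *\<^sub>K 1) *\<^sub>E x) # ys) as = (c *\<^sub>K 1) *\<^sub>V W (xs @ x # ys) as"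
    for xs x y ys as f c
  proof -
    define V where "V = (\<lambda>es. W (xs @ es))"
    have V: "cochain V"
      unfolding V_def by (rule cochain_prefix[OF assms(1)])
    show "W (xs @ (x + y) # ys) as = W (xs @ x # ys) as + W (xs @ y # ys) as"
      using arg_cong[OF contract_add_left[OF V, of x y], of "\<lambda>U. U ys as"]
      by (simp add: contract_def V_def)
    have "W (xs @ y # x # ys) as =
        - W (xs @ x # y # ys) as - W (xs @ ys) (add_mset (\<partial> \<langle>x, y\<rangle>) as)"
      using arg_cong[OF contract_contract[OF V, of x y], of "\<lambda>U. U ys as"]
      by (simp add: contract_def contractH_def V_def)
    then show "W (xs @ x # y # ys) as + W (xs @ y # x # ys) as =
        - W (xs @ ys) (add_mset (\<partial> \<langle>x, y\<rangle>) as)"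
      by simp
    show "W (xs @ (f *\<^sub>E x) # ys) as = f *\<^sub>V W (xs @ x # ys) as +
        (\<Sum>j<length ys. ((- 1) ^ (j + 1) * \<langle>x, ys ! j\<rangle>) *\<^sub>V W (xs @ omit j ys) (add_mset (\<partial> f) as))"
      using arg_cong[OF contract_scale_left[OF V, of f x], of "\<lambda>U. U ys as"]
      by (simp add: contract_def contractH_def V_def scale_form_def wedge_eq_sum sum_negf)
    \<comment> \<open>The correction in condition 2) contains \<partial> of a constant, which is
      zero.\<close>
    have "contract ((c *\<^sub>K 1) *\<^sub>E x) V = scale_form (c *\<^sub>K 1) (contract x V)"
      by (simp add: contract_scale_left[OF V] contractH_zero_left[OF V])
    from arg_cong[OF this, of "\<lambda>U. U ys as"]
    show "W (xs @ ((c *\<^sub>K 1) *\<^sub>E x) # ys) as = (c *\<^sub>K 1) *\<^sub>V W (xs @ x # ys) as"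
      by (simp add: contract_def V_def scale_form_def)
  qed
  have H: "W es (add_mset (\<alpha> + \<beta>) as) = W es (add_mset \<alpha> as) + W es (add_mset \<beta> as)"
    "W es (add_mset (f *\<^sub>E \<alpha>) as) = f *\<^sub>V W es (add_mset \<alpha> as)"
    if "\<alpha> \<in> H" "\<beta> \<in> H" for es \<alpha> \<beta> f as
    using arg_cong[OF contractH_add_left[OF assms(1) that], of "\<lambda>U. U es as"]
      arg_cong[OF contractH_scale_left[OF assms(1) that(1), of f], of "\<lambda>U. U es as"]
    by (simp_all add: contractH_def scale_form_def)
  have "to_seq W k es as = 0" if "\<not> (length es + 2 * k = n \<and> size as = k \<and> set_mset as \<subseteq> H)" for k es as
    using that supportedD[OF cochain_supported[OF assms(1)], of as es]
      homogeneousD[OF assms(2), of es as] by (auto simp: to_seq_def)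
  then show ?thesis
    unfolding std_cochains_def restricted_linear_iff
  proof (intro CollectI conjI allI ballI)
    fix k xs x y ys as
    show "to_seq W k (xs @ x # y # ys) as + to_seq W k (xs @ y # x # ys) as =
        - to_seq W (k + 1) (xs @ ys) (add_mset (\<partial> \<langle>x, y\<rangle>) as)"
      using sym by (simp add: to_seq_def)
  next
    fix k xs f x ys as
    show "to_seq W k (xs @ (f *\<^sub>E x) # ys) as = f *\<^sub>V to_seq W k (xs @ x # ys) as +
        (\<Sum>j<length ys. ((- 1) ^ (j + 1) * \<langle>x, ys ! j\<rangle>) *\<^sub>V
          to_seq W (k + 1) (xs @ omit j ys) (add_mset (\<partial> f) as))"
      using scale[of xs f x ys as] by (simp add: to_seq_def)
  qed (use lin scaleK H in \<open>simp_all add: to_seq_def\<close>)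
qed

lemma std_cochains_eq:
  "std_cochains scaleK scaleE pairing der H scaleV n = to_seq ` {W. cochain W \<and> homogeneous (int n) W}"
proof (intro subset_antisym subsetI)
  fix \<omega>
  assume \<omega>: "\<omega> \<in> std_cochains scaleK scaleE pairing der H scaleV n"
  then have "\<forall>k es as. \<not> (length es + 2 * k = n \<and> size as = k \<and> set_mset as \<subseteq> H) \<longrightarrow> \<omega> k es as = 0"
    unfolding std_cochains_def mem_Collect_eq by (rule conjunct1)
  then have zero: "\<omega> k es as = 0" if "\<not> (length es + 2 * k = n \<and> size as = k)" for k es as
    using that by blast
  let ?W = "\<lambda>es as. \<omega> (size as) es as"
  have "homogeneous (int n) ?W"
    using zero by (auto simp: homogeneous_def)
  moreover have "\<omega> = to_seq ?W"
    using zero by (simp add: to_seq_def fun_eq_iff)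
  ultimately show "\<omega> \<in> to_seq ` {W. cochain W \<and> homogeneous (int n) W}"
    using std_cochains_cochain[OF \<omega>] by blast
qed (use to_seq_in_std_cochains in blast)

lemma lie_eq_sum:
  assumes "set_mset as \<subseteq> H"
  shows "lie x W es as = \<nabla> x (W es as) - (\<Sum>b<length es. W (es[b := x \<circ>\<^sub>E es ! b]) as) -
    removal_sum (\<lambda>\<alpha> bs. W es (add_mset (x \<circ>\<^sub>E \<alpha>) bs)) as"
proof (induction es arbitrary: W)
  case Nil
  then show ?case
    using assms by (simp add: lie_Nil)
next
  case (Cons y es)
  have "lie x W (y # es) as = lie x (contract y W) es as - W (x \<circ>\<^sub>E y # es) as"
    by (simp add: lie_def)
  then show ?case
    unfolding Cons.IH by (simp add: contract_def sum.lessThan_Suc_shift del: sum.lessThan_Suc)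
qed

lemma omit_Cons [simp]: "omit 0 (x # es) = es" "omit (Suc a) (x # es) = x # omit a es"
  by (simp_all add: omit_def)

text \<open>Unrolling Cartan's formula leaves \<open>x \<circ>\<^sub>E \<alpha>\<close> from the Lie
  derivative where d' has \<open>\<alpha> \<circ>\<^sub>E x\<close>, and it puts \<alpha> behind x
  in \<delta>. Moving \<alpha> to the front costs the contraction with
  \<open>\<partial> \<langle>x, \<alpha>\<rangle>\<close>, the sum of the two brackets, and this
  settles both differences.\<close>

lemma differential_eq_sum:
  assumes "cochain W" and as: "set_mset as \<subseteq> H"
  shows "differential W es as =
    (\<Sum>a<length es. (- 1) ^ a *\<^sub>V \<nabla> (es ! a) (W (omit a es) as)) +
    (\<Sum>b<length es. \<Sum>a<b. (- 1) ^ (a + 1) *\<^sub>V W (omit a (es[b := es ! a \<circ>\<^sub>E es ! b])) as) +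
    removal_sum (\<lambda>\<alpha> bs. W (\<alpha> # es) bs) as +
    (\<Sum>a<length es. (- 1) ^ a *\<^sub>V
      removal_sum (\<lambda>\<alpha> bs. W (omit a es) (add_mset (\<alpha> \<circ>\<^sub>E es ! a) bs)) as)"
  using assms(1)
proof (induction es arbitrary: W)
  case Nil
  then show ?case
    using as by (simp add: differential_Nil)
next
  case (Cons x es)
  note W = Cons.prems
  have swap: "W (\<alpha> # x # es) bs = - W (x # \<alpha> # es) bs - W es (add_mset (x \<circ>\<^sub>E \<alpha>) bs) -
      W es (add_mset (\<alpha> \<circ>\<^sub>E x) bs)" if "\<alpha> \<in> H" for \<alpha> bs
  proof -
    have "contract x (contract \<alpha> W) =
        - contract \<alpha> (contract x W) - contractH (x \<circ>\<^sub>E \<alpha> + \<alpha> \<circ>\<^sub>E x) W"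
      unfolding bracket_sym by (rule contract_contract[OF W])
    then have "contract x (contract \<alpha> W) = - contract \<alpha> (contract x W) -
        contractH (x \<circ>\<^sub>E \<alpha>) W - contractH (\<alpha> \<circ>\<^sub>E x) W"
      using that by (simp add: contractH_add_left[OF W])
    from arg_cong[OF this, of "\<lambda>U. U es bs"] show ?thesis
      by (simp add: contract_def contractH_def)
  qed
  have "removal_sum (\<lambda>\<alpha> bs. W (\<alpha> # x # es) bs) as =
      removal_sum (\<lambda>\<alpha> bs. - W (x # \<alpha> # es) bs - W es (add_mset (x \<circ>\<^sub>E \<alpha>) bs) -
        W es (add_mset (\<alpha> \<circ>\<^sub>E x) bs)) as"
    using as swap by (intro removal_sum_cong) auto
  also have "\<dots> = - removal_sum (\<lambda>\<alpha> bs. W (x # \<alpha> # es) bs) as -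
      removal_sum (\<lambda>\<alpha> bs. W es (add_mset (x \<circ>\<^sub>E \<alpha>) bs)) as -
      removal_sum (\<lambda>\<alpha> bs. W es (add_mset (\<alpha> \<circ>\<^sub>E x) bs)) as"
    by (simp only: removal_sum_diff removal_sum_minus)
  finally have delta: "removal_sum (\<lambda>\<alpha> bs. W (\<alpha> # x # es) bs) as =
      - removal_sum (\<lambda>\<alpha> bs. W (x # \<alpha> # es) bs) as -
      removal_sum (\<lambda>\<alpha> bs. W es (add_mset (x \<circ>\<^sub>E \<alpha>) bs)) as -
      removal_sum (\<lambda>\<alpha> bs. W es (add_mset (\<alpha> \<circ>\<^sub>E x) bs)) as" .
  have "differential W (x # es) as = lie x W es as - differential (contract x W) es as"
    by (simp add: differential_def)
  then show ?case
    unfolding Cons.IH[OF cochain_contract[OF W]] lie_eq_sum[OF as] delta length_Cons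
      sum.lessThan_Suc_shift
    by (simp add: contract_def sum.distrib sum_negf sum_subtractf)
qed

lemma std_d_to_seq:
  assumes "cochain W"
  shows "std_d bracket H scaleV nabla (to_seq W) = to_seq (differential W)"
proof (intro ext)
  fix k es as
  have W_cases: "set_mset as \<subseteq> H \<or> differential W es as = 0"
    using supportedD[OF cochain_supported[OF cochain_differential[OF assms]]] by blast
  have delta: "std_delta (to_seq W) k es as =
      (if size as = k then removal_sum (\<lambda>\<alpha> bs. W (\<alpha> # es) bs) as else 0)"
  \<comment> \<open>For positive k, \<open>size bs = k - 1\<close> says the same as
    \<open>size as = k\<close>; for k = 0 truncated subtraction breaks this.\<close>
  proof (cases "k = 0")
    case False
    have "std_delta (to_seq W) k es as = removal_sum (\<lambda>\<alpha> bs. to_seq W (k - 1) (\<alpha> # es) bs) as"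
      using False by (simp add: std_delta_def removal_sum_def)
    also have "\<dots> = removal_sum (\<lambda>\<alpha> bs. if size as = k then W (\<alpha> # es) bs else 0) as"
      using False by (intro removal_sum_cong) (auto simp: to_seq_def)
    finally show ?thesis
      by simp
  qed (auto simp: std_delta_def)
  have "(\<Sum>\<alpha>\<in>#as. (- 1) ^ a *\<^sub>V to_seq W k (omit a es) (add_mset (\<alpha> \<circ>\<^sub>E es ! a) (as - {#\<alpha>#}))) =
      (if size as = k then (- 1) ^ a *\<^sub>V
        removal_sum (\<lambda>\<alpha> bs. W (omit a es) (add_mset (\<alpha> \<circ>\<^sub>E es ! a) bs)) as else 0)" for a
  proof -
    have "(\<Sum>\<alpha>\<in>#as. (- 1) ^ a *\<^sub>V to_seq W k (omit a es) (add_mset (\<alpha> \<circ>\<^sub>E es ! a) (as - {#\<alpha>#}))) =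
        removal_sum (\<lambda>\<alpha> bs. (- 1) ^ a *\<^sub>V to_seq W k (omit a es) (add_mset (\<alpha> \<circ>\<^sub>E es ! a) bs)) as"
      by (simp add: removal_sum_def)
    also have "\<dots> = removal_sum (\<lambda>\<alpha> bs. if size as = k
        then (- 1) ^ a *\<^sub>V W (omit a es) (add_mset (\<alpha> \<circ>\<^sub>E es ! a) bs) else 0) as"
      by (intro removal_sum_cong) (auto simp: to_seq_def)
    also have "\<dots> = (if size as = k then (- 1) ^ a *\<^sub>V
        removal_sum (\<lambda>\<alpha> bs. W (omit a es) (add_mset (\<alpha> \<circ>\<^sub>E es ! a) bs)) as else 0)"
      by (simp add: removal_sum_additive[where f = "\<lambda>v. (- 1) ^ a *\<^sub>V v"] V.scale_right_distrib)
    finally show ?thesis .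
  qed
  then have d': "std_d' bracket scaleV (to_seq W) k es as = (if size as = k then \<Sum>a<length es. (- 1) ^ a *\<^sub>V
      removal_sum (\<lambda>\<alpha> bs. W (omit a es) (add_mset (\<alpha> \<circ>\<^sub>E es ! a) bs)) as else 0)"
    by (simp add: std_d'_def)
  have d0: "std_d0 bracket scaleV nabla (to_seq W) k es as = (if size as = k then
      (\<Sum>a<length es. (- 1) ^ a *\<^sub>V \<nabla> (es ! a) (W (omit a es) as)) +
      (\<Sum>b<length es. \<Sum>a<b. (- 1) ^ (a + 1) *\<^sub>V W (omit a (es[b := es ! a \<circ>\<^sub>E es ! b])) as) else 0)"
    by (simp add: std_d0_def to_seq_def)
  show "std_d bracket H scaleV nabla (to_seq W) k es as = to_seq (differential W) k es as"
    unfolding std_d_def delta d' d0 using W_cases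
    by (auto simp: to_seq_def differential_eq_sum[OF assms])
qed

end


section \<open>Comparison with the Chevalley-Eilenberg complex\<close>

text \<open>\<Phi> runs against the direction of the claim, so the isomorphism is the inverse of the
  induced map, built by choosing a cocycle over each class. \<open>\<Phi>_B\<close> gives
  injectivity on cohomology and \<open>lift\<close> surjectivity.\<close>

lemma cohomology_isomorphic:
  fixes s :: "'k::comm_ring_1 \<Rightarrow> 'c::ab_group_add \<Rightarrow> 'c" and s' :: "'k \<Rightarrow> 'a::ab_group_add \<Rightarrow> 'a"
    and C :: "nat \<Rightarrow> 'c set" and C' :: "nat \<Rightarrow> 'a set" and d d' \<Phi>
  defines "B \<equiv> \<lambda>n. case n of 0 \<Rightarrow> {0} | Suc m \<Rightarrow> d ` C m"
    and "B' \<equiv> \<lambda>n. case n of 0 \<Rightarrow> {0} | Suc m \<Rightarrow> d' ` C' m"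
  assumes s: "Modules.module s" and s': "Modules.module s'"
    and C: "\<And>n. module.subspace s (C n)" and C': "\<And>n. module.subspace s' (C' n)"
    and d: "\<And>n x y. x \<in> C n \<Longrightarrow> y \<in> C n \<Longrightarrow> d (x + y) = d x + d y"
      "\<And>n c x. x \<in> C n \<Longrightarrow> d (s c x) = s c (d x)"
    and d': "\<And>n x y. x \<in> C' n \<Longrightarrow> y \<in> C' n \<Longrightarrow> d' (x + y) = d' x + d' y"
      "\<And>n c x. x \<in> C' n \<Longrightarrow> d' (s' c x) = s' c (d' x)"
    and \<Phi>: "\<And>x y. \<Phi> (x + y) = \<Phi> x + \<Phi> y" "\<And>c x. \<Phi> (s' c x) = s c (\<Phi> x)"
    and \<Phi>_C: "\<And>n x. x \<in> C' n \<Longrightarrow> \<Phi> x \<in> C n"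
    and \<Phi>_d: "\<And>n x. x \<in> C' n \<Longrightarrow> d (\<Phi> x) = \<Phi> (d' x)"
    and \<Phi>_B: "\<And>n x. x \<in> C' n \<Longrightarrow> d' x = 0 \<Longrightarrow> \<Phi> x \<in> B n \<Longrightarrow> x \<in> B' n"
    and lift: "\<And>n w. w \<in> C n \<Longrightarrow> d w = 0 \<Longrightarrow> \<exists>x\<in>C' n. d' x = 0 \<and> w - \<Phi> x \<in> B n"
  shows "module_isomorphic type_ring (cohomology s C d n) (cohomology s' C' d' n)"
proof -
  interpret s: Modules.module s by (rule s)
  interpret s': Modules.module s' by (rule s')
  define Z where "Z = {x \<in> C n. d x = 0}"
  define Z' where "Z' = {x \<in> C' n. d' x = 0}"
  have d0: "d 0 = 0"
    using d(2)[of 0 n 0] s.subspace_0[OF C, of n] by simp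
  have d'0: "d' 0 = 0"
    using d'(2)[of 0 n 0] s'.subspace_0[OF C', of n] by simp
  have \<Phi>0: "\<Phi> 0 = 0"
    using \<Phi>(1)[of 0 0] by simp
  have \<Phi>_diff: "\<Phi> (x - y) = \<Phi> x - \<Phi> y" for x y
    using \<Phi>(1)[of "x - y" y] by simp
  have B: "s.subspace (B n)"
  proof (cases n)
    case (Suc m)
    then show ?thesis
      unfolding s.subspace_def B_def
      using s.subspace_0[OF C, of m] s.subspace_add[OF C, of _ m] s.subspace_scale[OF C, of _ m]
        d[of _ m] d0
      by simp (metis (no_types, opaque_lifting) imageE image_eqI)
  qed (simp add: B_def s.subspace_def)
  have B': "s'.subspace (B' n)"
  proof (cases n)
    case (Suc m)
    then show ?thesis
      unfolding s'.subspace_def B'_def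
      using s'.subspace_0[OF C', of m] s'.subspace_add[OF C', of _ m] s'.subspace_scale[OF C', of _ m]
        d'[of _ m] d'0
      by simp (metis (no_types, opaque_lifting) imageE image_eqI)
  qed (simp add: B'_def s'.subspace_def)
  have Z'_add: "x + y \<in> Z'" "s' c x \<in> Z'" if "x \<in> Z'" "y \<in> Z'" for x y c
    using that s'.subspace_add[OF C', of x n y] s'.subspace_scale[OF C', of x n c]
    by (auto simp: Z'_def d'[of _ n])
  have Z'_diff: "x - y \<in> Z'" if "x \<in> Z'" "y \<in> Z'" for x y
    using Z'_add(1)[OF that(1) Z'_add(2)[OF that(2) that(2), of "- 1"]] by simp
  define c where "c x = (+) x ` B n" for x
  define c' where "c' x = (+) x ` B' n" for x
  note ops = quotient_module_add[OF s B, folded c_def] quotient_module_smult[OF s B, folded c_def]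
  note ops' = quotient_module_add[OF s' B', folded c'_def] quotient_module_smult[OF s' B', folded c'_def]
  have eq: "c x = c y \<longleftrightarrow> x - y \<in> B n" for x y
    unfolding c_def using B
    by (intro coset_eq_iff) (auto intro: s.subspace_0 s.subspace_add s.subspace_neg)
  have eq': "c' x = c' y \<longleftrightarrow> x - y \<in> B' n" for x y
    unfolding c'_def using B'
    by (intro coset_eq_iff) (auto intro: s'.subspace_0 s'.subspace_add s'.subspace_neg)
  define Q where "Q = quotient_module s Z (B n)"
  define Q' where "Q' = quotient_module s' Z' (B' n)"
  have car: "carrier Q = c ` Z" "carrier Q' = c' ` Z'"
    by (simp_all add: Q_def Q'_def quotient_module_def c_def c'_def)
  have carQ: "carrier Q = (\<lambda>x. c (\<Phi> x)) ` Z'"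
  proof (intro subset_antisym subsetI)
    fix X
    assume "X \<in> carrier Q"
    then obtain w where "w \<in> Z" "X = c w"
      unfolding car by blast
    then obtain x where "x \<in> Z'" "w - \<Phi> x \<in> B n"
      using lift[of w n] by (auto simp: Z_def Z'_def)
    then show "X \<in> (\<lambda>x. c (\<Phi> x)) ` Z'"
      using eq \<open>X = c w\<close> by blast
  next
    fix X
    assume "X \<in> (\<lambda>x. c (\<Phi> x)) ` Z'"
    then show "X \<in> carrier Q"
      unfolding car using \<Phi>_C[of _ n] \<Phi>_d[of _ n] \<Phi>0 by (auto simp: Z_def Z'_def)
  qed
  have c_\<Phi>: "c (\<Phi> x) = c (\<Phi> y) \<longleftrightarrow> c' x = c' y" if "x \<in> Z'" "y \<in> Z'" for x y
  proof
    assume "c (\<Phi> x) = c (\<Phi> y)"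
    then have "\<Phi> (x - y) \<in> B n"
      by (simp add: eq \<Phi>_diff)
    then show "c' x = c' y"
      using Z'_diff[OF that] \<Phi>_B[of "x - y" n] by (simp add: eq' Z'_def)
  next
    assume "c' x = c' y"
    then have "x - y \<in> B' n"
      by (simp add: eq')
    then have "\<Phi> (x - y) \<in> B n"
      using \<Phi>_C \<Phi>_d[symmetric] \<Phi>0 by (cases n) (auto simp: B_def B'_def)
    then show "c (\<Phi> x) = c (\<Phi> y)"
      by (simp add: eq \<Phi>_diff)
  qed
  define f where "f X = c' (SOME x. x \<in> Z' \<and> c (\<Phi> x) = X)" for X
  have f: "f (c (\<Phi> x)) = c' x" if "x \<in> Z'" for x
  proof -
    define y where "y = (SOME y. y \<in> Z' \<and> c (\<Phi> y) = c (\<Phi> x))"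
    have "y \<in> Z' \<and> c (\<Phi> y) = c (\<Phi> x)"
      unfolding y_def using that by (intro someI_ex[where P = "\<lambda>y. y \<in> Z' \<and> c (\<Phi> y) = c (\<Phi> x)"]) blast
    then have "c' y = c' x"
      using c_\<Phi>[of y x] that by simp
    then show ?thesis
      by (simp add: f_def y_def)
  qed
  have "f \<in> module_homs type_ring Q Q'"
    unfolding module_homs_def carQ car
    using Z'_add by (auto simp: f Q_def Q'_def ops ops' \<Phi>[symmetric])
  moreover have "bij_betw f (carrier Q) (carrier Q')"
    unfolding bij_betw_def
  proof
    show "inj_on f (carrier Q)"
      unfolding carQ by (auto simp: inj_on_def f c_\<Phi>)
    show "f ` carrier Q = carrier Q'"
      unfolding carQ car by (auto simp: f image_image)
  qed
  ultimately show ?thesis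
    unfolding module_isomorphic_def cohomology_def Q_def Q'_def Z_def Z'_def B_def B'_def by blast
qed

text \<open>A transposition is a product of an odd number of adjacent ones. Standard cochains
  control adjacent exchanges, Chevalley-Eilenberg cochains demand all transpositions.\<close>

lemma alternating_swap:
  fixes V :: "'a list \<Rightarrow> 'v::ab_group_add"
  assumes adjacent: "\<And>xs x y ys. V (xs @ x # y # ys) = - V (xs @ y # x # ys)"
    and "i < j" "j < length es"
  shows "V (es[i := es ! j, j := es ! i]) = - V es"
proof -
  have swap: "V (xs @ x # ys @ y # zs) = - V (xs @ y # ys @ x # zs)" for xs x ys y zs
  proof (induction ys arbitrary: xs)
    case Nil
    show ?case
      unfolding append_Nil by (rule adjacent)
  next
    case (Cons z ys)
    have "V (xs @ x # (z # ys) @ y # zs) = - V ((xs @ [z]) @ x # ys @ y # zs)"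
      using adjacent[of xs x z] by simp
    also have "\<dots> = V (xs @ z # y # ys @ x # zs)"
      unfolding Cons.IH by simp
    also have "\<dots> = - V (xs @ y # (z # ys) @ x # zs)"
      using adjacent[of xs z y] by simp
    finally show ?case .
  qed
  define xs where "xs = take i es"
  define ys where "ys = take (j - i - 1) (drop (Suc i) es)"
  define zs where "zs = drop (Suc j) es"
  have ij: "i = length xs" "j = length xs + Suc (length ys)"
    using assms(2,3) by (simp_all add: xs_def ys_def zs_def)
  have "drop (Suc i) es = ys @ es ! j # zs"
    using id_take_nth_drop[of "j - i - 1" "drop (Suc i) es"] assms(2,3)
    by (simp add: xs_def ys_def zs_def)
  then have es: "es = xs @ es ! i # ys @ es ! j # zs"
    using id_take_nth_drop[of i es] assms(2,3) by (simp add: xs_def ys_def zs_def)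
  obtain x y where xy: "x = es ! i" "y = es ! j"
    by simp
  have "es[i := y, j := x] = (xs @ x # ys @ y # zs)[i := y, j := x]"
    using es xy by simp
  also have "\<dots> = xs @ y # ys @ x # zs"
    unfolding ij by (simp add: list_update_append)
  finally show ?thesis
    using swap[of xs x ys y zs] es xy by simp
qed

text \<open>For the position of the bracket: \<open>std_d0\<close> leaves it in the place of the
  later argument, \<open>ce_d\<close> puts it in front.\<close>

lemma alternating_move_front:
  fixes V :: "'a list \<Rightarrow> 'v::ab_group_add"
  assumes "Modules.module scale"
    and adjacent: "\<And>xs x y ys. V (xs @ x # y # ys) = - V (xs @ y # x # ys)"
  shows "V (xs @ y # ys) = scale ((- 1) ^ length xs) (V (y # xs @ ys))"
proof -
  interpret Modules.module scale by fact
  show ?thesis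
  proof (induction xs arbitrary: ys rule: rev_induct)
    case (snoc x xs)
    then show ?case
      using adjacent[of xs x y ys] by simp
  qed simp
qed

context h_complex
begin

section \<open>The quotient E / H with its bracket and action\<close>

definition coset :: "'e \<Rightarrow> 'e set"
  where "coset x = (+) x ` H"

abbreviation EmodH :: "('r, 'e set) module"
  where "EmodH \<equiv> quotient_module scaleE UNIV H"

lemma coset_eq: "coset x = coset y \<longleftrightarrow> x - y \<in> H"
  unfolding coset_def by (rule coset_eq_iff) auto

lemma carrier_quotient: "carrier EmodH = range coset"
  by (simp add: quotient_module_def coset_def)

lemma map_coset_subset: "set (map coset es) \<subseteq> carrier EmodH"
  by (auto simp: carrier_quotient)

lemma list_of_cosets:
  assumes "set Xs \<subseteq> carrier EmodH"
  obtains es where "Xs = map coset es"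
  using assms unfolding carrier_quotient by (metis ex_map_conv subsetD imageE)

lemma quotient_ops:
  "coset x \<oplus>\<^bsub>EmodH\<^esub> coset y = coset (x + y)" "f \<odot>\<^bsub>EmodH\<^esub> coset x = coset (f *\<^sub>E x)"
  unfolding coset_def
  by (rule quotient_module_add[OF E.module_axioms subspace_H]
      quotient_module_smult[OF E.module_axioms subspace_H])+

lemma quotient_bracket_coset: "quotient_bracket bracket H (coset x) (coset y) = coset (x \<circ>\<^sub>E y)"
proof -
  have "coset ((x + \<alpha>) \<circ>\<^sub>E (y + \<beta>)) = coset (x \<circ>\<^sub>E y)" if "\<alpha> \<in> H" "\<beta> \<in> H" for \<alpha> \<beta>
  proof -
    have "(x + \<alpha>) \<circ>\<^sub>E (y + \<beta>) - x \<circ>\<^sub>E y = x \<circ>\<^sub>E \<beta> + (\<alpha> \<circ>\<^sub>E y + \<alpha> \<circ>\<^sub>E \<beta>)"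
      by (simp add: algebra_simps)
    also have "\<dots> \<in> H"
      using that by blast
    finally show ?thesis
      by (simp add: coset_eq)
  qed
  then have "quotient_bracket bracket H (coset x) (coset y) = (\<Union>\<alpha>\<in>H. \<Union>\<beta>\<in>H. coset (x \<circ>\<^sub>E y))"
    unfolding quotient_bracket_def by (simp add: coset_def)
  then show ?thesis
    using H_closed(1) by auto
qed

lemma quotient_action_coset: "quotient_action nabla (coset x) v = \<nabla> x v"
proof -
  have "(\<lambda>e. \<nabla> e v) ` coset x = {\<nabla> x v}"
    using H_closed(1) by (auto simp: coset_def nabla_H image_image)
  then show ?thesis
    by (simp add: quotient_action_def)
qed

section \<open>Pullbacks are the horizontal cochains\<close>

definition pullback :: "('e set list \<Rightarrow> 'v) \<Rightarrow> ('e, 'v) form"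
  where "pullback \<eta> = (\<lambda>es as. if as = {#} then \<eta> (map coset es) else 0)"

lemma pullback_add: "pullback (\<eta> + \<theta>) = pullback \<eta> + pullback \<theta>"
  by (simp add: pullback_def fun_eq_iff)

lemma pullback_zero: "pullback 0 = 0"
  by (simp add: pullback_def fun_eq_iff)

lemma pullback_scale:
  "pullback (\<lambda>Xs. restrict_scalars scaleK scaleV c (\<eta> Xs)) = scale_form (c *\<^sub>K 1) (pullback \<eta>)"
  by (simp add: pullback_def scale_form_def restrict_scalars_def fun_eq_iff)

text \<open>A pullback has no component with k > 0, so all correction terms vanish and the
  conditions on a cochain become skew-symmetry and R-multilinearity.\<close>

lemma
  assumes \<eta>: "\<eta> \<in> ce_cochains EmodH scaleV n"
  shows cochain_pullback: "cochain (pullback \<eta>)"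
    and homogeneous_pullback: "homogeneous (int n) (pullback \<eta>)"
    and horizontal_pullback: "horizontal (pullback \<eta>)"
proof -
  have add: "\<eta> (map coset xs @ coset (x + y) # Ys) = \<eta> (map coset xs @ coset x # Ys) + \<eta> (map coset xs @ coset y # Ys)"
    and scale: "\<eta> (map coset xs @ coset (f *\<^sub>E x) # Ys) = f *\<^sub>V \<eta> (map coset xs @ coset x # Ys)"
    for xs x y f Ys
    using \<eta> unfolding ce_cochains_def by (auto simp: carrier_quotient quotient_ops)
  have skew: "\<eta> (map coset xs @ coset x # coset y # Ys) + \<eta> (map coset xs @ coset y # coset x # Ys) = 0"
    for xs x y Ys
  proof -
    have "\<forall>Xs i j. i < j \<longrightarrow> j < length Xs \<longrightarrow> \<eta> (Xs[i := Xs ! j, j := Xs ! i]) = - \<eta> Xs"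
      using \<eta> unfolding ce_cochains_def by blast
    from this[rule_format, of "length xs" "Suc (length xs)" "map coset xs @ coset x # coset y # Ys"]
    show ?thesis
      by (simp add: list_update_append nth_append)
  qed
  show "cochain (pullback \<eta>)"
  proof (rule cochain_coinduct[where P = "\<lambda>W. \<exists>xs. W = (\<lambda>es. pullback \<eta> (xs @ es))"])
    show "\<exists>xs. pullback \<eta> = (\<lambda>es. pullback \<eta> (xs @ es))"
      by (rule exI[of _ "[]"]) simp
  next
    fix W :: "('e, 'v) form" and x
    assume "\<exists>xs. W = (\<lambda>es. pullback \<eta> (xs @ es))"
    then obtain xs where "W = (\<lambda>es. pullback \<eta> (xs @ es))"
      by blast
    then have "contract x W = (\<lambda>es. pullback \<eta> ((xs @ [x]) @ es))"
      by (simp add: contract_def)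
    then show "\<exists>xs. contract x W = (\<lambda>es. pullback \<eta> (xs @ es))"
      by blast
  next
    fix W :: "('e, 'v) form"
    assume "\<exists>xs. W = (\<lambda>es. pullback \<eta> (xs @ es))"
    then obtain xs where W: "W = (\<lambda>es. pullback \<eta> (xs @ es))"
      by blast
    have H0: "contractH \<alpha> W = 0" for \<alpha>
      by (simp add: fun_eq_iff W contractH_def pullback_def)
    show "cochain_head W"
      unfolding cochain_head_def H0
      by (auto simp: W fun_eq_iff contract_def pullback_def scale_form_def add scale skew)
  qed
  show "homogeneous (int n) (pullback \<eta>)"
    using \<eta> by (auto simp: homogeneous_def pullback_def ce_cochains_def)
  have "\<eta> (map coset es) = 0" if e: "e \<in> set es" "e \<in> H" for e es
  proof -
    obtain xs ys where "es = xs @ e # ys"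
      using split_list[OF e(1)] by blast
    \<comment> \<open>Scaling by 0 exhibits the zero coset, so that R-linearity makes the value
      zero.\<close>
    moreover have "coset e = coset (0 *\<^sub>E e)"
      using e(2) by (simp add: coset_eq)
    ultimately show ?thesis
      using scale[of xs 0 e "map coset ys"] by simp
  qed
  then show "horizontal (pullback \<eta>)"
    by (auto simp: horizontal_def pullback_def)
qed

text \<open>The correction term has an argument on the H-side and is zero by horizontality.\<close>

lemma horizontal_skew:
  assumes "cochain W" "horizontal W"
  shows "W (xs @ x # y # ys) as = - W (xs @ y # x # ys) as"
proof -
  define V where "V = (\<lambda>es. W (xs @ es))"
  have "cochain V"
    unfolding V_def by (rule cochain_prefix[OF assms(1)])
  moreover have "contractH (\<partial> \<langle>y, x\<rangle>) V = 0"
    using assms(2) by (simp add: V_def horizontal_def contractH_def fun_eq_iff)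
  ultimately have "contract y (contract x V) = - contract x (contract y V)"
    by (simp add: contract_contract[of V y x])
  from arg_cong[OF this, of "\<lambda>U. U ys as"] show ?thesis
    by (simp add: V_def contract_def)
qed

text \<open>Entries are exchanged one at a time; the error is a value with the entry
  \<open>x - y\<close> in H.\<close>

lemma horizontal_coset_cong:
  assumes "cochain W" "horizontal W" "map coset es = map coset es'"
  shows "W es as = W es' as"
  using assms
proof (induction es arbitrary: W es')
  case (Cons x es)
  then obtain y ys where es': "es' = y # ys" "coset x = coset y" "map coset es = map coset ys"
    by (cases es') auto
  have "horizontal (contract x W)"
    using Cons.prems(2) by (auto simp: horizontal_def contract_def)
  then have "W (x # es) as = W (x # ys) as"
    using Cons.IH[OF cochain_contract[OF Cons.prems(1)] _ es'(3)] by (simp add: contract_def)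
  also have "\<dots> = W (y # ys) as + W ((x - y) # ys) as"
    using arg_cong[OF contract_diff_left[OF Cons.prems(1), of x y], of "\<lambda>U. U ys as"]
    by (simp add: contract_def)
  also have "W ((x - y) # ys) as = 0"
    using Cons.prems(2) es'(2) by (simp add: horizontal_def coset_eq)
  finally show ?case
    using es' by simp
qed simp

lemma horizontal_imp_pullback:
  assumes W: "cochain W" "homogeneous (int n) W" "horizontal W"
  obtains \<eta> where "\<eta> \<in> ce_cochains EmodH scaleV n" "W = pullback \<eta>"
proof -
  \<comment> \<open>Representatives are chosen arbitrarily; by \<open>horizontal_coset_cong\<close>
    the value does not depend on them.\<close>
  define \<eta> where "\<eta> Xs = (if set Xs \<subseteq> carrier EmodH
    then W (map (\<lambda>X. SOME x. coset x = X) Xs) {#} else 0)" for Xs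
  have \<eta>: "\<eta> (map coset es) = W es {#}" for es
  proof -
    have "coset (SOME y. coset y = coset x) = coset x" for x
      by (rule someI) simp
    then have "map coset (map (\<lambda>X. SOME x. coset x = X) (map coset es)) = map coset es"
      by simp
    then have "W (map (\<lambda>X. SOME x. coset x = X) (map coset es)) {#} = W es {#}"
      by (rule horizontal_coset_cong[OF W(1,3)])
    then show ?thesis
      using map_coset_subset[of es] by (simp only: \<eta>_def if_True)
  qed
  have zero: "\<eta> Xs = 0" if "\<not> set Xs \<subseteq> carrier EmodH" for Xs
    using that by (simp add: \<eta>_def)
  have add: "W (xs @ (x + y) # ys) {#} = W (xs @ x # ys) {#} + W (xs @ y # ys) {#}"
    and scale: "W (xs @ (f *\<^sub>E x) # ys) {#} = f *\<^sub>V W (xs @ x # ys) {#}" for xs x y f ys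
  proof -
    define V where "V = (\<lambda>es. W (xs @ es))"
    have V: "cochain V"
      unfolding V_def by (rule cochain_prefix[OF W(1)])
    have "contractH (\<partial> f) V = 0"
      using W(3) by (simp add: V_def horizontal_def contractH_def fun_eq_iff)
    with contract_scale_left[OF V, of f x] have "contract (f *\<^sub>E x) V = scale_form f (contract x V)"
      by simp
    from arg_cong[OF this, of "\<lambda>U. U ys {#}"]
    show "W (xs @ (f *\<^sub>E x) # ys) {#} = f *\<^sub>V W (xs @ x # ys) {#}"
      by (simp add: V_def contract_def scale_form_def)
    show "W (xs @ (x + y) # ys) {#} = W (xs @ x # ys) {#} + W (xs @ y # ys) {#}"
      using arg_cong[OF contract_add_left[OF V, of x y], of "\<lambda>U. U ys {#}"]
      by (simp add: V_def contract_def)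
  qed
  have "\<eta> \<in> ce_cochains EmodH scaleV n"
    unfolding ce_cochains_def
  proof (intro CollectI conjI allI ballI impI)
    fix Xs
    assume *: "\<not> (length Xs = n \<and> set Xs \<subseteq> carrier EmodH)"
    show "\<eta> Xs = 0"
    proof (cases "set Xs \<subseteq> carrier EmodH")
      case True
      then obtain es where "Xs = map coset es"
        by (rule list_of_cosets)
      then show ?thesis
        using * map_coset_subset[of es] homogeneousD[OF W(2), of es "{#}"] by (simp add: \<eta>)
    qed (rule zero)
  next
    fix Xs Ys X Y
    assume X: "X \<in> carrier EmodH" and Y: "Y \<in> carrier EmodH"
    show "\<eta> (Xs @ (X \<oplus>\<^bsub>EmodH\<^esub> Y) # Ys) = \<eta> (Xs @ X # Ys) + \<eta> (Xs @ Y # Ys)"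
    proof (cases "set Xs \<subseteq> carrier EmodH \<and> set Ys \<subseteq> carrier EmodH")
      case True
      then obtain xs ys x y where "Xs = map coset xs" "Ys = map coset ys" "X = coset x" "Y = coset y"
        using X Y list_of_cosets unfolding carrier_quotient by (metis imageE)
      then show ?thesis
        using \<eta>[of "xs @ (x + y) # ys"] \<eta>[of "xs @ x # ys"] \<eta>[of "xs @ y # ys"] add
        by (simp add: quotient_ops)
    next
      case False
      then show ?thesis
        by (subst (1 2 3) zero) auto
    qed
  next
    fix f Xs Ys X
    assume X: "X \<in> carrier EmodH"
    show "\<eta> (Xs @ (f \<odot>\<^bsub>EmodH\<^esub> X) # Ys) = f *\<^sub>V \<eta> (Xs @ X # Ys)"
    proof (cases "set Xs \<subseteq> carrier EmodH \<and> set Ys \<subseteq> carrier EmodH")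
      case True
      then obtain xs ys x where "Xs = map coset xs" "Ys = map coset ys" "X = coset x"
        using X list_of_cosets unfolding carrier_quotient by (metis imageE)
      then show ?thesis
        using \<eta>[of "xs @ (f *\<^sub>E x) # ys"] \<eta>[of "xs @ x # ys"] scale by (simp add: quotient_ops)
    next
      case False
      then show ?thesis
        by (subst (1 2) zero) auto
    qed
  next
    fix Xs :: "'e set list" and i j
    assume ij: "i < j" "j < length Xs"
    show "\<eta> (Xs[i := Xs ! j, j := Xs ! i]) = - \<eta> Xs"
    proof (cases "set Xs \<subseteq> carrier EmodH")
      case True
      then obtain es where es: "Xs = map coset es"
        by (rule list_of_cosets)
      then have "Xs[i := Xs ! j, j := Xs ! i] = map coset (es[i := es ! j, j := es ! i])"
        using ij by (simp add: map_update)
      then show ?thesis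
        using alternating_swap[of "\<lambda>es. W es {#}" i j es, OF horizontal_skew[OF W(1,3)]] ij
        by (simp add: es \<eta> del: map_update)
    next
      case False
      then show ?thesis
        using ij by (subst (1 2) zero) (simp_all add: set_swap)
    qed
  qed
  moreover have "W = pullback \<eta>"
    using W(3) by (auto simp: fun_eq_iff pullback_def \<eta> horizontal_def)
  ultimately show ?thesis
    by (rule that)
qed

text \<open>A pullback sees only lists of cosets; outside them agreement has to be assumed.\<close>

lemma pullback_inj:
  assumes "pullback \<eta> = pullback \<theta>"
    and "\<And>Xs. \<not> set Xs \<subseteq> carrier EmodH \<Longrightarrow> \<eta> Xs = \<theta> Xs"
  shows "\<eta> = \<theta>"
proof
  fix Xs
  show "\<eta> Xs = \<theta> Xs"
  proof (cases "set Xs \<subseteq> carrier EmodH")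
    case True
    then obtain es where "Xs = map coset es"
      by (rule list_of_cosets)
    then show ?thesis
      using fun_cong[OF fun_cong[OF assms(1)], of es "{#}"] by (simp add: pullback_def)
  qed (rule assms(2))
qed

abbreviation quotient_d :: "('e set list \<Rightarrow> 'v) \<Rightarrow> 'e set list \<Rightarrow> 'v"
  where "quotient_d \<equiv> ce_d EmodH (quotient_bracket bracket H) scaleV (quotient_action nabla)"

text \<open>Once the earlier entry a is omitted, position b has become \<open>b - 1\<close>, the
  length of the prefix that the bracket must cross.\<close>

lemma omit_update:
  assumes "a < b" "b < length es"
  shows "omit a (es[b := z]) = take (b - 1) (omit a es) @ z # drop b (omit a es)"
    and "omit a (omit b es) = take (b - 1) (omit a es) @ drop b (omit a es)"
  using assms by (auto intro!: nth_equalityI simp: omit_def nth_append nth_list_update min_def add.commute)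

lemma differential_pullback:
  assumes \<eta>: "\<eta> \<in> ce_cochains EmodH scaleV n"
  shows "differential (pullback \<eta>) = pullback (quotient_d \<eta>)"
proof (intro ext)
  fix es as
  let ?W = "pullback \<eta>"
  note W = cochain_pullback[OF \<eta>] horizontal_pullback[OF \<eta>]
  have map_omit: "map coset (omit a es) = omit a (map coset es)" for a es
    by (simp add: omit_def take_map drop_map)
  consider "as = {#}" | "as \<noteq> {#}" "set_mset as \<subseteq> H" | "as \<noteq> {#}" "\<not> set_mset as \<subseteq> H"
    by blast
  then show "differential ?W es as = pullback (quotient_d \<eta>) es as"
  proof cases
    case 1
    have "(- 1) ^ (a + 1) *\<^sub>V \<eta> (map coset (omit a (es[b := es ! a \<circ>\<^sub>E es ! b]))) =
        (- 1) ^ (a + b) *\<^sub>V \<eta> (coset (es ! a \<circ>\<^sub>E es ! b) # omit a (omit b (map coset es)))"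
      if ab: "a < b" "b < length es" for a b
    proof -
      let ?z = "es ! a \<circ>\<^sub>E es ! b" and ?xs = "take (b - 1) (omit a es)" and ?ys = "drop b (omit a es)"
      have "?W (?xs @ ?z # ?ys) {#} = (- 1) ^ (length ?xs) *\<^sub>V ?W (?z # ?xs @ ?ys) {#}"
        by (rule alternating_move_front[where V = "\<lambda>es. ?W es {#}", OF V.module_axioms])
          (rule horizontal_skew[OF W])
      moreover have "length ?xs = b - 1"
        using ab by (simp add: omit_def)
      \<comment> \<open>The sign of \<open>std_d0\<close> times that of crossing
        \<open>b - 1\<close> entries is the sign in \<open>ce_d\<close>.\<close>
      moreover have "(- 1 :: 'r) ^ (a + 1) * (- 1) ^ (b - 1) = (- 1) ^ (a + b)"
        using ab by (cases b) (simp_all add: power_add)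
      ultimately show ?thesis
        using omit_update(1)[OF ab, of ?z] omit_update(2)[OF ab]
        by (simp add: pullback_def map_omit[symmetric] V.scale_scale del: power_Suc)
    qed
    then have "(\<Sum>b<length es. \<Sum>a<b. (- 1) ^ (a + 1) *\<^sub>V \<eta> (map coset (omit a (es[b := es ! a \<circ>\<^sub>E es ! b])))) =
        (\<Sum>b<length es. \<Sum>a<b. (- 1) ^ (a + b) *\<^sub>V
          \<eta> (coset (es ! a \<circ>\<^sub>E es ! b) # omit a (omit b (map coset es))))"
      by (intro sum.cong) auto
    also have "\<dots> = (\<Sum>b<length es. \<Sum>a<b. (- 1) ^ (a + b) *\<^sub>V
          \<eta> (quotient_bracket bracket H (map coset es ! a) (map coset es ! b) #
            omit a (omit b (map coset es))))"
      by (intro sum.cong) (auto simp: quotient_bracket_coset)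
    finally have brackets: "(\<Sum>b<length es. \<Sum>a<b. (- 1) ^ (a + 1) *\<^sub>V
          \<eta> (map coset (omit a (es[b := es ! a \<circ>\<^sub>E es ! b])))) = \<dots>" .
    have actions: "(\<Sum>a<length es. (- 1) ^ a *\<^sub>V \<nabla> (es ! a) (\<eta> (map coset (omit a es)))) =
        (\<Sum>a<length es. (- 1) ^ a *\<^sub>V
          quotient_action nabla (map coset es ! a) (\<eta> (omit a (map coset es))))"
      by (intro sum.cong) (auto simp: quotient_action_coset map_omit)
    have "differential ?W es as =
        (\<Sum>a<length es. (- 1) ^ a *\<^sub>V \<nabla> (es ! a) (\<eta> (map coset (omit a es)))) +
        (\<Sum>b<length es. \<Sum>a<b. (- 1) ^ (a + 1) *\<^sub>V
          \<eta> (map coset (omit a (es[b := es ! a \<circ>\<^sub>E es ! b]))))"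
      using 1 by (subst differential_eq_sum[OF W(1)]) (simp_all add: pullback_def)
    also have "\<dots> = quotient_d \<eta> (map coset es)"
      unfolding brackets actions by (simp only: ce_d_def map_coset_subset if_True length_map)
    finally show ?thesis
      using 1 by (simp add: pullback_def)
  next
    case 2
    \<comment> \<open>The only term reaching the component k = 0 is \<delta>, and it puts an element
      of H among the arguments from E.\<close>
    have "removal_sum (\<lambda>\<alpha> bs. ?W (\<alpha> # es) bs) as = removal_sum (\<lambda>_ _. 0) as"
      using 2 W(2) by (intro removal_sum_cong) (auto simp: horizontal_def)
    then show ?thesis
      using 2 by (subst differential_eq_sum[OF W(1)]) (simp_all add: pullback_def)
  next
    case 3
    then show ?thesis
      using supportedD[OF cochain_supported[OF cochain_differential[OF W(1)]]]
      by (simp add: pullback_def)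
  qed
qed

end

context h_splitting
begin

lemma std_ce_cohomology_isomorphic:
  "module_isomorphic type_ring (std_cohomology scaleK scaleE pairing der bracket H scaleV nabla n)
    (ce_cohomology scaleK EmodH (quotient_bracket bracket H) scaleV (quotient_action nabla) n)"
  unfolding std_cohomology_def ce_cohomology_def
proof (rule cohomology_isomorphic[where \<Phi> = "\<lambda>\<eta>. to_seq (pullback \<eta>)"])
  let ?s = "\<lambda>c \<omega> k es as. restrict_scalars scaleK scaleV c (\<omega> k es as)"
  let ?s' = "\<lambda>c \<eta> xs. restrict_scalars scaleK scaleV c (\<eta> xs)"
  let ?C = "std_cochains scaleK scaleE pairing der H scaleV" and ?C' = "ce_cochains EmodH scaleV"
  let ?d = "std_d bracket H scaleV nabla"
  have vs: "vector_space (restrict_scalars scaleK scaleV)"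
    using nabla_linear_right by (rule Vector_Spaces.linear.axioms)
  interpret R: vector_space "restrict_scalars scaleK scaleV"
    by (rule vs)
  show s: "Modules.module ?s" and s': "Modules.module ?s'"
    by (simp_all add: Modules.module_def fun_eq_iff R.scale_right_distrib R.scale_left_distrib)
  have s_to_seq: "?s c (to_seq W) = to_seq (scale_form (c *\<^sub>K 1) W)" for c W
    by (simp add: to_seq_def scale_form_def restrict_scalars_def fun_eq_iff)
  show "module.subspace ?s (?C m)" for m
    unfolding module.subspace_def[OF s] std_cochains_eq
    by (auto simp: s_to_seq cochain_scale homogeneous_scale
        intro!: image_eqI[of _ to_seq] cochain_add homogeneous_add
        simp flip: to_seq_linear)
  show subspace': "module.subspace ?s' (?C' m)" for m
    unfolding module.subspace_def[OF s'] ce_cochains_def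
    by (simp add: restrict_scalars_def V.scale_right_distrib mult.commute)
  show "?d (x + y) = ?d x + ?d y" if "x \<in> ?C m" "y \<in> ?C m" for m x y
    using that unfolding std_cochains_eq
    by (auto simp: std_d_to_seq cochain_add simp flip: to_seq_linear)
  show "?d (?s c x) = ?s c (?d x)" if "x \<in> ?C m" for m c x
    using that unfolding std_cochains_eq
    by (auto simp: s_to_seq std_d_to_seq cochain_scale differential_scale_const cochain_supported)
  \<comment> \<open>Linearity of \<open>quotient_d\<close> is inherited from
    \<open>differential\<close> along the injective pullback.\<close>
  show qd_add: "quotient_d (x + y) = quotient_d x + quotient_d y" if "x \<in> ?C' m" "y \<in> ?C' m" for m x y
  proof (rule pullback_inj)
    have "x + y \<in> ?C' m"
      using module.subspace_add[OF s' subspace'] that by blast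
    then have "pullback (quotient_d (x + y)) = differential (pullback x + pullback y)"
      by (simp add: differential_pullback flip: pullback_add)
    also have "\<dots> = pullback (quotient_d x + quotient_d y)"
      using that by (simp add: differential_pullback pullback_add)
    finally show "pullback (quotient_d (x + y)) = pullback (quotient_d x + quotient_d y)" .
  qed (simp add: ce_d_def)
  show "quotient_d (?s' c x) = ?s' c (quotient_d x)" if "x \<in> ?C' m" for m c x
  proof (rule pullback_inj)
    have "?s' c x \<in> ?C' m"
      using module.subspace_scale[OF s' subspace'] that by blast
    then have "pullback (quotient_d (?s' c x)) = differential (scale_form (c *\<^sub>K 1) (pullback x))"
      by (simp add: differential_pullback flip: pullback_scale)
    also have "\<dots> = pullback (?s' c (quotient_d x))"
      using that by (simp add: differential_pullback pullback_scale differential_scale_const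
        cochain_supported cochain_pullback)
    finally show "pullback (quotient_d (?s' c x)) = pullback (?s' c (quotient_d x))" .
  qed (simp add: ce_d_def)
  show "to_seq (pullback (x + y)) = to_seq (pullback x) + to_seq (pullback y)" for x y
    by (simp add: pullback_add to_seq_linear)
  show "to_seq (pullback (?s' c x)) = ?s c (to_seq (pullback x))" for c x
    by (simp add: pullback_scale s_to_seq)
  show "to_seq (pullback x) \<in> ?C m" if "x \<in> ?C' m" for x m
    using cochain_pullback[OF that] homogeneous_pullback[OF that] by (simp add: std_cochains_eq)
  show "?d (to_seq (pullback x)) = to_seq (pullback (quotient_d x))" if "x \<in> ?C' m" for x m
    using that by (simp add: std_d_to_seq cochain_pullback differential_pullback)
  have zero_off: "x Xs = 0" if "x \<in> ?C' m" "\<not> set Xs \<subseteq> carrier EmodH" for x m Xs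
    using that unfolding ce_cochains_def by blast
  let ?B = "\<lambda>n. case n of 0 \<Rightarrow> {0} | Suc m \<Rightarrow> ?d ` ?C m"
  show "x \<in> (case m of 0 \<Rightarrow> {0} | Suc l \<Rightarrow> quotient_d ` ?C' l)"
    if x: "x \<in> ?C' m" "quotient_d x = 0" "to_seq (pullback x) \<in> ?B m" for x m
  proof (cases m)
    case 0
    with x(3) have "pullback x = pullback 0"
      by (simp add: pullback_zero flip: to_seq_linear)
    then have "x = 0"
      by (rule pullback_inj) (simp add: zero_off[OF x(1)])
    then show ?thesis
      using 0 by simp
  next
    case (Suc l)
    with x(3) obtain W where W: "cochain W" "homogeneous (int l) W" "pullback x = differential W"
      by (auto simp: std_cochains_eq std_d_to_seq)
    \<comment> \<open>\<open>W\<close> is no cocycle, but its differential is a pullback and so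
      lives in k = 0. Making \<open>W\<close> horizontal turns it into a Chevalley-Eilenberg
      primitive of \<open>x\<close>.\<close>
    have "differential W es as = 0" if "as \<noteq> {#}" for es as
      using W(3)[symmetric] that by (simp add: pullback_def)
    then obtain U where U: "cochain U" "homogeneous (int l - 1) U" "horizontal (W - differential U)"
      using horizontal_representative[OF W(1,2)] by metis
    obtain y where y: "y \<in> ?C' l" "W - differential U = pullback y"
    proof (rule horizontal_imp_pullback[OF _ _ U(3)])
      show "cochain (W - differential U)" "homogeneous (int l) (W - differential U)"
        using W U homogeneous_differential[OF U(2)]
        by (simp_all add: cochain_diff cochain_differential homogeneous_diff)
    qed
    have "pullback x = differential (W - differential U)"
      using W(3) U(1) by (simp add: differential_differential)
    also have "\<dots> = pullback (quotient_d y)"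
      using y differential_pullback by simp
    finally have "x = quotient_d y"
      by (rule pullback_inj) (simp add: zero_off[OF x(1)] ce_d_def)
    then show ?thesis
      using y(1) Suc by simp
  qed
  show "\<exists>x\<in>?C' m. quotient_d x = 0 \<and> w - to_seq (pullback x) \<in> ?B m"
    if w: "w \<in> ?C m" "?d w = 0" for w m
  proof -
    obtain W where W: "w = to_seq W" "cochain W" "homogeneous (int m) W"
      using w(1) by (auto simp: std_cochains_eq)
    have "to_seq (differential W) = to_seq 0"
      using w(2) W by (simp add: std_d_to_seq to_seq_linear)
    then have closed: "differential W = 0"
      by simp
    obtain U where U: "cochain U" "homogeneous (int m - 1) U" "horizontal (W - differential U)"
      using horizontal_representative[OF W(2,3)] closed by (metis zero_fun_apply)
    obtain x where x: "x \<in> ?C' m" "W - differential U = pullback x"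
    proof (rule horizontal_imp_pullback[OF _ _ U(3)])
      show "cochain (W - differential U)" "homogeneous (int m) (W - differential U)"
        using W U homogeneous_differential[OF U(2)]
        by (simp_all add: cochain_diff cochain_differential homogeneous_diff)
    qed
    have "pullback (quotient_d x) = differential (W - differential U)"
      using x differential_pullback by simp
    also have "\<dots> = pullback 0"
      using closed U(1) by (simp add: differential_differential pullback_zero)
    finally have "quotient_d x = 0"
      by (rule pullback_inj) (simp add: ce_d_def)
    moreover have "w - to_seq (pullback x) = ?d (to_seq U)"
      using x(2)[symmetric] U(1) W(1) by (simp add: std_d_to_seq flip: to_seq_linear)
    moreover have "?d (to_seq U) \<in> ?B m"
    proof (cases m)
      case 0
      \<comment> \<open>\<open>U\<close> has degree - 1 here, so the representative is already
        horizontal, in accordance with zero coboundaries in degree 0.\<close>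
      then have "U = 0"
        using U(2) by (intro ext) (simp add: homogeneous_def)
      then show ?thesis
        using 0 std_d_to_seq[OF U(1)] by (simp add: to_seq_linear(3))
    next
      case (Suc l)
      then show ?thesis
        using U by (auto simp: std_cochains_eq)
    qed
    ultimately show ?thesis
      using x(1) by auto
  qed
qed
end

theorem theorem4p1:
  fixes scaleK :: "'k::field \<Rightarrow> 'r::comm_ring_1 \<Rightarrow> 'r"
    and scaleE :: "'r \<Rightarrow> 'e::ab_group_add \<Rightarrow> 'e"
    and pairing :: "'e \<Rightarrow> 'e \<Rightarrow> 'r"
    and der :: "'r \<Rightarrow> 'e"
    and bracket :: "'e \<Rightarrow> 'e \<Rightarrow> 'e"
    and H :: "'e set"
    and scaleV :: "'r \<Rightarrow> 'v::ab_group_add \<Rightarrow> 'v"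
    and nabla :: "'e \<Rightarrow> 'v \<Rightarrow> 'v"
  assumes "courant_dorfman_algebra scaleK scaleE pairing der bracket"
    and "module.subspace scaleE H"
    and "range der \<subseteq> H"
    and "isotropic_ideal pairing bracket H"
    and "h_representation scaleK scaleE pairing der bracket H scaleV nabla"
    and "projective_module type_ring (quotient_module scaleE UNIV H)"
  shows "\<forall>n. module_isomorphic type_ring
    (std_cohomology scaleK scaleE pairing der bracket H scaleV nabla n)
    (ce_cohomology scaleK (quotient_module scaleE UNIV H) (quotient_bracket bracket H)
      scaleV (quotient_action nabla) n)"
proof -
  interpret h_complex scaleK scaleE pairing der bracket H scaleV nabla
    using assms(1-5) by (simp add: h_complex_def h_complex_axioms_def)
  \<comment> \<open>E itself as a module record, the source of the surjection onto the quotient to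
    be split.\<close>
  define N :: "('r, 'e) module" where
    "N = \<lparr>carrier = UNIV, monoid.mult = undefined, one = undefined, zero = 0, add = (+), smult = scaleE\<rparr>"
  have "abelian_group N"
  proof (rule abelian_groupI)
    fix x
    assume "x \<in> carrier N"
    show "\<exists>y\<in>carrier N. y \<oplus>\<^bsub>N\<^esub> x = \<zero>\<^bsub>N\<^esub>"
      by (rule bexI[of _ "- x"]) (simp_all add: N_def)
  qed (simp_all add: N_def add_ac)
  then have N: "module type_ring N"
    by (rule moduleI[OF cring_type_ring])
      (simp_all add: N_def type_ring_def E.scale_right_distrib E.scale_left_distrib)
  have Q: "module type_ring EmodH"
    using assms(6) unfolding projective_module_def by blast
  have "coset \<in> module_homs type_ring N EmodH"
    unfolding module_homs_def by (simp add: N_def carrier_quotient quotient_ops)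
  moreover have "coset ` carrier N = carrier EmodH"
    by (simp add: N_def carrier_quotient)
  moreover have "(\<lambda>X. X) \<in> module_homs type_ring EmodH EmodH"
    by (auto simp: module_homs_def)
  \<comment> \<open>Lifting the identity of E / H along the quotient map gives an R-linear
    section.\<close>
  ultimately obtain \<sigma> where \<sigma>: "\<sigma> \<in> module_homs type_ring EmodH N"
    "\<And>X. X \<in> carrier EmodH \<Longrightarrow> coset (\<sigma> X) = X"
    using projective_module_lift[OF assms(6) N Q] by meson
  have \<sigma>_add: "\<sigma> (coset (x + y)) = \<sigma> (coset x) + \<sigma> (coset y)" for x y
    using \<sigma>(1) by (auto simp: module_homs_def carrier_quotient quotient_ops N_def)
  have \<sigma>_scale: "\<sigma> (coset (scaleE f x)) = scaleE f (\<sigma> (coset x))" for f x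
    using \<sigma>(1) by (auto simp: module_homs_def carrier_quotient quotient_ops N_def type_ring_def)
  have \<sigma>_H: "\<sigma> (coset \<alpha>) = 0" if "\<alpha> \<in> H" for \<alpha>
    using \<sigma>_add[of 0 0] that coset_eq[of \<alpha> 0] by simp
  \<comment> \<open>The projection onto H subtracts from x the chosen representative of its
    coset.\<close>
  interpret h_splitting scaleK scaleE pairing der bracket H scaleV nabla "\<lambda>x. x - \<sigma> (coset x)"
  proof
    show "x - \<sigma> (coset x) \<in> H" for x
      using \<sigma>(2)[of "coset x"] by (simp add: carrier_quotient flip: coset_eq)
  qed (simp_all add: \<sigma>_add \<sigma>_scale \<sigma>_H E.scale_right_diff_distrib)
  show ?thesis
    using std_ce_cohomology_isomorphic by blast
qed

end
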